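(* Let $I\subset\mathbb{R}$ be a compact interval, let $\psi:\mathbb{N}\to\mathbb{R}^+$ be monotonic, and let $f:I\to\mathbb{R}$ be weakly non-degenerate. Then the Lebesgue measure of $\mathcal{S}_f(\psi)$ is $0$ if $\sum_{q=1}^\infty\psi(q)^2<\infty$, and equals $|I|$ if $\sum_{q=1}^\infty\psi(q)^2=\infty$.
   Context: For $x\in\mathbb{R}$, $\|x\|=\min_{k\in\mathbb{Z}}|x-k|$. $\mathcal{S}_f(\psi)$ is the set of $x\in I$ for which there are infinitely many $q\in\mathbb{N}$ with $\max\{\|qx\|,\|qf(x)\|\}<\psi(q)$. For a compact interval $I_0$ and $0<c_1\le c_2$, $\mathcal{F}(I_0;c_1,c_2)$ is the set of $C^2$ functions $g:I_0\to\mathbb{R}$ with $c_1\le|g''|\le c_2$ on $I_0$, and $\overline{\mathcal{F}}(I_0;c_1,c_2)$ is its closure in $C(I_0)$ under the uniform norm. The function $f$ (equivalently its graph $\{(x,f(x)):x\in I\}$) is weakly non-degenerate at $x_0\in I$ if there exist constants $c_2\ge c_1>0$ and a compact interval $I_0\subset I$ centered at $x_0$ with $f|_{I_0}\in\overline{\mathcal{F}}(I_0;c_1,c_2)$; $f$ is weakly non-degenerate if it is weakly non-degenerate at Lebesgue-almost every $x_0\in I$. $|I|$ denotes the length of $I$. *)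

theory Defs
  imports "HOL-Analysis.Analysis"
begin

definition dist_nearest_int :: "real \<Rightarrow> real" where
  "dist_nearest_int x = (INF k::int. \<bar>x - of_int k\<bar>)"

text \<open>The infimum is attained, so it is the minimum over the integers.\<close>

lemma dist_nearest_int_attained: "\<exists>k::int. dist_nearest_int x = \<bar>x - of_int k\<bar>"
proof
  show "dist_nearest_int x = \<bar>x - of_int (round x)\<bar>"
    unfolding dist_nearest_int_def
    by (rule cInf_eq_minimum) (auto simp: round_diff_minimal)
qed

text \<open>Denominators \<open>q\<close> are positive integers; the value \<open>\<psi> 0\<close> is never used.\<close>

definition simult_approx_set :: "real set \<Rightarrow> (real \<Rightarrow> real) \<Rightarrow> (nat \<Rightarrow> real) \<Rightarrow> real set" where
  "simult_approx_set I f \<psi> =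
    {x \<in> I. infinite {q::nat. q \<ge> 1 \<and>
       max (dist_nearest_int (real q * x)) (dist_nearest_int (real q * f x)) < \<psi> q}}"

text \<open>The functions belong to the extensional function space over \<open>J\<close>, the carrier convention
  of \<^const>\<open>cfunspace\<close>. Derivatives at the endpoints of \<open>J\<close> are one-sided.\<close>

definition C2_curved :: "real set \<Rightarrow> real \<Rightarrow> real \<Rightarrow> (real \<Rightarrow> real) set" where
  "C2_curved J c1 c2 =
    {g \<in> extensional J. \<exists>g' g''.
       (\<forall>x\<in>J. (g has_real_derivative g' x) (at x within J)) \<and>
       (\<forall>x\<in>J. (g' has_real_derivative g'' x) (at x within J)) \<and>
       continuous_on J g'' \<and>
       (\<forall>x\<in>J. c1 \<le> \<bar>g'' x\<bar> \<and> \<bar>g'' x\<bar> \<le> c2)}"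

text \<open>On compact \<open>J\<close>, \<^const>\<open>cfunspace\<close> is the space of continuous functions on \<open>J\<close> with the
  supremum metric.\<close>

definition C2_curved_closure :: "real set \<Rightarrow> real \<Rightarrow> real \<Rightarrow> (real \<Rightarrow> real) set" where
  "C2_curved_closure J c1 c2 =
    mtopology_of (cfunspace (top_of_set J) euclidean_metric) closure_of C2_curved J c1 c2"

text \<open>The radius \<open>r\<close> is positive: the centred interval must be nondegenerate for the
  derivatives on it to be meaningful.\<close>

definition weakly_nondegenerate_at :: "real set \<Rightarrow> (real \<Rightarrow> real) \<Rightarrow> real \<Rightarrow> bool" where
  "weakly_nondegenerate_at I f x0 \<longleftrightarrow>
    (\<exists>c1 c2 r. 0 < c1 \<and> c1 \<le> c2 \<and> 0 < r \<and> {x0 - r..x0 + r} \<subseteq> I \<and>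
       restrict f {x0 - r..x0 + r} \<in> C2_curved_closure {x0 - r..x0 + r} c1 c2)"

definition weakly_nondegenerate :: "real set \<Rightarrow> (real \<Rightarrow> real) \<Rightarrow> bool" where
  "weakly_nondegenerate I f \<longleftrightarrow> (AE x0 in lebesgue_on I. weakly_nondegenerate_at I f x0)"

end

theory Submission
  imports Defs "HOL-Real_Asymp.Real_Asymp"
begin

text \<open>
  Locally \<open>f\<close> or \<open>- f\<close> has a derivative \<open>D\<close> that is increasing and bi-Lipschitz. To a rational point
  \<open>(p1/q, p2/q)\<close> and a parameter \<open>x\<close> one associates the vector with the coordinates \<open>q\<close>, \<open>q x - p1\<close>,
  \<open>q f x - p2 - D x (q x - p1)\<close>; these vectors form a unimodular lattice in three-space, and the
  dual lattice has the coordinates \<open>a0 + a1 x + a2 f x\<close>, \<open>a1 + a2 D x\<close>, \<open>a2\<close>. Quantitative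
  nondivergence in the style of Kleinbock and Margulis shows that, after rescaling the coordinates,
  the set of all \<open>x\<close> with a nonzero lattice vector of size \<open>\<epsilon>\<close> has measure \<open>O(sqrt \<epsilon>)\<close>.

  Convergence: for \<open>q\<close> of size \<open>Q\<close> split the interval into pieces of length \<open>Q powr (-5/6)\<close>. On each
  piece that contains a parameter without very short vectors, the number of relevant rational points
  is bounded by the volume of a box; the other pieces have summable measure. Then Borel--Cantelli
  applies.

  Divergence: Dirichlet's theorem together with nondivergence gives many well spaced rational points
  near the curve with \<open>q\<close> of exact order \<open>Q\<close>. The Kochen--Stone inequality shows that the limsup set
  meets every interval in a fixed proportion, hence has full measure.
\<close>

subsection \<open>Sublevel sets of functions on a curve\<close>

text \<open>The third lattice coordinate is measured from the tangent because an arc of length r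
  leaves its tangent by O(r^2) only: one box, long in the tangent direction, then catches every
  relevant rational point near the whole arc. The exponent -5/6 is a compromise. It makes Q r^2 =
  Q^(-2/3) smaller than the approximation radius, which is kept at least Q^(-3/5), while the box
  still has volume at least Q^(17/30), so that the exceptional sets shrink by a power of Q and are
  summable over dyadic Q. Radii below Q^(-3/5) are harmless in both halves of the theorem: with
  \<psi> = Q^(-3/5) the condensed series has the summable terms Q \<psi>^2 = Q^(-1/5). The obstacle
  is low regularity. A uniform limit of C^2 functions need not have a second derivative, so every
  estimate rests on the monotonicity of \<open>D\<close> and on two-sided quadratic Taylor bounds,
  which survive limits; goodness is therefore proved by comparing values at three points instead of
  using derivatives. An increasing \<psi> is settled by Dirichlet's theorem.\<close>

lemma three_spread_points:
  fixes S :: "real set"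
  assumes S: "compact S" and m: "0 < measure lebesgue S"
  obtains x y z where "x \<in> S" "y \<in> S" "z \<in> S"
    "measure lebesgue S \<le> 4 * (y - x)" "measure lebesgue S \<le> 4 * (z - y)"
proof -
  define m where "m = measure lebesgue S"
  have ne: "S \<noteq> {}" using m by auto
  obtain x where x: "x \<in> S" "\<And>t. t \<in> S \<Longrightarrow> x \<le> t"
    using compact_attains_inf[OF S ne] by blast
  obtain z where z: "z \<in> S" "\<And>t. t \<in> S \<Longrightarrow> t \<le> z"
    using compact_attains_sup[OF S ne] by blast
  \<comment> \<open>Otherwise the set lies in two end intervals of total length m/2.\<close>
  have "\<exists>y\<in>S. x + m/4 \<le> y \<and> y \<le> z - m/4"
  proof (rule ccontr)
    assume "\<not> ?thesis"
    then have sub: "S \<subseteq> {x..x + m/4} \<union> {z - m/4..z}"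
      using x z by force
    have "m \<le> measure lebesgue ({x..x + m/4} \<union> {z - m/4..z})"
      unfolding m_def by (rule measure_mono_fmeasurable) (use sub S in \<open>auto simp: m_def lmeasurable_compact fmeasurableD\<close>)
    also have "\<dots> \<le> measure lebesgue {x..x + m/4} + measure lebesgue {z - m/4..z}"
      by (rule measure_Un_le) auto
    also have "\<dots> = m/4 + m/4" using m by (simp add: m_def)
    finally show False using m by (simp add: m_def)
  qed
  then show thesis using that x(1) z(1) unfolding m_def by fastforce
qed

text \<open>This is the notion of a \<open>(C, 1/2)\<close>-good function, squared to avoid roots: a function that is large
  somewhere on an interval is small only on a small proportion of it.\<close>

definition good_on :: "real \<Rightarrow> real \<Rightarrow> real \<Rightarrow> (real \<Rightarrow> real) \<Rightarrow> bool" where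
  "good_on C u v g \<longleftrightarrow> (\<forall>l r z e. u \<le> l \<longrightarrow> r \<le> v \<longrightarrow> z \<in> {l..r} \<longrightarrow> 0 < e \<longrightarrow>
     \<bar>g z\<bar> * (measure lebesgue {x \<in> {l..r}. \<bar>g x\<bar> \<le> e})\<^sup>2 \<le> C * e * (r - l)\<^sup>2)"

lemma compact_sublevel:
  fixes g :: "real \<Rightarrow> real"
  assumes "continuous_on {l..r} g"
  shows "compact {x \<in> {l..r}. \<bar>g x\<bar> \<le> e}"
proof -
  have "closed {x \<in> {l..r}. \<bar>g x\<bar> \<le> e}"
    by (rule continuous_on_closed_Collect_le) (auto intro!: continuous_intros assms)
  moreover have "bounded {x \<in> {l..r}. \<bar>g x\<bar> \<le> e}"
    by (rule bounded_subset[of "{l..r}"]) auto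
  ultimately show ?thesis by (simp add: compact_eq_bounded_closed)
qed

text \<open>Reduces goodness to interpolation: three points of the sublevel set, spread at the scale
  of its measure \<open>m\<close>, have to control the value at an arbitrary point \<open>w\<close>.
  Three points match the three coefficients of the functions treated below.\<close>

lemma good_onI:
  assumes cont: "continuous_on {u..v} g" and C: "0 \<le> C"
    and key: "\<And>l r e m x y z w. \<lbrakk>u \<le> l; r \<le> v; {x, y, z, w} \<subseteq> {l..r};
      \<bar>g x\<bar> \<le> e; \<bar>g y\<bar> \<le> e; \<bar>g z\<bar> \<le> e; 0 < e; 0 < m; m \<le> 4 * (y - x); m \<le> 4 * (z - y); m \<le> r - l\<rbrakk>
      \<Longrightarrow> \<bar>g w\<bar> * m\<^sup>2 \<le> C * e * (r - l)\<^sup>2"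
  shows "good_on C u v g"
  unfolding good_on_def
proof (intro allI impI)
  fix l r w e :: real
  assume a: "u \<le> l" "r \<le> v" "w \<in> {l..r}" "0 < e"
  define S where "S = {x \<in> {l..r}. \<bar>g x\<bar> \<le> e}"
  have S: "compact S"
    unfolding S_def using a by (intro compact_sublevel continuous_on_subset[OF cont]) auto
  have mL: "measure lebesgue S \<le> r - l"
  proof -
    have "measure lebesgue S \<le> measure lebesgue {l..r}"
      by (rule measure_mono_fmeasurable) (use S in \<open>auto simp: S_def lmeasurable_compact fmeasurableD\<close>)
    then show ?thesis using a by simp
  qed
  show "\<bar>g w\<bar> * (measure lebesgue S)\<^sup>2 \<le> C * e * (r - l)\<^sup>2"
  proof (cases "0 < measure lebesgue S")
    case True
    obtain x y z where xyz: "x \<in> S" "y \<in> S" "z \<in> S"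
      and gap: "measure lebesgue S \<le> 4 * (y - x)" "measure lebesgue S \<le> 4 * (z - y)"
      using three_spread_points[OF S True] .
    show ?thesis
    proof (rule key[OF a(1,2) _ _ _ _ a(4) True gap mL])
      show "{x, y, z, w} \<subseteq> {l..r}" using xyz a(3) unfolding S_def by blast
    qed (use xyz in \<open>unfold S_def, blast+\<close>)
  next
    case False
    then have "measure lebesgue S = 0" using measure_nonneg[of lebesgue S] by linarith
    then show ?thesis using C a by simp
  qed
qed

text \<open>A form of c1 \<le> f'' \<le> c2 that passes to uniform limits: \<open>D\<close> plays
  the part of f', and no second derivative is mentioned. Functions with f'' \<le> -c1 are reached
  through -f.\<close>

locale curved =
  fixes f D :: "real \<Rightarrow> real" and u v c1 c2 :: real
  assumes uv: "u < v" and c1: "0 < c1" and c12: "c1 \<le> c2"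
    and D_lower: "\<lbrakk>x \<in> {u..v}; y \<in> {u..v}; x \<le> y\<rbrakk> \<Longrightarrow> c1 * (y - x) \<le> D y - D x"
    and D_upper: "\<lbrakk>x \<in> {u..v}; y \<in> {u..v}; x \<le> y\<rbrakk> \<Longrightarrow> D y - D x \<le> c2 * (y - x)"
    and f_lower: "\<lbrakk>x \<in> {u..v}; y \<in> {u..v}\<rbrakk> \<Longrightarrow> c1 / 2 * (y - x)\<^sup>2 \<le> f y - f x - D x * (y - x)"
    and f_upper: "\<lbrakk>x \<in> {u..v}; y \<in> {u..v}\<rbrakk> \<Longrightarrow> f y - f x - D x * (y - x) \<le> c2 / 2 * (y - x)\<^sup>2"
begin

text \<open>The largest constant arising below, from \<open>good_form\<close>; the other estimates
  give 1, 1 + 4 (c2/c1) and 1 + 40 (c2/c1).\<close>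

definition "Cgood = 5 + 64 * (c2 / c1)"
definition "Db = \<bar>D u\<bar> + c2 * (v - u)"
definition "Lip = Db + c2 * (v - u)"

lemma c2: "0 < c2" using c1 c12 by simp

lemma c21: "1 \<le> c2 / c1" using c1 c12 by (simp add: field_simps)

lemma Cgood_pos: "0 < Cgood" using c21 by (simp add: Cgood_def)

lemma D_lip: 
  assumes "x \<in> {u..v}" "y \<in> {u..v}" shows "\<bar>D y - D x\<bar> \<le> c2 * \<bar>y - x\<bar>"
proof (cases "x \<le> y")
  case True
  have "0 \<le> c1 * (y - x)" using c1 True by simp
  with D_lower[OF assms True] D_upper[OF assms True] True show ?thesis by simp
next
  case False
  then have "y \<le> x" by simp
  have "0 \<le> c1 * (x - y)" using c1 False by simp
  with D_lower[OF assms(2,1) \<open>y \<le> x\<close>] D_upper[OF assms(2,1) \<open>y \<le> x\<close>] False show ?thesis by simp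
qed

lemma D_bound: assumes "x \<in> {u..v}" shows "\<bar>D x\<bar> \<le> Db"
proof -
  have "\<bar>D x - D u\<bar> \<le> c2 * \<bar>x - u\<bar>" using D_lip[of u x] assms uv by auto
  also have "\<dots> \<le> c2 * (v - u)" using c2 assms by (intro mult_left_mono) auto
  finally show ?thesis unfolding Db_def by linarith
qed

lemma Db_nonneg: "0 \<le> Db" using c2 uv by (simp add: Db_def)
lemma Lip_nonneg: "0 \<le> Lip" using c2 uv Db_nonneg by (simp add: Lip_def)

lemma f_taylor:
  assumes "x \<in> {u..v}" "y \<in> {u..v}"
  shows "\<bar>f y - f x - D x * (y - x)\<bar> \<le> c2 / 2 * (y - x)\<^sup>2"
proof -
  have "0 \<le> c1 / 2 * (y - x)\<^sup>2" using c1 by simp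
  with f_lower[OF assms] f_upper[OF assms] show ?thesis by linarith
qed

lemma f_lip: 
  assumes "x \<in> {u..v}" "y \<in> {u..v}" shows "\<bar>f y - f x\<bar> \<le> Lip * \<bar>y - x\<bar>"
proof -
  have a: "\<bar>D x * (y - x)\<bar> \<le> Db * \<bar>y - x\<bar>"
    using D_bound[OF assms(1)] by (simp add: abs_mult mult_right_mono)
  have "\<bar>y - x\<bar> * \<bar>y - x\<bar> \<le> (v - u) * \<bar>y - x\<bar>"
    using assms by (intro mult_right_mono) auto
  then have "(y - x)\<^sup>2 \<le> (v - u) * \<bar>y - x\<bar>" by (simp add: power2_eq_square flip: abs_mult)
  then have "c2 / 2 * (y - x)\<^sup>2 \<le> c2 / 2 * ((v - u) * \<bar>y - x\<bar>)"
    using c2 by (intro mult_left_mono) auto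
  also have "\<dots> \<le> c2 * (v - u) * \<bar>y - x\<bar>" using c2 uv by simp
  finally have "\<bar>f y - f x - D x * (y - x)\<bar> \<le> c2 * (v - u) * \<bar>y - x\<bar>"
    using f_taylor[OF assms] by linarith
  then have "\<bar>f y - f x\<bar> \<le> Db * \<bar>y - x\<bar> + c2 * (v - u) * \<bar>y - x\<bar>"
    using a by linarith
  then show ?thesis unfolding Lip_def by (simp only: distrib_right)
qed

lemma cont_D: "continuous_on {u..v} D"
proof (rule lipschitz_on_continuous_on[of c2])
  show "c2-lipschitz_on {u..v} D" 
    using D_lip c2 by (intro lipschitz_onI) (auto simp: dist_real_def abs_minus_commute)
qed

lemma cont_f: "continuous_on {u..v} f"
proof (rule lipschitz_on_continuous_on[of Lip])
  show "Lip-lipschitz_on {u..v} f" 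
    using f_lip Lip_nonneg by (intro lipschitz_onI) (auto simp: dist_real_def abs_minus_commute)
qed

text \<open>The two outer points limit the slope scale \<open>k\<close> to 4 e / (c1 m), and from
  one small value the function can then grow by at most c2 k L over an interval of length L.\<close>

lemma good_bilipschitz:
  assumes cont: "continuous_on {u..v} g" and k: "0 \<le> k"
    and bi: "\<And>x y. \<lbrakk>x \<in> {u..v}; y \<in> {u..v}; x \<le> y\<rbrakk> \<Longrightarrow>
      c1 * k * (y - x) \<le> \<bar>g y - g x\<bar> \<and> \<bar>g y - g x\<bar> \<le> c2 * k * (y - x)"
  shows "good_on Cgood u v g"
proof (rule good_onI[OF cont])
  show "0 \<le> Cgood" using Cgood_pos by simp
  fix l r e m x y z w
  assume a: "u \<le> l" "r \<le> v" "{x, y, z, w} \<subseteq> {l..r}"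
    "\<bar>g x\<bar> \<le> e" "\<bar>g y\<bar> \<le> e" "\<bar>g z\<bar> \<le> e" "0 < e" "0 < m" "m \<le> 4 * (y - x)" "m \<le> 4 * (z - y)" "m \<le> r - l"
  define L where "L = r - l"
  have "c1 * k * (m / 2) \<le> c1 * k * (z - x)" using a c1 k by (intro mult_left_mono) auto
  also have "\<dots> \<le> \<bar>g z - g x\<bar>" using bi[of x z] a by auto
  also have "\<dots> \<le> 2 * e" using a by linarith
  finally have km: "c1 * k * m \<le> 4 * e" by simp
  have "\<bar>g w - g x\<bar> \<le> c2 * k * \<bar>w - x\<bar>"
    using bi[of x w] bi[of w x] a by (cases "x \<le> w") (auto simp: abs_minus_commute)
  also have "\<dots> \<le> c2 * k * L" using a c2 k by (intro mult_left_mono) (auto simp: L_def)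
  finally have gw: "\<bar>g w\<bar> \<le> e + c2 * k * L" using a by linarith
  have L: "0 < L" "m \<le> L" using a by (auto simp: L_def)
  have m2: "m\<^sup>2 \<le> L\<^sup>2" using L a by (intro power_mono) auto
  have "\<bar>g w\<bar> * m\<^sup>2 \<le> (e + c2 * k * L) * m\<^sup>2" using gw by (intro mult_right_mono) auto
  also have "\<dots> = e * m\<^sup>2 + (c2 / c1) * L * (m * (c1 * k * m))"
    using c1 by (simp add: field_simps power2_eq_square)
  also have "\<dots> \<le> e * L\<^sup>2 + (c2 / c1) * L * (L * (4 * e))"
  proof -
    have "e * m\<^sup>2 \<le> e * L\<^sup>2" using m2 a by (intro mult_left_mono) auto
    moreover have "m * (c1 * k * m) \<le> L * (4 * e)" using km L a(7,8) c1 k by (intro mult_mono[of m L "c1 * k * m"]) simp_all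
    then have "(c2 / c1) * L * (m * (c1 * k * m)) \<le> (c2 / c1) * L * (L * (4 * e))"
      using c1 c2 L by (intro mult_left_mono) auto
    ultimately show ?thesis by linarith
  qed
  also have "\<dots> = (1 + 4 * (c2/c1)) * (e * L\<^sup>2)" by (simp add: algebra_simps power2_eq_square)
  also have "\<dots> \<le> Cgood * (e * L\<^sup>2)"
    using c21 a by (intro mult_right_mono) (auto simp: Cgood_def)
  finally show "\<bar>g w\<bar> * m\<^sup>2 \<le> Cgood * e * (r - l)\<^sup>2" by (simp add: L_def)
qed

lemma good_const: "good_on Cgood u v (\<lambda>x. k)"
proof (rule good_onI)
  show "0 \<le> Cgood" using Cgood_pos by simp
  fix l r e m x y z w :: real
  assume a: "\<bar>k\<bar> \<le> e" "0 < e" "0 < m" "m \<le> r - l" 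
  have "\<bar>k\<bar> * m\<^sup>2 \<le> e * (r - l)\<^sup>2" using a by (intro mult_mono power_mono) auto
  also have "\<dots> \<le> Cgood * (e * (r - l)\<^sup>2)" 
    using a c21 by (intro mult_right_mono[of 1 Cgood, simplified]) (auto simp: Cgood_def)
  finally show "\<bar>k\<bar> * m\<^sup>2 \<le> Cgood * e * (r - l)\<^sup>2" by simp
qed auto

lemma good_linear: "good_on Cgood u v (\<lambda>x. q * x - p)"
\<comment> \<open>This \<open>k\<close> makes c1 k equal to |q|; the upper bound then holds because
  c2/c1 \<ge> 1.\<close>
proof (rule good_bilipschitz[where k = "\<bar>q\<bar> / c1"])
  fix x y :: real assume "x \<le> y"
  have e: "\<bar>(q * y - p) - (q * x - p)\<bar> = \<bar>q\<bar> * (y - x)"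
    using \<open>x \<le> y\<close> by (simp add: abs_mult flip: right_diff_distrib)
  have "1 * (\<bar>q\<bar> * (y - x)) \<le> (c2 / c1) * (\<bar>q\<bar> * (y - x))"
    using c21 \<open>x \<le> y\<close> by (intro mult_right_mono) auto
  then show "c1 * (\<bar>q\<bar> / c1) * (y - x) \<le> \<bar>(q * y - p) - (q * x - p)\<bar> \<and>
     \<bar>(q * y - p) - (q * x - p)\<bar> \<le> c2 * (\<bar>q\<bar> / c1) * (y - x)"
    unfolding e using c1 by simp
qed (use c1 in \<open>auto intro!: continuous_intros\<close>)

lemma good_slope: "good_on Cgood u v (\<lambda>x. a1 + a2 * D x)"
proof (rule good_bilipschitz[where k = "\<bar>a2\<bar>"])
  fix x y assume a: "x \<in> {u..v}" "y \<in> {u..v}" "x \<le> y"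
  have "0 \<le> c1 * (y - x)" using c1 a by simp
  then have D: "\<bar>D y - D x\<bar> = D y - D x" using D_lower[OF a] by linarith
  have e: "\<bar>(a1 + a2 * D y) - (a1 + a2 * D x)\<bar> = \<bar>a2\<bar> * (D y - D x)"
  proof -
    have "(a1 + a2 * D y) - (a1 + a2 * D x) = a2 * (D y - D x)" by (simp add: right_diff_distrib)
    then show ?thesis by (simp only: abs_mult D)
  qed
  show "c1 * \<bar>a2\<bar> * (y - x) \<le> \<bar>(a1 + a2 * D y) - (a1 + a2 * D x)\<bar> \<and>
     \<bar>(a1 + a2 * D y) - (a1 + a2 * D x)\<bar> \<le> c2 * \<bar>a2\<bar> * (y - x)"
    unfolding e using mult_left_mono[OF D_lower[OF a], of "\<bar>a2\<bar>"] mult_left_mono[OF D_upper[OF a], of "\<bar>a2\<bar>"]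
    by (simp add: mult_ac)
qed (auto intro!: continuous_intros cont_D)

text \<open>The three small values bound first the coefficient \<open>a2\<close>, through a divided
  difference, and then the slope at \<open>x\<close>; Taylor expansion at \<open>x\<close> carries
  both bounds to \<open>w\<close>.\<close>

lemma good_form: "good_on Cgood u v (\<lambda>x. a0 + a1 * x + a2 * f x)"
proof (rule good_onI)
  show "0 \<le> Cgood" using Cgood_pos by simp
  show "continuous_on {u..v} (\<lambda>x. a0 + a1 * x + a2 * f x)" by (intro continuous_intros cont_f)
  fix l r e m x y z w :: real
  let ?F = "\<lambda>x. a0 + a1 * x + a2 * f x"
  assume a: "u \<le> l" "r \<le> v" "{x, y, z, w} \<subseteq> {l..r}"
    "\<bar>?F x\<bar> \<le> e" "\<bar>?F y\<bar> \<le> e" "\<bar>?F z\<bar> \<le> e" "0 < e" "0 < m" "m \<le> 4 * (y - x)" "m \<le> 4 * (z - y)" "m \<le> r - l"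
  define L where "L = r - l"
  have L: "0 < L" "m \<le> L" using a by (auto simp: L_def)
  have mem: "x \<in> {u..v}" "y \<in> {u..v}" "z \<in> {u..v}" "w \<in> {u..v}" using a by auto
  \<comment> \<open>A multiple of the second divided difference of \<open>f\<close>. The same
    combination of values of the form eliminates \<open>a0\<close> and \<open>a1\<close> and leaves
    \<open>a2 * B\<close>.\<close>
  define B where "B = f x * (z - y) - f y * (z - x) + f z * (y - x)"
  have "(c1/2 * (x - y)\<^sup>2) * (z - y) + (c1/2 * (z - y)\<^sup>2) * (y - x)
     \<le> (f x - f y - D y * (x - y)) * (z - y) + (f z - f y - D y * (z - y)) * (y - x)"
    using a by (intro add_mono mult_right_mono f_lower mem) auto
  also have "\<dots> = B" by (simp add: B_def algebra_simps)
  finally have "(c1/2 * (x - y)\<^sup>2) * (z - y) + (c1/2 * (z - y)\<^sup>2) * (y - x) \<le> B" .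
  moreover have "(c1/2 * (x - y)\<^sup>2) * (z - y) + (c1/2 * (z - y)\<^sup>2) * (y - x) = c1/2 * ((y - x) * (z - y) * (z - x))"
    by (simp add: field_simps power2_eq_square)
  ultimately have B: "c1/2 * ((y - x) * (z - y) * (z - x)) \<le> B" by simp
  have zx: "0 < z - x" using a by auto
  have "\<bar>a2\<bar> * (c1/2 * ((y - x) * (z - y) * (z - x))) \<le> \<bar>a2\<bar> * \<bar>B\<bar>"
    by (rule mult_left_mono) (use B in linarith, simp)
  also have "\<dots> = \<bar>a2 * B\<bar>" by (simp add: abs_mult)
  also have "a2 * B = ?F x * (z - y) - ?F y * (z - x) + ?F z * (y - x)"
    by (simp add: B_def algebra_simps)
  also have "\<bar>\<dots>\<bar> \<le> \<bar>?F x\<bar> * (z - y) + \<bar>?F y\<bar> * (z - x) + \<bar>?F z\<bar> * (y - x)"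
  proof -
    have "\<bar>?F x * (z - y)\<bar> = \<bar>?F x\<bar> * (z - y)" "\<bar>?F y * (z - x)\<bar> = \<bar>?F y\<bar> * (z - x)" 
       "\<bar>?F z * (y - x)\<bar> = \<bar>?F z\<bar> * (y - x)" using a by (simp_all add: abs_mult)
    then show ?thesis by linarith
  qed
  also have "\<dots> \<le> e * (z - y) + e * (z - x) + e * (y - x)"
    using a by (intro add_mono mult_right_mono) auto
  also have "\<dots> = 2 * e * (z - x)" by (simp add: algebra_simps)
  finally have "(\<bar>a2\<bar> * (c1/2 * ((y - x) * (z - y)))) * (z - x) \<le> (2 * e) * (z - x)"
    by (simp add: mult_ac)
  then have "\<bar>a2\<bar> * (c1/2 * ((y - x) * (z - y))) \<le> 2 * e" using zx by simp
  moreover have "\<bar>a2\<bar> * (c1/2 * ((m/4) * (m/4))) \<le> \<bar>a2\<bar> * (c1/2 * ((y - x) * (z - y)))"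
    using a c1 by (intro mult_left_mono mult_mono) auto
  moreover have "c1 * \<bar>a2\<bar> * m\<^sup>2 = 32 * (\<bar>a2\<bar> * (c1/2 * ((m/4) * (m/4))))"
    by (simp add: power2_eq_square)
  ultimately have am: "c1 * \<bar>a2\<bar> * m\<^sup>2 \<le> 64 * e" by linarith
  define G where "G = a1 + a2 * D x"
  have exp: "\<bar>?F t - ?F x - G * (t - x)\<bar> \<le> \<bar>a2\<bar> * (c2/2 * (t - x)\<^sup>2)" if "t \<in> {u..v}" for t
  proof -
    have "?F t - ?F x - G * (t - x) = a2 * (f t - f x - D x * (t - x))" by (simp add: G_def algebra_simps)
    then show ?thesis by (simp only: abs_mult) (intro mult_left_mono f_taylor[OF mem(1) that], simp)
  qed
  have tL: "\<bar>a2\<bar> * (c2/2 * (t - x)\<^sup>2) \<le> \<bar>a2\<bar> * (c2/2 * L\<^sup>2)" if "t \<in> {l..r}" for t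
  proof -
    have "(t - x)\<^sup>2 \<le> L\<^sup>2" unfolding L_def using that a by (intro power2_le_iff_abs_le[THEN iffD2]) auto
    then show ?thesis using c2 by (intro mult_left_mono) auto
  qed
  have "\<bar>G\<bar> * (z - x) \<le> 2 * e + \<bar>a2\<bar> * (c2/2 * (z - x)\<^sup>2)"
  proof -
    have "\<bar>G * (z - x)\<bar> \<le> 2 * e + \<bar>a2\<bar> * (c2/2 * (z - x)\<^sup>2)" using exp[OF mem(3)] a by linarith
    then show ?thesis using zx by (simp add: abs_mult)
  qed
  then have "\<bar>G\<bar> * (z - x) \<le> (2 * e / (z - x) + \<bar>a2\<bar> * (c2/2 * (z - x))) * (z - x)"
    using zx by (simp add: distrib_right power2_eq_square mult.assoc)
  then have "\<bar>G\<bar> \<le> 2 * e / (z - x) + \<bar>a2\<bar> * (c2/2 * (z - x))" using zx by simp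
  also have "\<dots> \<le> 2 * e / (m/2) + \<bar>a2\<bar> * (c2/2 * L)"
    using a c2 by (intro add_mono mult_left_mono divide_left_mono mult_pos_pos) (auto simp: L_def)
  finally have G: "\<bar>G\<bar> \<le> 4 * e / m + \<bar>a2\<bar> * (c2/2 * L)" by simp
  have "\<bar>?F w\<bar> \<le> e + \<bar>G * (w - x)\<bar> + \<bar>a2\<bar> * (c2/2 * L\<^sup>2)"
  proof -
    have "w \<in> {l..r}" using a by simp
    from tL[OF this] exp[OF mem(4)] a(4) show ?thesis by linarith
  qed
  also have "\<bar>G * (w - x)\<bar> \<le> \<bar>G\<bar> * L" using a by (auto simp: abs_mult L_def intro!: mult_left_mono)
  also have "\<bar>G\<bar> * L \<le> (4 * e / m + \<bar>a2\<bar> * (c2/2 * L)) * L" using G L by (intro mult_right_mono) auto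
  finally have "\<bar>?F w\<bar> \<le> e + 4 * e * L / m + c2 * \<bar>a2\<bar> * L\<^sup>2"
    by (simp add: algebra_simps power2_eq_square)
  then have "\<bar>?F w\<bar> * m\<^sup>2 \<le> (e + 4 * e * L / m + c2 * \<bar>a2\<bar> * L\<^sup>2) * m\<^sup>2" by (intro mult_right_mono) auto
  also have "\<dots> = e * (m * m) + 4 * e * (L * m) + (c2/c1) * (c1 * \<bar>a2\<bar> * m\<^sup>2) * L\<^sup>2"
    using a c1 by (simp add: field_simps power2_eq_square)
  also have "\<dots> \<le> e * (L * L) + 4 * e * (L * L) + (c2/c1) * (64 * e) * L\<^sup>2"
  proof -
    have "m * m \<le> L * L" "L * m \<le> L * L" using a(8) L by (auto intro: mult_mono)
    then have "e * (m * m) \<le> e * (L * L)" "4 * e * (L * m) \<le> 4 * e * (L * L)"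
      using a(7) by (auto intro: mult_left_mono)
    moreover have "(c2/c1) * (c1 * \<bar>a2\<bar> * m\<^sup>2) * L\<^sup>2 \<le> (c2/c1) * (64 * e) * L\<^sup>2"
      using am c1 c2 by (intro mult_right_mono mult_left_mono) auto
    ultimately show ?thesis by linarith
  qed
  also have "\<dots> = Cgood * e * (r - l)\<^sup>2" by (simp add: Cgood_def L_def algebra_simps power2_eq_square)
  finally show "\<bar>?F w\<bar> * m\<^sup>2 \<le> Cgood * e * (r - l)\<^sup>2" .
qed

text \<open>Formally the derivative is -f''(x) (q x - p1), so the function behaves like a parabola
  with vertex s = p1/q. One of the outer points \<open>x\<close>, \<open>z\<close> lies beyond
  \<open>y\<close> as seen from \<open>s\<close>; between \<open>y\<close> and that point the two
  terms of \<open>diff\<close> are both nonnegative, so nothing cancels and the coefficient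
  \<open>q\<close> as well as its product with the distance from \<open>y\<close> to
  \<open>s\<close> are bounded.\<close>

lemma good_tangent: "good_on Cgood u v (\<lambda>x. q * f x - p2 - D x * (q * x - p1))"
proof (cases "q = 0")
  case True
  show ?thesis using good_slope[of "- p2" p1] True by (simp add: mult.commute)
next
  case False
  show ?thesis
  proof (rule good_onI)
    show "0 \<le> Cgood" using Cgood_pos by simp
    show "continuous_on {u..v} (\<lambda>x. q * f x - p2 - D x * (q * x - p1))"
      by (intro continuous_intros cont_f cont_D)
    fix l r e m x y z w :: real
    let ?T = "\<lambda>x. q * f x - p2 - D x * (q * x - p1)"
    assume a: "u \<le> l" "r \<le> v" "{x, y, z, w} \<subseteq> {l..r}"
      "\<bar>?T x\<bar> \<le> e" "\<bar>?T y\<bar> \<le> e" "\<bar>?T z\<bar> \<le> e" "0 < e" "0 < m" "m \<le> 4 * (y - x)" "m \<le> 4 * (z - y)" "m \<le> r - l"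
    define L where "L = r - l"
    have L: "0 < L" "m \<le> L" using a by (auto simp: L_def)
    have mem: "x \<in> {u..v}" "y \<in> {u..v}" "z \<in> {u..v}" "w \<in> {u..v}" using a by auto
    define s where "s = p1 / q"
    define d where "d = \<bar>y - s\<bar>"
    have diff: "?T y - ?T t = q * ((f y - f t - D t * (y - t)) + (D t - D y) * (y - s))" for t
      using False by (simp add: s_def field_simps)
    have low: "\<bar>q\<bar> * (c1/2 * (y - t)\<^sup>2 + c1 * \<bar>y - t\<bar> * d) \<le> 2 * e"
      if t: "t \<in> {u..v}" "\<bar>?T t\<bar> \<le> e" "(t - y) * (y - s) \<ge> 0" for t
    proof -
      have "(D t - D y) * (y - s) \<ge> c1 * \<bar>y - t\<bar> * d"
      proof (cases "t \<le> y")
        case True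
        have DD: "c1 * (y - t) \<le> D y - D t" by (rule D_lower[OF t(1) mem(2) True])
        show ?thesis
        proof (cases "t = y")
          case False
          then have "y \<le> s" using t(3) True by (simp add: zero_le_mult_iff)
          then have "(c1 * (y - t)) * (s - y) \<le> (D y - D t) * (s - y)"
            using DD by (intro mult_right_mono) auto
          then show ?thesis using True \<open>y \<le> s\<close> by (simp add: d_def algebra_simps)
        qed auto
      next
        case False
        then have "y \<ge> s" using t(3) by (simp add: zero_le_mult_iff)
        have DD: "c1 * (t - y) \<le> D t - D y" using D_lower[OF mem(2) t(1)] False by simp
        then have "(c1 * (t - y)) * (y - s) \<le> (D t - D y) * (y - s)"
          using \<open>y \<ge> s\<close> by (intro mult_right_mono) auto
        then show ?thesis using False \<open>y \<ge> s\<close> by (simp add: d_def)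
      qed
      then have "c1/2 * (y - t)\<^sup>2 + c1 * \<bar>y - t\<bar> * d \<le> (f y - f t - D t * (y - t)) + (D t - D y) * (y - s)"
        using f_lower[OF t(1) mem(2)] by linarith
      moreover have "0 \<le> c1/2 * (y - t)\<^sup>2 + c1 * \<bar>y - t\<bar> * d" using c1 by (simp add: d_def)
      ultimately have "\<bar>q\<bar> * (c1/2 * (y - t)\<^sup>2 + c1 * \<bar>y - t\<bar> * d) \<le> \<bar>?T y - ?T t\<bar>"
        unfolding diff abs_mult by (intro mult_left_mono) auto
      then show ?thesis using a(5) t(2) by linarith
    qed
    have low2: "\<bar>q\<bar> * (c1/2 * (m/4)\<^sup>2 + c1 * (m/4) * d) \<le> 2 * e"
    proof -
      obtain t where t: "t \<in> {u..v}" "\<bar>?T t\<bar> \<le> e" "(t - y) * (y - s) \<ge> 0" "m/4 \<le> \<bar>y - t\<bar>"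
      proof (cases "s \<le> y")
        case True then show ?thesis using that[of z] a mem by auto
      next
        case False then show ?thesis using that[of x] a mem by (auto simp: zero_le_mult_iff)
      qed
      have "(m/4)\<^sup>2 \<le> \<bar>y - t\<bar>\<^sup>2" using a t by (intro power_mono) auto
      then have "\<bar>q\<bar> * (c1/2 * (m/4)\<^sup>2 + c1 * (m/4) * d) \<le> \<bar>q\<bar> * (c1/2 * (y - t)\<^sup>2 + c1 * \<bar>y - t\<bar> * d)"
        using c1 t by (intro mult_left_mono add_mono mult_right_mono) (auto simp: d_def)
      then show ?thesis using low[OF t(1-3)] by linarith
    qed
    have A1: "\<bar>q\<bar> * c1 * m\<^sup>2 \<le> 64 * e" and A2: "\<bar>q\<bar> * c1 * m * d \<le> 8 * e"
    proof -
      have nn: "0 \<le> \<bar>q\<bar> * (c1/2 * (m/4)\<^sup>2)" "0 \<le> \<bar>q\<bar> * (c1 * (m/4) * d)"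
        using c1 a by (auto simp: d_def)
      show "\<bar>q\<bar> * c1 * m\<^sup>2 \<le> 64 * e" "\<bar>q\<bar> * c1 * m * d \<le> 8 * e"
        using low2 nn by (simp_all add: distrib_left power_divide)
    qed
    have "\<bar>(f y - f w - D w * (y - w)) + (D w - D y) * (y - s)\<bar> \<le> c2/2 * L\<^sup>2 + c2 * L * d"
    proof -
      have wy: "\<bar>w - y\<bar> \<le> L" using a by (auto simp: L_def)
      then have "(y - w)\<^sup>2 \<le> L\<^sup>2" by (intro power2_le_iff_abs_le[THEN iffD2]) auto
      then have "c2/2 * (y - w)\<^sup>2 \<le> c2/2 * L\<^sup>2" using c2 by (intro mult_left_mono) auto
      then have "\<bar>f y - f w - D w * (y - w)\<bar> \<le> c2/2 * L\<^sup>2"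
        using f_taylor[OF mem(4,2)] by linarith
      moreover have "\<bar>(D w - D y) * (y - s)\<bar> \<le> c2 * L * d"
        unfolding abs_mult d_def using wy c2 D_lip[OF mem(2,4)]
        by (intro mult_right_mono order_trans[OF D_lip[OF mem(2,4)]] mult_left_mono) auto
      ultimately show ?thesis by linarith
    qed
    then have "\<bar>?T y - ?T w\<bar> \<le> \<bar>q\<bar> * (c2/2 * L\<^sup>2 + c2 * L * d)"
      unfolding diff abs_mult by (intro mult_left_mono) auto
    then have "\<bar>?T w\<bar> \<le> e + \<bar>q\<bar> * (c2/2 * L\<^sup>2 + c2 * L * d)" using a(5) by linarith
    then have "\<bar>?T w\<bar> * m\<^sup>2 \<le> (e + \<bar>q\<bar> * (c2/2 * L\<^sup>2 + c2 * L * d)) * m\<^sup>2" by (intro mult_right_mono) auto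
    also have "\<dots> = e * (m * m) + (c2/c1)/2 * (\<bar>q\<bar> * c1 * m\<^sup>2) * L\<^sup>2 + (c2/c1) * (\<bar>q\<bar> * c1 * m * d) * (L * m)"
      using c1 by (simp add: field_simps power2_eq_square)
    also have "\<dots> \<le> e * (L * L) + (c2/c1)/2 * (64 * e) * L\<^sup>2 + (c2/c1) * (8 * e) * (L * L)"
    proof -
      have "m * m \<le> L * L" using a(8) L by (intro mult_mono) simp_all
      then have "e * (m * m) \<le> e * (L * L)" using a(7) by (intro mult_left_mono) simp_all
      moreover have "(c2/c1)/2 * (\<bar>q\<bar> * c1 * m\<^sup>2) * L\<^sup>2 \<le> (c2/c1)/2 * (64 * e) * L\<^sup>2"
        using A1 c1 c2 by (intro mult_right_mono mult_left_mono) auto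
      moreover have "((c2/c1) * (\<bar>q\<bar> * c1 * m * d)) * (L * m) \<le> ((c2/c1) * (8 * e)) * (L * L)"
      proof (rule mult_mono)
        show "(c2/c1) * (\<bar>q\<bar> * c1 * m * d) \<le> (c2/c1) * (8 * e)"
          using A2 c1 c2 by (intro mult_left_mono) auto
        show "L * m \<le> L * L" using L by (intro mult_left_mono) simp_all
        show "0 \<le> (c2/c1) * (8 * e)" using c1 c2 a(7) by simp
        show "0 \<le> L * m" using L a(8) by simp
      qed
      ultimately show ?thesis by linarith
    qed
    also have "\<dots> = (1 + 40 * (c2/c1)) * (e * L\<^sup>2)" by (simp add: algebra_simps power2_eq_square)
    also have "\<dots> \<le> Cgood * (e * L\<^sup>2)" using c21 a by (intro mult_right_mono) (auto simp: Cgood_def)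
    finally show "\<bar>?T w\<bar> * m\<^sup>2 \<le> Cgood * e * (r - l)\<^sup>2" by (simp add: L_def)
  qed
qed

end

subsection \<open>Quantitative nondivergence in dimension three\<close>

lemma three_intervals_redundant:
  fixes P :: "(real \<times> real) set"
  assumes P: "A \<in> P" "B \<in> P" "C \<in> P" "A \<noteq> B" "A \<noteq> C" "B \<noteq> C"
    and x: "x \<in> {fst A..snd A}" "x \<in> {fst B..snd B}" "x \<in> {fst C..snd C}"
  shows "\<exists>D\<in>P. (\<Union>p\<in>P. {fst p..snd p}) = (\<Union>p\<in>P - {D}. {fst p..snd p})"
proof -
  have *: "\<exists>D\<in>P. (\<Union>p\<in>P. {fst p..snd p}) = (\<Union>p\<in>P - {D}. {fst p..snd p})"
    if "D \<in> P" "X \<in> P - {D}" "Y \<in> P - {D}" "{fst D..snd D} \<subseteq> {fst X..snd X} \<union> {fst Y..snd Y}" for D X Y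
  proof (intro bexI[of _ D] subset_antisym subsetI)
    fix t assume "t \<in> (\<Union>p\<in>P. {fst p..snd p})"
    then obtain p where p: "p \<in> P" "t \<in> {fst p..snd p}" by blast
    show "t \<in> (\<Union>p\<in>P - {D}. {fst p..snd p})"
    proof (cases "p = D")
      case True
      then have "t \<in> {fst X..snd X} \<or> t \<in> {fst Y..snd Y}" using p that(4) by blast
      then show ?thesis using that(2,3) by blast
    next
      case False
      then show ?thesis using p by blast
    qed
  qed (use that in auto)
  consider "fst A \<le> fst B" "fst A \<le> fst C" | "fst B \<le> fst A" "fst B \<le> fst C" | "fst C \<le> fst A" "fst C \<le> fst B"
    by linarith
  then show ?thesis
  proof cases
    case 1
    show ?thesis
    proof (cases "snd B \<le> snd C")
      case True then show ?thesis using 1 P x by (intro *[of B A C]) auto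
    next
      case False then show ?thesis using 1 P x by (intro *[of C A B]) auto
    qed
  next
    case 2
    show ?thesis
    proof (cases "snd A \<le> snd C")
      case True then show ?thesis using 2 P x by (intro *[of A B C]) auto
    next
      case False then show ?thesis using 2 P x by (intro *[of C B A]) auto
    qed
  next
    case 3
    show ?thesis
    proof (cases "snd A \<le> snd B")
      case True then show ?thesis using 3 P x by (intro *[of A C B]) auto
    next
      case False then show ?thesis using 3 P x by (intro *[of B C A]) auto
    qed
  qed
qed

text \<open>A subfamily of least cardinality with the same union works: of three intervals through
  one point, those reaching farthest to the left and to the right make the third redundant.\<close>

lemma finite_interval_subcover:
  fixes P :: "(real \<times> real) set"
  assumes "finite P"
  obtains P' where "P' \<subseteq> P" "(\<Union>p\<in>P'. {fst p..snd p}) = (\<Union>p\<in>P. {fst p..snd p})"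
    "\<And>x. card {p \<in> P'. x \<in> {fst p..snd p}} \<le> 2"
proof -
  define Q where "Q R \<longleftrightarrow> R \<subseteq> P \<and> (\<Union>p\<in>R. {fst p..snd p}) = (\<Union>p\<in>P. {fst p..snd p})" for R
  have "Q P" by (simp add: Q_def)
  then obtain R where R: "Q R" and min: "\<And>R'. Q R' \<Longrightarrow> card R \<le> card R'"
    using ex_has_least_nat[of Q P card] by blast
  have fin: "finite R" using R assms finite_subset unfolding Q_def by blast
  have "card {p \<in> R. x \<in> {fst p..snd p}} \<le> 2" for x
  proof (rule ccontr)
    assume "\<not> ?thesis"
    then have "3 \<le> card {p \<in> R. x \<in> {fst p..snd p}}" by simp
    then obtain T where T: "T \<subseteq> {p \<in> R. x \<in> {fst p..snd p}}" "card T = 3"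
      by (rule obtain_subset_with_card_n) blast
    obtain A B C where ABC: "T = {A, B, C}" "A \<noteq> B" "B \<noteq> C" "A \<noteq> C"
      using iffD1[OF card_3_iff T(2)] by blast
    have "\<exists>D\<in>R. (\<Union>p\<in>R. {fst p..snd p}) = (\<Union>p\<in>R - {D}. {fst p..snd p})"
      by (rule three_intervals_redundant[of A R B C x]) (use T ABC in blast)+
    then obtain D where D: "D \<in> R" "(\<Union>p\<in>R. {fst p..snd p}) = (\<Union>p\<in>R - {D}. {fst p..snd p})"
      by blast
    then have "Q (R - {D})" using R unfolding Q_def by auto
    then have "card R \<le> card (R - {D})" by (rule min)
    moreover have "card (R - {D}) < card R" using D fin by (intro card_Diff1_less)
    ultimately show False by simp
  qed
  then show thesis using that R unfolding Q_def by blast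
qed

text \<open>A one-dimensional covering theorem of Besicovitch type: local bounds are summed over a
  finite cover of multiplicity at most two, which costs the factor 2.\<close>

lemma measure_le_interval_cover:
  fixes E :: "real set"
  assumes E: "compact E" "E \<subseteq> {u..v}" and uv: "u \<le> v" and k: "0 \<le> k"
    and loc: "\<And>x. x \<in> E \<Longrightarrow> \<exists>l r. u \<le> l \<and> l \<le> x \<and> x \<le> r \<and> r \<le> v \<and> (l < x \<or> l = u) \<and> (x < r \<or> r = v) \<and>
      measure lebesgue (E \<inter> {l..r}) \<le> k * (r - l)"
  shows "measure lebesgue E \<le> 2 * k * (v - u)"
proof -
  obtain L R where LR: "\<And>x. x \<in> E \<Longrightarrow> u \<le> L x \<and> L x \<le> x \<and> x \<le> R x \<and> R x \<le> v \<and>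
      (L x < x \<or> L x = u) \<and> (x < R x \<or> R x = v) \<and> measure lebesgue (E \<inter> {L x..R x}) \<le> k * (R x - L x)"
    using loc by metis
  \<comment> \<open>Compactness needs open intervals around the points, including those at the ends
    of {u..v}. Ends at \<open>u\<close> or \<open>v\<close> are pushed outwards; inside {u..v} the
    closed intervals cover the same points.\<close>
  define lo hi where "lo x = (if L x = u then u - 1 else L x)" and "hi x = (if R x = v then v + 1 else R x)" for x
  have "E \<subseteq> (\<Union>x\<in>E. {lo x<..<hi x})"
  proof
    fix x assume "x \<in> E"
    then show "x \<in> (\<Union>x\<in>E. {lo x<..<hi x})" using LR[of x] by (intro UN_I[of x]) (auto simp: lo_def hi_def)
  qed
  then obtain X where X: "X \<subseteq> E" "finite X" "E \<subseteq> (\<Union>x\<in>X. {lo x<..<hi x})"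
    using compactE_image[OF E(1), of E "\<lambda>x. {lo x<..<hi x}"] by auto
  define P where "P = (\<lambda>x. (L x, R x)) ` X"
  have "finite P" using X by (simp add: P_def)
  then obtain P' where P': "P' \<subseteq> P" "(\<Union>p\<in>P'. {fst p..snd p}) = (\<Union>p\<in>P. {fst p..snd p})"
    "\<And>x. card {p \<in> P'. x \<in> {fst p..snd p}} \<le> 2"
    using finite_interval_subcover by blast
  have finP': "finite P'" using P'(1) \<open>finite P\<close> finite_subset by blast
  have EP: "E \<subseteq> (\<Union>p\<in>P. {fst p..snd p})"
  proof
    fix t assume t: "t \<in> E"
    then obtain x where x: "x \<in> X" "lo x < t" "t < hi x" using X by auto
    have "t \<in> {L x..R x}" using x t E(2) by (auto simp: lo_def hi_def split: if_splits)
    then show "t \<in> (\<Union>p\<in>P. {fst p..snd p})" using x by (auto simp: P_def)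
  qed
  have Pp: "u \<le> fst p" "fst p \<le> snd p" "snd p \<le> v" "measure lebesgue (E \<inter> {fst p..snd p}) \<le> k * (snd p - fst p)"
    if pP: "p \<in> P'" for p
  proof -
    obtain x where x: "x \<in> E" "p = (L x, R x)" using pP P'(1) X(1) unfolding P_def by blast
    show "u \<le> fst p" "fst p \<le> snd p" "snd p \<le> v" "measure lebesgue (E \<inter> {fst p..snd p}) \<le> k * (snd p - fst p)"
      using LR[OF x(1)] by (simp_all add: x(2))
  qed
  have cE: "E \<inter> {a..b} \<in> lmeasurable" for a b
    using E(1) by (intro lmeasurable_compact compact_Int) auto
  have "measure lebesgue E = measure lebesgue (\<Union>p\<in>P'. E \<inter> {fst p..snd p})"
  proof -
    have "E = (\<Union>p\<in>P'. E \<inter> {fst p..snd p})" using EP P'(2) by blast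
    then show ?thesis by simp
  qed
  also have "\<dots> \<le> (\<Sum>p\<in>P'. measure lebesgue (E \<inter> {fst p..snd p}))"
    by (rule measure_UNION_le[OF finP']) (use cE in \<open>auto intro: fmeasurableD\<close>)
  also have "\<dots> \<le> (\<Sum>p\<in>P'. k * (snd p - fst p))" by (intro sum_mono Pp)
  also have "\<dots> = k * (\<Sum>p\<in>P'. (snd p - fst p))" by (simp add: sum_distrib_left)
  also have "\<dots> \<le> k * (2 * (v - u))"
  proof (rule mult_left_mono[OF _ k])
    have int: "integrable lborel (indicat_real {a..b})" for a b :: real
      by (rule integrable_real_indicator) (auto simp: emeasure_lborel_Icc_eq)
    \<comment> \<open>The total length is the integral of the multiplicity, which is at most 2 on
      {u..v} and 0 elsewhere.\<close>
    have "(\<Sum>p\<in>P'. (snd p - fst p)) = (\<Sum>p\<in>P'. integral\<^sup>L lborel (indicator {fst p..snd p}))"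
      using Pp by (intro sum.cong) auto
    also have "\<dots> = integral\<^sup>L lborel (\<lambda>x. \<Sum>p\<in>P'. indicator {fst p..snd p} x)"
      by (rule Bochner_Integration.integral_sum[symmetric]) (rule int)
    also have "\<dots> \<le> integral\<^sup>L lborel (\<lambda>x. 2 * indicator {u..v} x)"
    proof (rule integral_mono)
      fix x
      have "(\<Sum>p\<in>P'. indicator {fst p..snd p} x) = real (card {p \<in> P'. x \<in> {fst p..snd p}})"
        using finP' by (simp add: indicator_def sum.If_cases Int_def)
      also have "\<dots> \<le> 2 * indicator {u..v} x"
      proof (cases "x \<in> {u..v}")
        case True then show ?thesis using P'(3)[of x] by simp
      next
        case False
        then have none: "{p \<in> P'. x \<in> {fst p..snd p}} = {}" using Pp by fastforce
        show ?thesis using False unfolding none by simp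
      qed
      finally show "(\<Sum>p\<in>P'. indicator {fst p..snd p} x) \<le> (2 * indicator {u..v} x :: real)" .
    qed (auto intro!: Bochner_Integration.integrable_sum int)
    also have "\<dots> = 2 * (v - u)" using uv by simp
    finally show "(\<Sum>p\<in>P'. (snd p - fst p)) \<le> 2 * (v - u)" .
  qed
  finally show ?thesis by (simp add: algebra_simps)
qed

section \<open>Maximal intervals below a level\<close>

lemma maximal_right:
  fixes h :: "real \<Rightarrow> real"
  assumes cont: "continuous_on {x..v} h" and x: "x \<le> v" "h x < \<rho>"
  shows "\<exists>r. x \<le> r \<and> r \<le> v \<and> (x < r \<or> r = v) \<and> (\<forall>z\<in>{x..r}. h z \<le> \<rho>) \<and> (r = v \<or> h r = \<rho>)"
proof (cases "\<forall>z\<in>{x..v}. h z < \<rho>")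
  case True
  then show ?thesis using x by (intro exI[of _ v]) (auto intro: less_imp_le)
next
  case False
  define Z where "Z = {z \<in> {x..v}. \<rho> \<le> h z}"
  have "closed Z" unfolding Z_def
    by (rule continuous_on_closed_Collect_le) (auto intro!: continuous_intros cont)
  moreover have "bounded Z" unfolding Z_def by (rule bounded_subset[of "{x..v}"]) auto
  ultimately have cZ: "compact Z" by (simp add: compact_eq_bounded_closed)
  have "Z \<noteq> {}" using False by (auto simp: Z_def not_less)
  then obtain r where r: "r \<in> Z" "\<And>t. t \<in> Z \<Longrightarrow> r \<le> t"
    using compact_attains_inf[OF cZ] by blast
  have "\<exists>t\<ge>x. t \<le> r \<and> h t = \<rho>"
  proof (rule IVT')
    show "h x \<le> \<rho>" using x by simp
    show "\<rho> \<le> h r" "x \<le> r" using r(1) by (auto simp: Z_def)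
    show "continuous_on {x..r} h" by (rule continuous_on_subset[OF cont]) (use r(1) in \<open>auto simp: Z_def\<close>)
  qed
  then obtain t where t: "x \<le> t" "t \<le> r" "h t = \<rho>" by blast
  then have "t \<in> Z" using r by (auto simp: Z_def)
  then have tr: "t = r" using r(2) t by force
  have "h z \<le> \<rho>" if "z \<in> {x..r}" for z
  proof (cases "z = r")
    case True then show ?thesis using t tr by simp
  next
    case False
    then have "z \<notin> Z" using r(2) that by force
    then show ?thesis using that r by (auto simp: Z_def)
  qed
  moreover have "x \<noteq> r" using t tr x by auto
  then have "x < r" using t tr by simp
  moreover have "r \<le> v" using r(1) by (simp add: Z_def)
  ultimately show ?thesis using t tr by (intro exI[of _ r]) auto
qed

lemma maximal_interval:
  fixes h :: "real \<Rightarrow> real"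
  assumes cont: "continuous_on {u..v} h" and x: "x \<in> {u..v}" "h x < \<rho>"
  shows "\<exists>l r. u \<le> l \<and> l \<le> x \<and> x \<le> r \<and> r \<le> v \<and> (l < x \<or> l = u) \<and> (x < r \<or> r = v) \<and>
    (\<forall>z\<in>{l..r}. h z \<le> \<rho>) \<and> (l = u \<or> h l = \<rho>) \<and> (r = v \<or> h r = \<rho>)"
proof -
  have "\<exists>r. x \<le> r \<and> r \<le> v \<and> (x < r \<or> r = v) \<and> (\<forall>z\<in>{x..r}. h z \<le> \<rho>) \<and> (r = v \<or> h r = \<rho>)"
    by (rule maximal_right) (use x in \<open>auto intro: continuous_on_subset[OF cont]\<close>)
  moreover have "\<exists>r. -x \<le> r \<and> r \<le> -u \<and> (-x < r \<or> r = -u) \<and> (\<forall>z\<in>{-x..r}. h (-z) \<le> \<rho>) \<and> (r = -u \<or> h (-r) = \<rho>)"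
  proof (rule maximal_right)
    show "continuous_on {- x..- u} (\<lambda>z. h (- z))"
      by (rule continuous_on_compose2[OF cont]) (use x in \<open>auto intro!: continuous_intros\<close>)
  qed (use x in auto)
  ultimately obtain r s where rs: "x \<le> r" "r \<le> v" "x < r \<or> r = v" "\<forall>z\<in>{x..r}. h z \<le> \<rho>" "r = v \<or> h r = \<rho>"
    "-x \<le> s" "s \<le> -u" "-x < s \<or> s = -u" "\<forall>z\<in>{-x..s}. h (-z) \<le> \<rho>" "s = -u \<or> h (-s) = \<rho>" by auto
  have "h z \<le> \<rho>" if "z \<in> {-s..r}" for z
  proof (cases "x \<le> z")
    case True then show ?thesis using rs that by auto
  next
    case False then show ?thesis using rs(9)[rule_format, of "-z"] that by auto
  qed
  then show ?thesis using rs by (intro exI[of _ "-s"] exI[of _ r]) auto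
qed

text \<open>Of the maximal intervals about \<open>x\<close> belonging to the members below \<rho> at
  \<open>x\<close>, a longest one is taken. A member that stayed below \<rho> on all of it would
  have a strictly longer maximal interval, unless both are {u..v}, which \<open>sup\<close>
  excludes.\<close>

lemma longest_maximal_interval:
  fixes h :: "'i \<Rightarrow> real \<Rightarrow> real"
  assumes fin: "finite H" and cont: "\<And>i. i \<in> H \<Longrightarrow> continuous_on {u..v} (h i)"
    and sup: "\<And>i. i \<in> H \<Longrightarrow> \<exists>z\<in>{u..v}. \<rho> \<le> h i z"
    and x: "x \<in> {u..v}" "i0 \<in> H" "h i0 x < \<rho>"
  obtains i l r where "i \<in> H" "u \<le> l" "l \<le> x" "x \<le> r" "r \<le> v" "l < x \<or> l = u" "x < r \<or> r = v"
    "\<And>z. z \<in> {l..r} \<Longrightarrow> h i z \<le> \<rho>" "\<And>j. j \<in> H \<Longrightarrow> \<exists>z\<in>{l..r}. \<rho> \<le> h j z"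
proof -
  define H' where "H' = {i \<in> H. h i x < \<rho>}"
  have "\<forall>i\<in>H'. \<exists>l r. u \<le> l \<and> l \<le> x \<and> x \<le> r \<and> r \<le> v \<and> (l < x \<or> l = u) \<and> (x < r \<or> r = v) \<and>
    (\<forall>z\<in>{l..r}. h i z \<le> \<rho>) \<and> (l = u \<or> h i l = \<rho>) \<and> (r = v \<or> h i r = \<rho>)"
    unfolding H'_def using maximal_interval[OF cont x(1)] by simp
  then obtain L R where LR: "\<And>i. i \<in> H' \<Longrightarrow> u \<le> L i \<and> L i \<le> x \<and> x \<le> R i \<and> R i \<le> v \<and> (L i < x \<or> L i = u) \<and> (x < R i \<or> R i = v) \<and>
    (\<forall>z\<in>{L i..R i}. h i z \<le> \<rho>) \<and> (L i = u \<or> h i (L i) = \<rho>) \<and> (R i = v \<or> h i (R i) = \<rho>)"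
    by metis
  have fin': "finite H'" "H' \<noteq> {}" using fin x by (auto simp: H'_def)
  have "Max ((\<lambda>i. R i - L i) ` H') \<in> (\<lambda>i. R i - L i) ` H'" using fin' by (intro Max_in) auto
  then obtain i where i: "i \<in> H'" "R i - L i = Max ((\<lambda>i. R i - L i) ` H')" by auto
  have max: "R j - L j \<le> R i - L i" if "j \<in> H'" for j
    unfolding i(2) using fin' that by (intro Max_ge) auto
  have sup': "\<exists>z\<in>{L i..R i}. \<rho> \<le> h j z" if j: "j \<in> H" for j
  proof (rule ccontr)
    assume "\<not> ?thesis"
    then have neg: "\<And>z. z \<in> {L i..R i} \<Longrightarrow> h j z < \<rho>" by (auto simp: not_le)
    then have jH: "j \<in> H'" using LR[OF i(1)] j by (auto simp: H'_def)
    note j' = LR[OF jH] and i' = LR[OF i(1)]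
    have l: "L j \<le> L i \<and> (L j = L i \<longrightarrow> L j = u)"
    proof (cases "L j = u")
      case True then show ?thesis using i' by simp
    next
      case False
      then have "h j (L j) = \<rho>" using j' by blast
      then have "L j \<notin> {L i..R i}" using neg[of "L j"] by force
      moreover have "L j \<le> R i" using i' j' by linarith
      ultimately show ?thesis by simp
    qed
    have r: "R i \<le> R j \<and> (R j = R i \<longrightarrow> R j = v)"
    proof (cases "R j = v")
      case True then show ?thesis using i' by simp
    next
      case False
      then have "h j (R j) = \<rho>" using j' by blast
      then have "R j \<notin> {L i..R i}" using neg[of "R j"] by force
      moreover have "L i \<le> R j" using i' j' by linarith
      ultimately show ?thesis by simp
    qed
    have "L j = L i" "R j = R i" using max[OF jH] l r by linarith+
    then have "L i = u" "R i = v" using l r by auto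
    then show False using sup[OF j] neg by force
  qed
  show thesis
    by (rule that[of i "L i" "R i"]) (use i LR[OF i(1)] sup' in \<open>auto simp: H'_def\<close>)
qed

lemma compact_le_ge:
  fixes g h :: "real \<Rightarrow> real"
  assumes "continuous_on {u..v} g" "continuous_on {u..v} h"
  shows "compact {z \<in> {u..v}. e1 \<le> h z \<and> g z \<le> e}" "compact {z \<in> {u..v}. g z \<le> e}"
proof -
  have "closed {z \<in> {u..v}. e1 \<le> h z}" "closed {z \<in> {u..v}. g z \<le> e}"
    by (rule continuous_on_closed_Collect_le; auto intro!: continuous_intros assms)+
  moreover have "{z \<in> {u..v}. e1 \<le> h z \<and> g z \<le> e} = {z \<in> {u..v}. e1 \<le> h z} \<inter> {z \<in> {u..v}. g z \<le> e}" by auto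
  ultimately have "closed {z \<in> {u..v}. e1 \<le> h z \<and> g z \<le> e}" "closed {z \<in> {u..v}. g z \<le> e}" by auto
  moreover have "bounded {z \<in> {u..v}. e1 \<le> h z \<and> g z \<le> e}" "bounded {z \<in> {u..v}. g z \<le> e}"
    by (rule bounded_subset[of "{u..v}"]; auto)+
  ultimately show "compact {z \<in> {u..v}. e1 \<le> h z \<and> g z \<le> e}" "compact {z \<in> {u..v}. g z \<le> e}"
    by (simp_all add: compact_eq_bounded_closed)
qed

text \<open>Around each point take the longest interval on which some \<open>g a\<close> stays below \<open>\<rho>\<close>. On it every member
  of the family is somewhere at least \<open>\<rho>\<close>, while no essentially different \<open>g b\<close> can be small where \<open>h\<close>
  is not, so only the sublevel set of \<open>g a\<close> itself matters.\<close>

lemma fibre_measure_le: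
  fixes g :: "'i \<Rightarrow> real \<Rightarrow> real"
  assumes fin: "finite A" and cont: "\<And>a. a \<in> A \<Longrightarrow> continuous_on {u..v} (g a)" "continuous_on {u..v} h"
    and uv: "u \<le> v" and sup: "\<And>a. a \<in> A \<Longrightarrow> \<exists>z\<in>{u..v}. \<rho> \<le> g a z"
    and k: "0 \<le> k" and good: "\<And>a l r z. \<lbrakk>a \<in> A; u \<le> l; r \<le> v; z \<in> {l..r}; \<rho> \<le> g a z\<rbrakk> \<Longrightarrow>
      measure lebesgue {x \<in> {l..r}. g a x \<le> e} \<le> k * (r - l)"
    and pos: "\<And>a z. a \<in> A \<Longrightarrow> z \<in> {u..v} \<Longrightarrow> 0 \<le> g a z"
    and e: "e < \<rho>" "0 < e" "2 * \<rho> * e < e1"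
    and dich: "\<And>a b. \<lbrakk>a \<in> A; b \<in> A\<rbrakk> \<Longrightarrow> (\<forall>z\<in>{u..v}. g a z = g b z) \<or> (\<forall>z\<in>{u..v}. h z \<le> 2 * g a z * g b z)"
  shows "measure lebesgue {z \<in> {u..v}. e1 \<le> h z \<and> (\<exists>a\<in>A. g a z \<le> e)} \<le> 2 * k * (v - u)"
proof (rule measure_le_interval_cover[OF _ _ uv k])
  let ?E = "{z \<in> {u..v}. e1 \<le> h z \<and> (\<exists>a\<in>A. g a z \<le> e)}"
  have "?E = (\<Union>a\<in>A. {z \<in> {u..v}. e1 \<le> h z \<and> g a z \<le> e})" by auto
  moreover have "compact \<dots>" by (intro compact_UN compact_le_ge(1) fin cont)
  ultimately show "compact ?E" by (simp only:)
  show "?E \<subseteq> {u..v}" by auto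
  fix x assume x: "x \<in> ?E"
  then obtain a0 where a0: "a0 \<in> A" "g a0 x < \<rho>" using e by force
  obtain a l r where a: "a \<in> A" "u \<le> l" "l \<le> x" "x \<le> r" "r \<le> v" "l < x \<or> l = u" "x < r \<or> r = v"
    "\<And>z. z \<in> {l..r} \<Longrightarrow> g a z \<le> \<rho>" "\<And>j. j \<in> A \<Longrightarrow> \<exists>z\<in>{l..r}. \<rho> \<le> g j z"
    using longest_maximal_interval[of A u v g \<rho> x a0] fin cont sup x a0 by auto
  have sub: "?E \<inter> {l..r} \<subseteq> {z \<in> {l..r}. g a z \<le> e}"
  proof
    fix z assume "z \<in> ?E \<inter> {l..r}"
    then obtain b where z: "z \<in> {l..r}" "z \<in> {u..v}" "e1 \<le> h z" "b \<in> A" "g b z \<le> e" by auto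
    have "g a z = g b z"
    proof (rule ccontr)
      assume "g a z \<noteq> g b z"
      then have "h z \<le> 2 * g a z * g b z" using dich[OF a(1) z(4)] z(2) by auto
      also have "\<dots> \<le> 2 * \<rho> * e" using a(8)[OF z(1)] z pos[OF z(4,2)] pos[OF a(1) z(2)] e
        by (intro mult_mono) auto
      finally show False using e z by simp
    qed
    then show "z \<in> {z \<in> {l..r}. g a z \<le> e}" using z by simp
  qed
  have ca: "compact {z \<in> {l..r}. g a z \<le> e}"
  proof (rule compact_le_ge(2))
    show "continuous_on {l..r} (g a)" "continuous_on {l..r} (g a)"
      by (rule continuous_on_subset[OF cont(1)[OF a(1)]]; use a(2,5) in auto)+
  qed
  have "compact ?E" by fact
  then have "measure lebesgue (?E \<inter> {l..r}) \<le> measure lebesgue {z \<in> {l..r}. g a z \<le> e}"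
    by (intro measure_mono_fmeasurable[OF sub] lmeasurable_compact ca fmeasurableD compact_Int compact_Icc)
  also have "\<dots> \<le> k * (r - l)"
  proof -
    obtain z where "z \<in> {l..r}" "\<rho> \<le> g a z" using a(9)[OF a(1)] by blast
    then show ?thesis by (rule good[OF a(1,2,5)])
  qed
  finally have "measure lebesgue (?E \<inter> {l..r}) \<le> k * (r - l)" .
  then show "\<exists>l r. u \<le> l \<and> l \<le> x \<and> x \<le> r \<and> r \<le> v \<and> (l < x \<or> l = u) \<and> (x < r \<or> r = v) \<and>
      measure lebesgue (?E \<inter> {l..r}) \<le> k * (r - l)"
    by (intro exI[of _ l] exI[of _ r] conjI a(2-7))
qed

section \<open>Integer triples, cross products and primitive vectors\<close>

type_synonym triple = "int \<times> int \<times> int"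

fun cross :: "triple \<Rightarrow> triple \<Rightarrow> triple" where
  "cross (a, b, c) (d, e, f) = (b * f - c * e, c * d - a * f, a * e - b * d)"

fun dot :: "triple \<Rightarrow> triple \<Rightarrow> int" where
  "dot (a, b, c) (d, e, f) = a * d + b * e + c * f"

fun scale :: "int \<Rightarrow> triple \<Rightarrow> triple" where
  "scale k (a, b, c) = (k * a, k * b, k * c)"

fun primitive :: "triple \<Rightarrow> bool" where
  "primitive (a, b, c) \<longleftrightarrow> gcd a (gcd b c) = 1"

lemma gcd_scale_triple: "gcd (k * a) (gcd (k * b) (k * c)) = \<bar>k\<bar> * gcd a (gcd b c)" for a b c k :: int
proof -
  have "gcd (k * a) (gcd (k * b) (k * c)) = gcd \<bar>k * a\<bar> (gcd \<bar>k * b\<bar> \<bar>k * c\<bar>)" by (simp del: abs_mult)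
  also have "\<dots> = gcd (\<bar>k\<bar> * \<bar>a\<bar>) (gcd (\<bar>k\<bar> * \<bar>b\<bar>) (\<bar>k\<bar> * \<bar>c\<bar>))" by (simp only: abs_mult)
  also have "\<dots> = \<bar>k\<bar> * gcd \<bar>a\<bar> (gcd \<bar>b\<bar> \<bar>c\<bar>)" by (metis abs_abs gcd_mult_distrib_int)
  finally show ?thesis by simp
qed

lemma primitive_nonzero: "primitive v \<Longrightarrow> v \<noteq> (0, 0, 0)" by auto

lemma primitive_part:
  assumes "v \<noteq> (0, 0, 0)"
  obtains k w where "v = scale k w" "1 \<le> k" "primitive w"
proof -
  obtain a b c where v: "v = (a, b, c)" by (cases v)
  define g where "g = gcd a (gcd b c)"
  have g: "g > 0" using assms by (auto simp: g_def v)
  have dv: "g dvd a" "g dvd b" "g dvd c" 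
    unfolding g_def by (auto intro: dvd_trans[OF gcd_dvd2])
  then obtain a' b' c' where abc: "a = g * a'" "b = g * b'" "c = g * c'" by (auto elim!: dvdE)
  have "g = \<bar>g\<bar> * gcd a' (gcd b' c')"
    by (subst (1) g_def) (simp only: abc gcd_scale_triple)
  then have "gcd a' (gcd b' c') = 1" using g by simp
  then show thesis using that[of g "(a', b', c')"] g abc v by simp
qed

text \<open>A Bezout relation among the entries of \<open>v\<close> yields the factor:
  \<open>l\<close> is the same combination of the entries of \<open>w\<close>.\<close>

lemma parallel_primitive:
  assumes "primitive v" "cross v w = (0, 0, 0)"
  obtains l where "w = scale l v"
proof -
  obtain a b c d e f where v: "v = (a, b, c)" and w: "w = (d, e, f)" by (cases v, cases w)
  obtain s t where st: "s * b + t * c = gcd b c" using bezout_int by blast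
  obtain x y where xy: "x * a + y * gcd b c = 1" using bezout_int[of a "gcd b c"] assms(1) v by auto
  have one: "x * a + (y * s) * b + (y * t) * c = 1" using xy unfolding st[symmetric] by (simp add: algebra_simps)
  have cr: "b * f = c * e" "c * d = a * f" "a * e = b * d" using assms(2) by (auto simp: v w)
  define l where "l = x * d + (y * s) * e + (y * t) * f"
  have "d = (x * a + (y * s) * b + (y * t) * c) * d" using one by simp
  also have "\<dots> = x * d * a + y * s * (b * d) + y * t * (c * d)" by (simp add: algebra_simps)
  also have "\<dots> = l * a" unfolding cr(2) cr(3)[symmetric] by (simp add: l_def algebra_simps)
  finally have 1: "d = l * a" .
  have "e = (x * a + (y * s) * b + (y * t) * c) * e" using one by simp
  also have "\<dots> = x * (a * e) + y * s * e * b + y * t * (c * e)" by (simp add: algebra_simps)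
  also have "\<dots> = l * b" unfolding cr(3) cr(1)[symmetric] by (simp add: l_def algebra_simps)
  finally have 2: "e = l * b" .
  have "f = (x * a + (y * s) * b + (y * t) * c) * f" using one by simp
  also have "\<dots> = x * (a * f) + y * s * (b * f) + y * t * f * c" by (simp add: algebra_simps)
  also have "\<dots> = l * c" unfolding cr(1) cr(2)[symmetric] by (simp add: l_def algebra_simps)
  finally have 3: "f = l * c" .
  show thesis using that[of l] 1 2 3 by (simp add: v w)
qed

lemma parallel_primitives:
  assumes "primitive v" "primitive w" "cross v w = (0, 0, 0)"
  obtains l where "w = scale l v" "\<bar>l\<bar> = 1"
proof -
  obtain l where l: "w = scale l v" using parallel_primitive assms by blast
  obtain a b c where v: "v = (a, b, c)" by (cases v)
  have "\<bar>l\<bar> * gcd a (gcd b c) = 1" using assms(2) l v by (simp add: gcd_scale_triple)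
  then have "\<bar>l\<bar> = 1" using assms(1) v by simp
  then show thesis using that l by blast
qed

lemma cross_perp: "dot a (cross a b) = 0" "dot b (cross a b) = 0"
  by (cases a, cases b, simp add: algebra_simps)+

text \<open>The expansion of v x (a x b) as a (v.b) - b (v.a).\<close>

lemma cross_of_perp:
  assumes "dot v a = 0" "dot v b = 0"
  shows "cross v (cross a b) = (0, 0, 0)"
proof -
  obtain x y z where v: "v = (x, y, z)" by (cases v)
  obtain a1 a2 a3 where a: "a = (a1, a2, a3)" by (cases a)
  obtain b1 b2 b3 where b: "b = (b1, b2, b3)" by (cases b)
  have A: "x * a1 + y * a2 + z * a3 = 0" "x * b1 + y * b2 + z * b3 = 0" using assms by (auto simp: v a b)
  have "y * (a1*b2 - a2*b1) - z * (a3*b1 - a1*b3) = a1 * (x * b1 + y * b2 + z * b3) - b1 * (x * a1 + y * a2 + z * a3)"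
    "z * (a2*b3 - a3*b2) - x * (a1*b2 - a2*b1) = a2 * (x * b1 + y * b2 + z * b3) - b2 * (x * a1 + y * a2 + z * a3)"
    "x * (a3*b1 - a1*b3) - y * (a2*b3 - a3*b2) = a3 * (x * b1 + y * b2 + z * b3) - b3 * (x * a1 + y * a2 + z * a3)"
    by (simp_all add: algebra_simps)
  then show ?thesis unfolding A by (simp add: v a b)
qed

lemma dot_commute: "dot v w = dot w v" by (cases v; cases w; simp)
lemma dot_scale: "dot v (scale k w) = k * dot v w" by (cases v; cases w; simp add: algebra_simps)

text \<open>\<open>N\<close> and \<open>M\<close> are the norms of integer vectors and covectors at the point \<open>x\<close>; the covectors
  are identified with primitive planes, and the axioms are symmetric under exchanging the two.\<close>

locale dual_norms =
  fixes N M :: "triple \<Rightarrow> real \<Rightarrow> real" and u v e k :: real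
  assumes uv: "u \<le> v" and e: "0 < e" "e < 1/4" and k: "0 \<le> k"
    and N_cross: "x \<in> {u..v} \<Longrightarrow> M (cross a b) x \<le> 2 * N a x * N b x"
    and M_cross: "x \<in> {u..v} \<Longrightarrow> N (cross a b) x \<le> 2 * M a x * M b x"
    and N_M_dot: "x \<in> {u..v} \<Longrightarrow> \<bar>of_int (dot a b)\<bar> \<le> 3 * N a x * M b x"
    and N_scale: "x \<in> {u..v} \<Longrightarrow> N (scale j a) x = \<bar>of_int j\<bar> * N a x"
    and M_scale: "x \<in> {u..v} \<Longrightarrow> M (scale j a) x = \<bar>of_int j\<bar> * M a x"
    and N_nonneg: "x \<in> {u..v} \<Longrightarrow> 0 \<le> N a x" and M_nonneg: "x \<in> {u..v} \<Longrightarrow> 0 \<le> M a x"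
    and N_cont: "continuous_on {u..v} (N a)" and M_cont: "continuous_on {u..v} (M a)"
    and N_good: "\<lbrakk>u \<le> l; r \<le> v; z \<in> {l..r}; 1/4 \<le> N a z\<rbrakk> \<Longrightarrow>
      measure lebesgue {x \<in> {l..r}. N a x \<le> e} \<le> k * (r - l)"
    and M_good: "\<lbrakk>u \<le> l; r \<le> v; z \<in> {l..r}; 1/4 \<le> M a z\<rbrakk> \<Longrightarrow>
      measure lebesgue {x \<in> {l..r}. M a x \<le> e} \<le> k * (r - l)"
    and N_sup: "a \<noteq> (0,0,0) \<Longrightarrow> \<exists>z\<in>{u..v}. 1/4 \<le> N a z"
    and M_sup: "a \<noteq> (0,0,0) \<Longrightarrow> \<exists>z\<in>{u..v}. 1/4 \<le> M a z"
    and N_fin: "finite {a. \<exists>z\<in>{u..v}. N a z < 1/4}" and M_fin: "finite {a. \<exists>z\<in>{u..v}. M a z < 1/4}"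

sublocale dual_norms \<subseteq> dual: dual_norms M N u v e k
proof unfold_locales
  fix x a b assume x: "x \<in> {u..v}"
  show "\<bar>of_int (dot a b)\<bar> \<le> 3 * M a x * N b x"
    using N_M_dot[OF x, of b a] by (simp add: dot_commute mult_ac)
qed (fact uv e k N_cross M_cross N_scale M_scale N_nonneg M_nonneg N_cont M_cont N_good M_good N_sup M_sup N_fin M_fin)+

context dual_norms
begin

text \<open>The level 1/4 is the \<rho> of the interval arguments; only these finitely many vectors
  can take part in them.\<close>

definition "short = {a. primitive a \<and> (\<exists>z\<in>{u..v}. N a z < 1/4)}"

lemma finite_short: "finite short"
  unfolding short_def by (rule finite_subset[OF Collect_mono N_fin]) (rule impI, erule conjunct2)

lemma primitive_shorter:
  assumes "a \<noteq> (0,0,0)"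
  obtains j w where "a = scale j w" "primitive w" "j \<noteq> 0" "\<And>x. x \<in> {u..v} \<Longrightarrow> N w x \<le> N a x"
proof -
  obtain j w where w: "a = scale j w" "1 \<le> j" "primitive w" using primitive_part[OF assms] .
  have "N w x \<le> N a x" if "x \<in> {u..v}" for x
  proof -
    have "1 * N w x \<le> \<bar>of_int j\<bar> * N w x" using w(2) N_nonneg[OF that] by (intro mult_right_mono) auto
    then show ?thesis using N_scale[OF that] w by simp
  qed
  moreover have "j \<noteq> 0" using w by simp
  ultimately show thesis using that w by blast
qed

end

context dual_norms
begin

text \<open>Two different planes through \<open>v0\<close> meet in the multiples of
  \<open>v0\<close>, so their norms satisfy N v0 \<le> 2 M a M b. Hence where N v0 exceeds
  \<open>e\<close>, a plane below \<open>e\<close> excludes any other plane below 1/4, and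
  \<open>fibre_measure_le\<close> applies to the planes through \<open>v0\<close>. The line itself
  costs \<open>k\<close>, the planes cost 2 k.\<close>

lemma measure_near_line:
  assumes v0: "primitive v0" and lr: "u \<le> l" "l \<le> r" "r \<le> v"
    and le: "\<And>z. z \<in> {l..r} \<Longrightarrow> N v0 z \<le> 1/4"
    and sup0: "\<exists>z\<in>{l..r}. 1/4 \<le> N v0 z"
    and sup: "\<And>a. a \<in> dual.short \<Longrightarrow> \<exists>z\<in>{l..r}. 1/4 \<le> M a z"
  shows "measure lebesgue {z \<in> {l..r}. N v0 z \<le> e \<or> (\<exists>a\<in>dual.short. dot v0 a = 0 \<and> M a z \<le> e)} \<le> 3 * k * (r - l)"
    "compact {z \<in> {l..r}. N v0 z \<le> e \<or> (\<exists>a\<in>dual.short. dot v0 a = 0 \<and> M a z \<le> e)}"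
proof -
  define A where "A = {a \<in> dual.short. dot v0 a = 0}"
  have finA: "finite A" unfolding A_def using dual.finite_short by simp
  define E1 where "E1 = {z \<in> {l..r}. N v0 z \<le> e}"
  define E2 where "E2 = {z \<in> {l..r}. e \<le> N v0 z \<and> (\<exists>a\<in>A. M a z \<le> e)}"
  have eq: "{z \<in> {l..r}. N v0 z \<le> e \<or> (\<exists>a\<in>dual.short. dot v0 a = 0 \<and> M a z \<le> e)} = E1 \<union> E2"
    by (auto simp: E1_def E2_def A_def)
  have cont: "continuous_on {l..r} (N a)" "continuous_on {l..r} (M a)" for a
    using lr by (auto intro: continuous_on_subset[OF N_cont] continuous_on_subset[OF M_cont])
  have c1: "compact E1" unfolding E1_def by (rule compact_le_ge[OF cont(1) cont(1)])
  have "E2 = (\<Union>a\<in>A. {z \<in> {l..r}. e \<le> N v0 z \<and> M a z \<le> e})" by (auto simp: E2_def)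
  moreover have "compact \<dots>" by (intro compact_UN compact_le_ge(1) finA cont)
  ultimately have c2: "compact E2" by (simp only:)
  show "compact {z \<in> {l..r}. N v0 z \<le> e \<or> (\<exists>a\<in>dual.short. dot v0 a = 0 \<and> M a z \<le> e)}"
    unfolding eq using c1 c2 by (rule compact_Un)
  obtain z0 where "z0 \<in> {l..r}" "1/4 \<le> N v0 z0" using sup0 by blast
  then have m1: "measure lebesgue E1 \<le> k * (r - l)" 
    unfolding E1_def using lr by (intro N_good) auto
  have m2: "measure lebesgue E2 \<le> 2 * k * (r - l)"
    unfolding E2_def
  proof (rule fibre_measure_le[where \<rho> = "1/4"])
    fix a b assume ab: "a \<in> A" "b \<in> A"
    then have pr: "primitive a" "primitive b" and d: "dot v0 a = 0" "dot v0 b = 0"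
      by (auto simp: A_def dual.short_def)
    show "(\<forall>z\<in>{l..r}. M a z = M b z) \<or> (\<forall>z\<in>{l..r}. N v0 z \<le> 2 * M a z * M b z)"
    proof (cases "cross a b = (0,0,0)")
      case True
      then obtain j where "b = scale j a" "\<bar>j\<bar> = 1" using parallel_primitives pr by blast
      then have "M a z = M b z" if "z \<in> {l..r}" for z
        using M_scale[of z j a] that lr by (auto simp flip: of_int_abs)
      then show ?thesis by blast
    next
      case False
      obtain j where j: "cross a b = scale j v0"
        using parallel_primitive[OF v0 cross_of_perp[OF d]] by blast
      then have "j \<noteq> 0" using False by (cases v0) auto
      have "N v0 z \<le> 2 * M a z * M b z" if "z \<in> {l..r}" for z
      proof -
        have z: "z \<in> {u..v}" using that lr by auto
        have "1 * N v0 z \<le> \<bar>of_int j\<bar> * N v0 z" using \<open>j \<noteq> 0\<close> N_nonneg[OF z]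
          by (intro mult_right_mono) (auto simp flip: of_int_abs)
        also have "\<dots> = N (cross a b) z" using N_scale[OF z] j by simp
        also have "\<dots> \<le> 2 * M a z * M b z" by (rule M_cross[OF z])
        finally show ?thesis by simp
      qed
      then show ?thesis by blast
    qed
  next
    fix a l' r' z assume "a \<in> A" "l \<le> l'" "r' \<le> r" "z \<in> {l'..r'}" "1/4 \<le> M a z"
    then show "measure lebesgue {x \<in> {l'..r'}. M a x \<le> e} \<le> k * (r' - l')"
      using lr by (intro M_good) auto
  qed (use finA cont lr k e sup M_nonneg in \<open>auto simp: A_def\<close>)
  have "measure lebesgue (E1 \<union> E2) \<le> measure lebesgue E1 + measure lebesgue E2"
    by (intro measure_Un_le fmeasurableD lmeasurable_compact c1 c2)
  then show "measure lebesgue {z \<in> {l..r}. N v0 z \<le> e \<or> (\<exists>a\<in>dual.short. dot v0 a = 0 \<and> M a z \<le> e)} \<le> 3 * k * (r - l)"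
    unfolding eq using m1 m2 by linarith
qed

end

context dual_norms
begin

text \<open>On the longest interval about a bad point every short vector can be tied to the line or
  plane that defines the interval. If it is a line \<open>v0\<close>, another vector of norm at most
  \<open>e\<close> spans with \<open>v0\<close> a plane of norm at most 2 (1/4) e < e. If it is a
  plane, the pairing of that vector with the plane is an integer of size at most 3 e/4 < 1, so the
  vector lies in the plane. In both cases \<open>measure_near_line\<close> or its dual gives 3 k,
  and the covering doubles it.\<close>

theorem nondivergence:
  "compact {x \<in> {u..v}. \<exists>a. a \<noteq> (0,0,0) \<and> N a x \<le> e}" (is "compact ?E")
  "measure lebesgue {x \<in> {u..v}. \<exists>a. a \<noteq> (0,0,0) \<and> N a x \<le> e} \<le> 6 * k * (v - u)"
proof -
  have E_alt: "\<exists>a\<in>short. N a x \<le> e" if "x \<in> ?E" for x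
  proof -
    obtain a where a: "x \<in> {u..v}" "a \<noteq> (0,0,0)" "N a x \<le> e" using \<open>x \<in> ?E\<close> by blast
    then obtain j w where w: "primitive w" "\<And>x. x \<in> {u..v} \<Longrightarrow> N w x \<le> N a x"
      using primitive_shorter by blast
    then have "N w x \<le> e" using a by force
    moreover have "w \<in> short" using w \<open>N w x \<le> e\<close> e a by (auto simp: short_def intro!: bexI[of _ x])
    ultimately show ?thesis by blast
  qed
  have "?E = (\<Union>a\<in>short. {x \<in> {u..v}. N a x \<le> e})"
  proof (rule set_eqI, rule iffI)
    fix x assume "x \<in> ?E"
    then show "x \<in> (\<Union>a\<in>short. {x \<in> {u..v}. N a x \<le> e})" using E_alt[of x] by blast
  next
    fix x assume "x \<in> (\<Union>a\<in>short. {x \<in> {u..v}. N a x \<le> e})"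
    then obtain a where a: "primitive a" "x \<in> {u..v}" "N a x \<le> e" unfolding short_def by blast
    with primitive_nonzero[OF a(1)] show "x \<in> ?E" by blast
  qed
  moreover have "compact \<dots>" by (intro compact_UN compact_le_ge(2)[OF N_cont N_cont] finite_short)
  ultimately show cE: "compact ?E" by (simp only:)
  have "measure lebesgue ?E \<le> 2 * (3 * k) * (v - u)"
  proof (rule measure_le_interval_cover[OF cE _ uv])
    show "0 \<le> 3 * k" using k by simp
    fix x assume x: "x \<in> ?E"
    \<comment> \<open>Lines and planes compete for the longest interval in a single family.\<close>
    define H where "H = Inl ` short \<union> Inr ` dual.short"
    define h where "h = case_sum N M"
    obtain a0 where a0: "a0 \<in> short" "N a0 x \<le> e" using E_alt[OF x] by blast
    have finH: "finite H" using finite_short dual.finite_short by (simp add: H_def)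
    have contH: "continuous_on {u..v} (h i)" for i using N_cont M_cont by (cases i) (auto simp: h_def)
    have supH: "\<exists>z\<in>{u..v}. 1/4 \<le> h i z" if "i \<in> H" for i
      using that N_sup M_sup primitive_nonzero by (auto simp: H_def h_def short_def dual.short_def)
    have xm: "x \<in> {u..v}" using x by blast
    have iH: "Inl a0 \<in> H" using a0 by (simp add: H_def)
    have i0: "h (Inl a0) x < 1/4" using a0 e by (simp add: h_def)
    obtain i l r where i: "i \<in> H" and lr: "u \<le> l" "l \<le> x" "x \<le> r" "r \<le> v" "l < x \<or> l = u" "x < r \<or> r = v"
      and le: "\<And>z. z \<in> {l..r} \<Longrightarrow> h i z \<le> 1/4" and sup: "\<And>j. j \<in> H \<Longrightarrow> \<exists>z\<in>{l..r}. 1/4 \<le> h j z"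
      using longest_maximal_interval[where h = h and \<rho> = "1/4" and u = u and v = v, OF finH contH supH xm iH i0] by blast
    have supN: "\<exists>z\<in>{l..r}. 1/4 \<le> N a z" if "a \<in> short" for a using sup[of "Inl a"] that by (auto simp: h_def H_def)
    have supM: "\<exists>z\<in>{l..r}. 1/4 \<le> M a z" if "a \<in> dual.short" for a using sup[of "Inr a"] that by (auto simp: h_def H_def)
    have cEl: "compact (?E \<inter> {l..r})" using cE by (intro compact_Int) auto
    have "measure lebesgue (?E \<inter> {l..r}) \<le> 3 * k * (r - l)"
    proof (cases i)
      case (Inl v0)
      have v0: "v0 \<in> short" using i Inl by (auto simp: H_def)
      let ?F = "{z \<in> {l..r}. N v0 z \<le> e \<or> (\<exists>a\<in>dual.short. dot v0 a = 0 \<and> M a z \<le> e)}"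
      have v0p: "primitive v0" using v0 by (simp add: short_def)
      have le0: "N v0 z \<le> 1/4" if "z \<in> {l..r}" for z using le[OF that] by (simp add: Inl h_def)
      have F: "measure lebesgue ?F \<le> 3 * k * (r - l)" "compact ?F"
        by (rule measure_near_line[OF v0p _ _ _ le0 supN[OF v0] supM]; use lr in auto)+
      have sub: "?E \<inter> {l..r} \<subseteq> ?F"
      proof
        fix z assume "z \<in> ?E \<inter> {l..r}"
        then have z: "z \<in> {l..r}" "z \<in> {u..v}" "z \<in> ?E" by auto
        obtain a where a: "a \<in> short" "N a z \<le> e" using E_alt[OF z(3)] by blast
        show "z \<in> ?F"
        proof (cases "cross v0 a = (0,0,0)")
          case True
          then obtain j where "a = scale j v0" "\<bar>j\<bar> = 1"
            using parallel_primitives[OF v0p, of a] a by (auto simp: short_def)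
          then have "N v0 z = N a z" using N_scale[OF z(2), of j v0] by (auto simp flip: of_int_abs)
          then show ?thesis using a z by auto
        next
          case False
          obtain j w where w: "cross v0 a = scale j w" "primitive w" "j \<noteq> 0" "\<And>x. x \<in> {u..v} \<Longrightarrow> M w x \<le> M (cross v0 a) x"
            using dual.primitive_shorter[OF False] by blast
          have "M w z \<le> M (cross v0 a) z" by (rule w(4)[OF z(2)])
          also have "\<dots> \<le> 2 * N v0 z * N a z" by (rule N_cross[OF z(2)])
          also have "\<dots> \<le> 2 * (1/4) * e" using le0[OF z(1)] a e N_nonneg[OF z(2)]
            by (intro mult_mono) auto
          finally have Mw: "M w z \<le> e" using e by simp
          have "j * dot v0 w = 0" using cross_perp(1)[of v0 a] w(1) by (simp add: dot_scale)
          then have "dot v0 w = 0" using w by simp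
          moreover have "w \<in> dual.short" using w Mw e z by (auto simp: dual.short_def intro!: bexI[of _ z])
          ultimately show ?thesis using Mw z by auto
        qed
      qed
      have "measure lebesgue (?E \<inter> {l..r}) \<le> measure lebesgue ?F"
        by (intro measure_mono_fmeasurable[OF sub] fmeasurableD lmeasurable_compact cEl F(2))
      then show ?thesis using F by linarith
    next
      case (Inr a0)
      have a0: "a0 \<in> dual.short" using i Inr by (auto simp: H_def)
      let ?F = "{z \<in> {l..r}. M a0 z \<le> e \<or> (\<exists>a\<in>short. dot a0 a = 0 \<and> N a z \<le> e)}"
      have a0p: "primitive a0" using a0 by (simp add: dual.short_def)
      have le0: "M a0 z \<le> 1/4" if "z \<in> {l..r}" for z using le[OF that] by (simp add: Inr h_def)
      have F: "measure lebesgue ?F \<le> 3 * k * (r - l)" "compact ?F"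
        by (rule dual.measure_near_line[OF a0p _ _ _ le0 supM[OF a0] supN]; use lr in auto)+
      have sub: "?E \<inter> {l..r} \<subseteq> ?F"
      proof
        fix z assume "z \<in> ?E \<inter> {l..r}"
        then have z: "z \<in> {l..r}" "z \<in> {u..v}" "z \<in> ?E" by auto
        obtain a where a: "a \<in> short" "N a z \<le> e" using E_alt[OF z(3)] by blast
        have "\<bar>of_int (dot a a0)\<bar> \<le> 3 * N a z * M a0 z" by (rule N_M_dot[OF z(2)])
        also have "\<dots> \<le> 3 * e * (1/4)" using le0[OF z(1)] a e N_nonneg[OF z(2)] M_nonneg[OF z(2)]
          by (intro mult_mono) auto
        also have "\<dots> < 1" using e by simp
        finally have "dot a0 a = 0" by (simp add: dot_commute[of a])
        then show "z \<in> ?F" using a z by auto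
      qed
      have "measure lebesgue (?E \<inter> {l..r}) \<le> measure lebesgue ?F"
        by (intro measure_mono_fmeasurable[OF sub] fmeasurableD lmeasurable_compact cEl F(2))
      then show ?thesis using F by linarith
    qed
    then show "\<exists>l r. u \<le> l \<and> l \<le> x \<and> x \<le> r \<and> r \<le> v \<and> (l < x \<or> l = u) \<and> (x < r \<or> r = v) \<and>
      measure lebesgue (?E \<inter> {l..r}) \<le> 3 * k * (r - l)"
      by (intro exI[of _ l] exI[of _ r] conjI lr)
  qed blast
  moreover have "2 * (3 * k) * (v - u) = 6 * k * (v - u)" by simp
  ultimately show "measure lebesgue ?E \<le> 6 * k * (v - u)" by (simp only:)
qed

end

subsection \<open>Nondivergence for lattices along a curve\<close>

definition max3 :: "real \<Rightarrow> real \<Rightarrow> real \<Rightarrow> real" where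
  "max3 a b c = max a (max b c)"

lemma max3_le_iff: "max3 a b c \<le> e \<longleftrightarrow> a \<le> e \<and> b \<le> e \<and> c \<le> e" by (simp add: max3_def)
lemma le_max3_iff: "e \<le> max3 a b c \<longleftrightarrow> e \<le> a \<or> e \<le> b \<or> e \<le> c" by (auto simp: max3_def le_max_iff_disj)
lemma max3_ge: "a \<le> max3 a b c" "b \<le> max3 a b c" "c \<le> max3 a b c" by (auto simp: max3_def)

lemma max3_scale: "0 \<le> k \<Longrightarrow> max3 (k * a) (k * b) (k * c) = k * max3 a b c"
  unfolding max3_def max_mult_distrib_left by simp

lemma abs_minor_le:
  assumes "\<bar>a\<bar> * s \<le> m" "\<bar>b\<bar> * t \<le> m" "\<bar>c\<bar> * s \<le> n" "\<bar>d\<bar> * t \<le> n" "0 \<le> s" "0 \<le> t"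
  shows "\<bar>a * d - b * c\<bar> * (s * t) \<le> 2 * m * (n::real)"
proof -
  have "0 \<le> \<bar>a\<bar> * s" "0 \<le> \<bar>c\<bar> * s" using assms by auto
  then have n0: "0 \<le> m" "0 \<le> n" using assms by linarith+
  have "\<bar>a * d - b * c\<bar> * (s * t) \<le> (\<bar>a * d\<bar> + \<bar>b * c\<bar>) * (s * t)"
    by (intro mult_right_mono abs_triangle_ineq4) (use assms in auto)
  also have "\<dots> = (\<bar>a\<bar> * s) * (\<bar>d\<bar> * t) + (\<bar>b\<bar> * t) * (\<bar>c\<bar> * s)" by (simp add: abs_mult algebra_simps)
  also have "\<dots> \<le> m * n + m * n" using assms n0 by (intro add_mono mult_mono) auto
  finally show ?thesis by simp
qed

text \<open>One coordinate that is at least 1/4 at \<open>z\<close> suffices: its goodness bounds a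
  quarter of the squared measure by C e (r - l)^2.\<close>

lemma measure_max3_le:
  assumes g: "good_on C u v g1" "good_on C u v g2" "good_on C u v g3"
    and cont: "continuous_on {u..v} g1" "continuous_on {u..v} g2" "continuous_on {u..v} g3"
    and s: "0 < s1" "0 < s2" "0 < s3" and e: "0 < e" and C: "0 \<le> C"
    and lr: "u \<le> l" "r \<le> v" "z \<in> {l..r}" "1/4 \<le> max3 (\<bar>g1 z\<bar> * s1) (\<bar>g2 z\<bar> * s2) (\<bar>g3 z\<bar> * s3)"
  shows "measure lebesgue {x \<in> {l..r}. max3 (\<bar>g1 x\<bar> * s1) (\<bar>g2 x\<bar> * s2) (\<bar>g3 x\<bar> * s3) \<le> e} \<le> sqrt (4 * C * e) * (r - l)"
proof -
  let ?S = "{x \<in> {l..r}. max3 (\<bar>g1 x\<bar> * s1) (\<bar>g2 x\<bar> * s2) (\<bar>g3 x\<bar> * s3) \<le> e}"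
  have *: "measure lebesgue ?S \<le> sqrt (4 * C * e) * (r - l)"
    if g: "good_on C u v g" "continuous_on {u..v} g" "0 < s" "1/4 \<le> \<bar>g z\<bar> * s" 
      and sub: "\<And>x. x \<in> ?S \<Longrightarrow> \<bar>g x\<bar> * s \<le> e" for g s
  proof -
    let ?T = "{x \<in> {l..r}. \<bar>g x\<bar> \<le> e / s}"
    have sub': "?S \<subseteq> ?T" using sub \<open>0 < s\<close> by (auto simp: field_simps)
    have cT: "compact ?T" using lr by (intro compact_sublevel continuous_on_subset[OF g(2)]) auto
    have cS: "compact ?S"
    proof -
      have c: "continuous_on {l..r} g1" "continuous_on {l..r} g2" "continuous_on {l..r} g3"
        using lr by (auto intro: continuous_on_subset[OF cont(1)] continuous_on_subset[OF cont(2)] continuous_on_subset[OF cont(3)])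
      show ?thesis unfolding max3_def
        by (rule compact_le_ge(2)[where h = "\<lambda>x. 0"]) (intro continuous_intros c)+
    qed
    have le: "measure lebesgue ?S \<le> measure lebesgue ?T"
      by (intro measure_mono_fmeasurable[OF sub'] fmeasurableD lmeasurable_compact cT cS)
    have "\<bar>g z\<bar> * (measure lebesgue ?T)\<^sup>2 \<le> C * (e / s) * (r - l)\<^sup>2"
      using g(1) lr e \<open>0 < s\<close> unfolding good_on_def by (meson divide_pos_pos)
    then have "(\<bar>g z\<bar> * s) * (measure lebesgue ?T)\<^sup>2 \<le> C * e * (r - l)\<^sup>2"
      using \<open>0 < s\<close> by (simp add: field_simps)
    moreover have "1/4 * (measure lebesgue ?T)\<^sup>2 \<le> (\<bar>g z\<bar> * s) * (measure lebesgue ?T)\<^sup>2"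
      using g(4) by (intro mult_right_mono) auto
    ultimately have "(measure lebesgue ?T)\<^sup>2 \<le> (4 * C * e) * (r - l)\<^sup>2" by linarith
    then have "measure lebesgue ?T \<le> sqrt ((4 * C * e) * (r - l)\<^sup>2)" by (rule real_le_rsqrt)
    also have "\<dots> = sqrt (4 * C * e) * (r - l)" using lr by (simp add: real_sqrt_mult)
    finally show ?thesis using le by linarith
  qed
  consider "1/4 \<le> \<bar>g1 z\<bar> * s1" | "1/4 \<le> \<bar>g2 z\<bar> * s2" | "1/4 \<le> \<bar>g3 z\<bar> * s3"
    using lr(4) by (auto simp: le_max3_iff)
  then show ?thesis
  proof cases
    case 1 then show ?thesis by (rule *[OF g(1) cont(1) s(1)]) (auto simp: max3_le_iff)
  next
    case 2 then show ?thesis by (rule *[OF g(2) cont(2) s(2)]) (auto simp: max3_le_iff)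
  next
    case 3 then show ?thesis by (rule *[OF g(3) cont(3) s(3)]) (auto simp: max3_le_iff)
  qed
qed

lemma finite_bounded_triples:
  assumes "\<And>a b c. (a, b, c) \<in> S \<Longrightarrow> \<bar>real_of_int a\<bar> \<le> K \<and> \<bar>real_of_int b\<bar> \<le> K \<and> \<bar>real_of_int c\<bar> \<le> K"
  shows "finite (S :: triple set)"
proof (rule finite_subset)
  let ?I = "{-\<lceil>K\<rceil>..\<lceil>K\<rceil>}"
  have I: "i \<in> ?I" if "\<bar>real_of_int i\<bar> \<le> K" for i
  proof -
    have "real_of_int i \<le> K" "- real_of_int i \<le> K" using that by linarith+
    then show ?thesis by (simp; linarith)
  qed
  show "S \<subseteq> ?I \<times> ?I \<times> ?I"
  proof
    fix x assume "x \<in> S"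
    moreover obtain a b c where "x = (a, b, c)" by (cases x)
    ultimately show "x \<in> ?I \<times> ?I \<times> ?I" using I assms by blast
  qed
qed auto

context curved
begin

text \<open>The triple \<open>(q, p1, p2)\<close> stands for the rational point \<open>(p1/q, p2/q)\<close>; its third coordinate
  at \<open>x\<close> measures the distance of that point to the tangent line of the curve at \<open>x\<close>.\<close>

fun y1 :: "triple \<Rightarrow> real \<Rightarrow> real" where "y1 (q, p1, p2) x = q"
fun y2 :: "triple \<Rightarrow> real \<Rightarrow> real" where "y2 (q, p1, p2) x = q * x - p1"
fun y3 :: "triple \<Rightarrow> real \<Rightarrow> real" where "y3 (q, p1, p2) x = q * f x - p2 - D x * (q * x - p1)"
text \<open>\<open>z1\<close> is a linear form restricted to the curve and \<open>z2\<close> its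
  derivative along the curve; \<open>y_z_dot\<close> exhibits the duality with the coordinates of
  points.\<close>

fun z1 :: "triple \<Rightarrow> real \<Rightarrow> real" where "z1 (a0, a1, a2) x = a0 + a1 * x + a2 * f x"
fun z2 :: "triple \<Rightarrow> real \<Rightarrow> real" where "z2 (a0, a1, a2) x = a1 + a2 * D x"
fun z3 :: "triple \<Rightarrow> real \<Rightarrow> real" where "z3 (a0, a1, a2) x = a2"

definition "pnorm s1 s2 s3 a x = max3 (\<bar>y1 a x\<bar> * s1) (\<bar>y2 a x\<bar> * s2) (\<bar>y3 a x\<bar> * s3)"
definition "dnorm t1 t2 t3 a x = max3 (\<bar>z1 a x\<bar> * t1) (\<bar>z2 a x\<bar> * t2) (\<bar>z3 a x\<bar> * t3)"

text \<open>The passage from a triple to \<open>y1\<close>, \<open>y2\<close>, \<open>y3\<close> is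
  linear of determinant 1, so the 2 x 2 minors of these coordinates are the dual coordinates of the
  cross product, up to order and sign.\<close>

lemma z_cross:
  "z1 (cross a b) x = y2 a x * y3 b x - y3 a x * y2 b x"
  "z2 (cross a b) x = y1 a x * y3 b x - y3 a x * y1 b x"
  "z3 (cross a b) x = y2 a x * y1 b x - y1 a x * y2 b x"
proof -
  obtain a1 a2 a3 b1 b2 b3 where ab: "a = (a1, a2, a3)" "b = (b1, b2, b3)" by (cases a, cases b)
  note simps = ab y1.simps y2.simps y3.simps z1.simps z2.simps z3.simps cross.simps of_int_diff of_int_mult
  show "z1 (cross a b) x = y2 a x * y3 b x - y3 a x * y2 b x" unfolding simps by algebra
  show "z2 (cross a b) x = y1 a x * y3 b x - y3 a x * y1 b x" unfolding simps by algebra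
  show "z3 (cross a b) x = y2 a x * y1 b x - y1 a x * y2 b x" unfolding simps by algebra
qed

lemma y_cross:
  "y1 (cross a b) x = z2 a x * z3 b x - z3 a x * z2 b x"
  "y2 (cross a b) x = z1 a x * z3 b x - z3 a x * z1 b x"
  "y3 (cross a b) x = z2 a x * z1 b x - z1 a x * z2 b x"
proof -
  obtain a1 a2 a3 b1 b2 b3 where ab: "a = (a1, a2, a3)" "b = (b1, b2, b3)" by (cases a, cases b)
  note simps = ab y1.simps y2.simps y3.simps z1.simps z2.simps z3.simps cross.simps of_int_diff of_int_mult
  show "y1 (cross a b) x = z2 a x * z3 b x - z3 a x * z2 b x" unfolding simps by algebra
  show "y2 (cross a b) x = z1 a x * z3 b x - z3 a x * z1 b x" unfolding simps by algebra
  show "y3 (cross a b) x = z2 a x * z1 b x - z1 a x * z2 b x" unfolding simps by algebra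
qed

lemma y_z_dot: "of_int (dot a b) = y1 a x * z1 b x - y2 a x * z2 b x - y3 a x * z3 b x"
proof -
  obtain a1 a2 a3 b1 b2 b3 where ab: "a = (a1, a2, a3)" "b = (b1, b2, b3)" by (cases a, cases b)
  show ?thesis
    unfolding ab y1.simps y2.simps y3.simps z1.simps z2.simps z3.simps dot.simps of_int_add of_int_mult by algebra
qed

lemma y_scale: "y1 (scale j a) x = of_int j * y1 a x" "y2 (scale j a) x = of_int j * y2 a x" "y3 (scale j a) x = of_int j * y3 a x"
proof -
  obtain a1 a2 a3 where a: "a = (a1, a2, a3)" by (cases a)
  show "y1 (scale j a) x = of_int j * y1 a x" "y2 (scale j a) x = of_int j * y2 a x" "y3 (scale j a) x = of_int j * y3 a x"
    unfolding a y1.simps y2.simps y3.simps scale.simps of_int_mult by (rule refl | algebra)+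
qed

lemma z_scale: "z1 (scale j a) x = of_int j * z1 a x" "z2 (scale j a) x = of_int j * z2 a x" "z3 (scale j a) x = of_int j * z3 a x"
proof -
  obtain a1 a2 a3 where a: "a = (a1, a2, a3)" by (cases a)
  show "z1 (scale j a) x = of_int j * z1 a x" "z2 (scale j a) x = of_int j * z2 a x" "z3 (scale j a) x = of_int j * z3 a x"
    unfolding a z1.simps z2.simps z3.simps scale.simps of_int_mult by (rule refl | algebra)+
qed

lemma cont_y: "continuous_on {u..v} (y1 a)" "continuous_on {u..v} (y2 a)" "continuous_on {u..v} (y3 a)"
proof -
  obtain a1 a2 a3 where a: "a = (a1, a2, a3)" by (cases a)
  have e: "y1 a = (\<lambda>x. real_of_int a1)" "y2 a = (\<lambda>x. real_of_int a1 * x - real_of_int a2)"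
    "y3 a = (\<lambda>x. real_of_int a1 * f x - real_of_int a3 - D x * (real_of_int a1 * x - real_of_int a2))"
    by (simp_all only: a y1.simps y2.simps y3.simps fun_eq_iff simp_thms)
  show "continuous_on {u..v} (y1 a)" "continuous_on {u..v} (y2 a)" "continuous_on {u..v} (y3 a)"
    unfolding e by (intro continuous_intros cont_f cont_D)+
qed

lemma cont_z: "continuous_on {u..v} (z1 a)" "continuous_on {u..v} (z2 a)" "continuous_on {u..v} (z3 a)"
proof -
  obtain a1 a2 a3 where a: "a = (a1, a2, a3)" by (cases a)
  have e: "z1 a = (\<lambda>x. real_of_int a1 + real_of_int a2 * x + real_of_int a3 * f x)" "z2 a = (\<lambda>x. real_of_int a2 + real_of_int a3 * D x)"
    "z3 a = (\<lambda>x. real_of_int a3)"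
    by (simp_all only: a z1.simps z2.simps z3.simps fun_eq_iff simp_thms)
  show "continuous_on {u..v} (z1 a)" "continuous_on {u..v} (z2 a)" "continuous_on {u..v} (z3 a)"
    unfolding e by (intro continuous_intros cont_f cont_D)+
qed

lemma good_y: "good_on Cgood u v (y1 a)" "good_on Cgood u v (y2 a)" "good_on Cgood u v (y3 a)"
proof -
  obtain a1 a2 a3 where a: "a = (a1, a2, a3)" by (cases a)
  have e: "y1 a = (\<lambda>x. real_of_int a1)" "y2 a = (\<lambda>x. real_of_int a1 * x - real_of_int a2)"
    "y3 a = (\<lambda>x. real_of_int a1 * f x - real_of_int a3 - D x * (real_of_int a1 * x - real_of_int a2))"
    by (simp_all only: a y1.simps y2.simps y3.simps fun_eq_iff simp_thms)
  show "good_on Cgood u v (y1 a)" "good_on Cgood u v (y2 a)" "good_on Cgood u v (y3 a)"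
    unfolding e by (intro good_const good_linear good_tangent)+
qed

lemma good_z: "good_on Cgood u v (z1 a)" "good_on Cgood u v (z2 a)" "good_on Cgood u v (z3 a)"
proof -
  obtain a1 a2 a3 where a: "a = (a1, a2, a3)" by (cases a)
  have e: "z1 a = (\<lambda>x. real_of_int a1 + real_of_int a2 * x + real_of_int a3 * f x)" "z2 a = (\<lambda>x. real_of_int a2 + real_of_int a3 * D x)"
    "z3 a = (\<lambda>x. real_of_int a3)"
    by (simp_all only: a z1.simps z2.simps z3.simps fun_eq_iff simp_thms)
  show "good_on Cgood u v (z1 a)" "good_on Cgood u v (z2 a)" "good_on Cgood u v (z3 a)"
    unfolding e by (intro good_const good_form good_slope)+
qed

lemma bounded_curve:
  obtains B where "1 \<le> B" "\<And>x. x \<in> {u..v} \<Longrightarrow> \<bar>x\<bar> \<le> B \<and> \<bar>f x\<bar> \<le> B \<and> \<bar>D x\<bar> \<le> B"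
proof -
  define B where "B = 1 + \<bar>u\<bar> + \<bar>v\<bar> + \<bar>f u\<bar> + Lip * (v - u) + Db"
  have nn: "0 \<le> Lip * (v - u)" "0 \<le> Db" using Lip_nonneg Db_nonneg uv by auto
  have "\<bar>x\<bar> \<le> B \<and> \<bar>f x\<bar> \<le> B \<and> \<bar>D x\<bar> \<le> B" if x: "x \<in> {u..v}" for x
  proof -
    have "\<bar>f x - f u\<bar> \<le> Lip * \<bar>x - u\<bar>" using f_lip[of u x] x uv by auto
    also have "\<dots> \<le> Lip * (v - u)" using x Lip_nonneg by (intro mult_left_mono) auto
    finally have "\<bar>f x - f u\<bar> \<le> Lip * (v - u)" .
    moreover have "\<bar>x\<bar> \<le> \<bar>u\<bar> + \<bar>v\<bar>" using x by auto
    ultimately show ?thesis using D_bound[OF x] nn unfolding B_def by linarith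
  qed
  moreover have "1 \<le> B" using nn by (simp add: B_def)
  ultimately show thesis using that by blast
qed

text \<open>The conditions \<open>small\<close> keep nonzero integer vectors from staying below 1/4
  on the whole interval: t3 \<le> 4 serves the vectors (0,0,k), t2 \<le> 4 the others with q = 0,
  and t2 \<le> 2 (r - l) those with q \<noteq> 0. The conditions \<open>large\<close> do the same
  for covectors whose form is constant, affine, or contains \<open>f\<close>, in this order.\<close>

theorem curve_nondivergence:
  assumes lr: "u \<le> l" "l < r" "r \<le> v" and e: "0 < e" "e < 1/4"
    and t: "0 < t1" "0 < t2" "0 < t3" "t1 * t2 * t3 = 1"
    and large: "1 \<le> 4 * t1" "1 \<le> 2 * t1 * (r - l)" "4 \<le> t1 * c1 * (r - l)\<^sup>2"
    and small: "t2 \<le> 2 * (r - l)" "t2 \<le> 4" "t3 \<le> 4"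
  shows "compact {x \<in> {l..r}. \<exists>a. a \<noteq> (0,0,0) \<and> \<bar>y1 a x\<bar> \<le> e * t1 \<and> \<bar>y2 a x\<bar> \<le> e * t2 \<and> \<bar>y3 a x\<bar> \<le> e * t3}"
    "measure lebesgue {x \<in> {l..r}. \<exists>a. a \<noteq> (0,0,0) \<and> \<bar>y1 a x\<bar> \<le> e * t1 \<and> \<bar>y2 a x\<bar> \<le> e * t2 \<and> \<bar>y3 a x\<bar> \<le> e * t3}
       \<le> 6 * sqrt (4 * Cgood * e) * (r - l)"
proof -
  define s1 s2 s3 where s: "s1 = 1 / t1" "s2 = 1 / t2" "s3 = 1 / t3"
  have sp: "0 < s1" "0 < s2" "0 < s3" using t by (auto simp: s)
  \<comment> \<open>As the product of the scales is 1, each weight is the product of the two dual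
    weights that occur in the corresponding minor.\<close>
  have st: "t1 = s2 * s3" "t2 = s1 * s3" "t3 = s1 * s2" "s1 = t2 * t3" "s2 = t1 * t3" "s3 = t1 * t2"
    using t by (auto simp: s field_simps)
  have inv: "s1 * t1 = 1" "s2 * t2 = 1" "s3 * t3 = 1" using t by (auto simp: s)
  let ?N = "pnorm s1 s2 s3" and ?M = "dnorm t1 t2 t3"
  have sub: "x \<in> {u..v}" if "x \<in> {l..r}" for x using that lr by auto
  have yN: "\<bar>y1 a x\<bar> * s1 \<le> ?N a x" "\<bar>y2 a x\<bar> * s2 \<le> ?N a x" "\<bar>y3 a x\<bar> * s3 \<le> ?N a x" for a x
    unfolding pnorm_def by (rule max3_ge)+
  have zM: "\<bar>z1 a x\<bar> * t1 \<le> ?M a x" "\<bar>z2 a x\<bar> * t2 \<le> ?M a x" "\<bar>z3 a x\<bar> * t3 \<le> ?M a x" for a x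
    unfolding dnorm_def by (rule max3_ge)+
  obtain B where B: "1 \<le> B" "\<And>x. x \<in> {u..v} \<Longrightarrow> \<bar>x\<bar> \<le> B \<and> \<bar>f x\<bar> \<le> B \<and> \<bar>D x\<bar> \<le> B"
    using bounded_curve by blast
  interpret dual_norms ?N ?M l r e "sqrt (4 * Cgood * e)"
  proof
    show "l \<le> r" "0 < e" "e < 1/4" "0 \<le> sqrt (4 * Cgood * e)" using lr e Cgood_pos by auto
    fix x assume x: "x \<in> {l..r}"
    fix a b :: triple and j :: int
    show "?M (cross a b) x \<le> 2 * ?N a x * ?N b x"
    proof -
      have "\<bar>z1 (cross a b) x\<bar> * t1 \<le> 2 * ?N a x * ?N b x" 
        unfolding z_cross st(1) using abs_minor_le[OF yN(2) yN(3) yN(2) yN(3)] sp by simp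
      moreover have "\<bar>z2 (cross a b) x\<bar> * t2 \<le> 2 * ?N a x * ?N b x" 
        unfolding z_cross st(2) using abs_minor_le[OF yN(1) yN(3) yN(1) yN(3)] sp by simp
      moreover have "\<bar>z3 (cross a b) x\<bar> * t3 \<le> 2 * ?N a x * ?N b x" 
        unfolding z_cross st(3) mult.commute[of s1] using abs_minor_le[OF yN(2) yN(1) yN(2) yN(1)] sp by simp
      ultimately show ?thesis unfolding dnorm_def max3_le_iff by blast
    qed
    show "?N (cross a b) x \<le> 2 * ?M a x * ?M b x"
    proof -
      have "\<bar>y1 (cross a b) x\<bar> * s1 \<le> 2 * ?M a x * ?M b x" 
        unfolding y_cross st(4) using abs_minor_le[OF zM(2) zM(3) zM(2) zM(3)] t by simp
      moreover have "\<bar>y2 (cross a b) x\<bar> * s2 \<le> 2 * ?M a x * ?M b x" 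
        unfolding y_cross st(5) using abs_minor_le[OF zM(1) zM(3) zM(1) zM(3)] t by simp
      moreover have "\<bar>y3 (cross a b) x\<bar> * s3 \<le> 2 * ?M a x * ?M b x" 
        unfolding y_cross st(6) mult.commute[of t1] using abs_minor_le[OF zM(2) zM(1) zM(2) zM(1)] t by simp
      ultimately show ?thesis unfolding pnorm_def max3_le_iff by blast
    qed
    have Nn: "0 \<le> ?N a x" for a using order_trans[OF _ yN(1)[of a x]] sp by simp
    have Mn: "0 \<le> ?M a x" for a using order_trans[OF _ zM(1)[of a x]] t by simp
    show "0 \<le> ?N a x" "0 \<le> ?M a x" by (rule Nn Mn)+
    show "\<bar>of_int (dot a b)\<bar> \<le> 3 * ?N a x * ?M b x"
    proof -
      have *: "\<bar>y * z\<bar> \<le> ?N a x * ?M b x" if "\<bar>y\<bar> * s \<le> ?N a x" "\<bar>z\<bar> * t \<le> ?M b x" "s * t = 1" "0 < s" for y z s t :: real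
      proof -
        have "\<bar>y * z\<bar> = (\<bar>y\<bar> * s) * (\<bar>z\<bar> * t)" using that(3) by (simp add: abs_mult mult_ac)
        also have "\<dots> \<le> ?N a x * ?M b x"
        proof (rule mult_mono[OF that(1,2) Nn])
          have "0 < t" using that(3,4) by (metis zero_less_mult_pos zero_less_one)
          then show "0 \<le> \<bar>z\<bar> * t" by simp
        qed
        finally show ?thesis .
      qed
      have "\<bar>y1 a x * z1 b x\<bar> \<le> ?N a x * ?M b x" "\<bar>y2 a x * z2 b x\<bar> \<le> ?N a x * ?M b x" "\<bar>y3 a x * z3 b x\<bar> \<le> ?N a x * ?M b x"
        using *[OF yN(1) zM(1) inv(1) sp(1)] *[OF yN(2) zM(2) inv(2) sp(2)] *[OF yN(3) zM(3) inv(3) sp(3)] by auto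
      moreover have "3 * ?N a x * ?M b x = ?N a x * ?M b x + ?N a x * ?M b x + ?N a x * ?M b x" by simp
      ultimately show ?thesis unfolding y_z_dot[of a b x] by linarith
    qed
    show "?N (scale j a) x = \<bar>of_int j\<bar> * ?N a x"
      unfolding pnorm_def y_scale abs_mult mult.assoc by (rule max3_scale) simp
    show "?M (scale j a) x = \<bar>of_int j\<bar> * ?M a x"
      unfolding dnorm_def z_scale abs_mult mult.assoc by (rule max3_scale) simp
  next
    fix a :: triple
    have cy: "continuous_on {l..r} (y1 a)" "continuous_on {l..r} (y2 a)" "continuous_on {l..r} (y3 a)"
      using lr by (auto intro: continuous_on_subset[OF cont_y(1)] continuous_on_subset[OF cont_y(2)] continuous_on_subset[OF cont_y(3)])
    have cz: "continuous_on {l..r} (z1 a)" "continuous_on {l..r} (z2 a)" "continuous_on {l..r} (z3 a)"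
      using lr by (auto intro: continuous_on_subset[OF cont_z(1)] continuous_on_subset[OF cont_z(2)] continuous_on_subset[OF cont_z(3)])
    show "continuous_on {l..r} (?N a)" unfolding pnorm_def max3_def by (intro continuous_intros cy)
    show "continuous_on {l..r} (?M a)" unfolding dnorm_def max3_def by (intro continuous_intros cz)
    {
      fix l' r' z assume h: "l \<le> l'" "r' \<le> r" "z \<in> {l'..r'}" 
      then have h': "u \<le> l'" "r' \<le> v" using lr by auto
      have C: "0 \<le> Cgood" using Cgood_pos by simp
      show "measure lebesgue {x \<in> {l'..r'}. ?N a x \<le> e} \<le> sqrt (4 * Cgood * e) * (r' - l')"
        if "1/4 \<le> ?N a z"
        using that unfolding pnorm_def
        by (intro measure_max3_le[OF good_y cont_y sp e(1) C h' h(3)]) 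
      show "measure lebesgue {x \<in> {l'..r'}. ?M a x \<le> e} \<le> sqrt (4 * Cgood * e) * (r' - l')"
        if "1/4 \<le> ?M a z"
        using that unfolding dnorm_def
        by (intro measure_max3_le[OF good_z cont_z t(1-3) e(1) C h' h(3)]) 
    }
    assume a: "a \<noteq> (0,0,0)"
    obtain i j k where ijk: "a = (i, j, k)" by (cases a)
    show "\<exists>z\<in>{l..r}. 1/4 \<le> ?N a z"
    proof (cases "i = 0 \<and> j = 0")
      case True
      then have k: "1 \<le> \<bar>real_of_int k\<bar>" using a ijk by (simp flip: of_int_abs)
      have "1/4 \<le> 1 * s3" using small t by (simp add: s field_simps)
      also have "\<dots> \<le> \<bar>y3 a l\<bar> * s3" using k sp True ijk by (intro mult_right_mono) auto
      also have "\<dots> \<le> ?N a l" by (rule yN)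
      finally show ?thesis using lr by (intro bexI[of _ l]) auto
    next
      case False
      have "\<exists>z\<in>{l..r}. t2/4 \<le> \<bar>y2 a z\<bar>"
      proof (cases "i = 0")
        case True
        then have "1 \<le> \<bar>real_of_int j\<bar>" using False by (simp flip: of_int_abs)
        then show ?thesis using ijk True lr small by (intro bexI[of _ l]) auto
      next
        case False
        then have i: "1 \<le> \<bar>real_of_int i\<bar>" by (simp flip: of_int_abs)
        show ?thesis
        proof (rule ccontr)
          assume "\<not> ?thesis"
          then have "\<bar>y2 a l\<bar> < t2/4" "\<bar>y2 a r\<bar> < t2/4" using lr by (auto simp: not_le)
          then have "\<bar>y2 a r - y2 a l\<bar> < t2/2" by linarith
          moreover have "y2 a r - y2 a l = i * (r - l)" by (simp add: ijk algebra_simps)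
          moreover have "1 * (r - l) \<le> \<bar>real_of_int i\<bar> * (r - l)" using i lr by (intro mult_right_mono) auto
          ultimately show False using small lr by (simp add: abs_mult)
        qed
      qed
      then obtain z where z: "z \<in> {l..r}" "t2/4 \<le> \<bar>y2 a z\<bar>" by blast
      have "1/4 \<le> \<bar>y2 a z\<bar> * s2" using z t by (simp add: s field_simps)
      also have "\<dots> \<le> ?N a z" by (rule yN)
      finally show ?thesis using z by blast
    qed
    have "\<exists>z\<in>{l..r}. 1/4 \<le> \<bar>z1 a z\<bar> * t1"
    proof (cases "k = 0")
      case k0: True
      show ?thesis
      proof (cases "j = 0")
        case True
        then have "1 \<le> \<bar>real_of_int i\<bar>" using a ijk k0 by (simp flip: of_int_abs)
        then have "1 * t1 \<le> \<bar>z1 a l\<bar> * t1" using True k0 ijk t by (intro mult_right_mono) auto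
        then have "1/4 \<le> \<bar>z1 a l\<bar> * t1" using large(1) by linarith
        then show ?thesis using lr by (intro bexI[of _ l]) auto
      next
        case False
        then have j: "1 \<le> \<bar>real_of_int j\<bar>" by (simp flip: of_int_abs)
        show ?thesis
        proof (rule ccontr)
          assume "\<not> ?thesis"
          then have "\<bar>z1 a l\<bar> * t1 < 1/4" "\<bar>z1 a r\<bar> * t1 < 1/4" using lr by (auto simp: not_le)
          then have "(\<bar>z1 a l\<bar> + \<bar>z1 a r\<bar>) * t1 < 1/2" by (simp add: distrib_right)
          moreover have "\<bar>z1 a r - z1 a l\<bar> * t1 \<le> (\<bar>z1 a l\<bar> + \<bar>z1 a r\<bar>) * t1" using t by (intro mult_right_mono) auto
          moreover have "\<bar>z1 a r - z1 a l\<bar> * t1 = \<bar>real_of_int j\<bar> * (r - l) * t1"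
          proof -
            have "z1 a r - z1 a l = j * (r - l)" by (simp add: ijk k0 algebra_simps)
            then show ?thesis using lr by (simp add: abs_mult)
          qed
          moreover have "1 * (r - l) * t1 \<le> \<bar>real_of_int j\<bar> * (r - l) * t1" using j lr t by (intro mult_right_mono) auto
          moreover have "1 \<le> 2 * (1 * (r - l) * t1)" using large(2) by (simp only: mult_ac mult_1)
          ultimately show False by linarith
        qed
      qed
    next
      case False
      then have k: "1 \<le> \<bar>real_of_int k\<bar>" by (simp flip: of_int_abs)
      \<comment> \<open>The second difference at the midpoint eliminates the affine part of the
        form, and curvature makes it at least c1 h^2.\<close>
      define m where "m = (l + r) / 2"
      define h where "h = (r - l) / 2"
      have m: "l = m - h" "r = m + h" "m \<in> {l..r}" using lr by (auto simp: m_def h_def field_simps)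
      have "c1/2 * (l - m)\<^sup>2 + c1/2 * (r - m)\<^sup>2 \<le> (f l - f m - D m * (l - m)) + (f r - f m - D m * (r - m))"
        using lr m by (intro add_mono f_lower sub) auto
      also have "\<dots> = f l + f r - 2 * f m" by (simp add: m(1,2))
      finally have *: "c1 * h\<^sup>2 \<le> f l + f r - 2 * f m" by (simp add: m(1,2))
      show ?thesis
      proof (rule ccontr)
        assume "\<not> ?thesis"
        then have "\<bar>z1 a l\<bar> * t1 < 1/4" "\<bar>z1 a r\<bar> * t1 < 1/4" "\<bar>z1 a m\<bar> * t1 < 1/4" using lr m(3) by (auto simp: not_le)
        then have "(\<bar>z1 a l\<bar> + \<bar>z1 a r\<bar> + 2 * \<bar>z1 a m\<bar>) * t1 < 1" by (simp add: distrib_right)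
        moreover have "\<bar>z1 a l + z1 a r - 2 * z1 a m\<bar> * t1 \<le> (\<bar>z1 a l\<bar> + \<bar>z1 a r\<bar> + 2 * \<bar>z1 a m\<bar>) * t1"
          using t by (intro mult_right_mono) auto
        moreover have "\<bar>z1 a l + z1 a r - 2 * z1 a m\<bar> * t1 = \<bar>real_of_int k\<bar> * \<bar>f l + f r - 2 * f m\<bar> * t1"
        proof -
          have "z1 a l + z1 a r - 2 * z1 a m = k * (f l + f r - 2 * f m)" by (simp add: ijk m(1,2) algebra_simps)
          then show ?thesis by (simp only: abs_mult)
        qed
        moreover have "1 * (c1 * h\<^sup>2) * t1 \<le> \<bar>real_of_int k\<bar> * \<bar>f l + f r - 2 * f m\<bar> * t1"
          using k * c1 t by (intro mult_right_mono mult_mono) auto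
        moreover have "1 \<le> (c1 * h\<^sup>2) * t1" using large(3) by (simp add: h_def power_divide mult_ac)
        ultimately show False by linarith
      qed
    qed
    then obtain z where z: "z \<in> {l..r}" "1/4 \<le> \<bar>z1 a z\<bar> * t1" by blast
    moreover have "\<bar>z1 a z\<bar> * t1 \<le> ?M a z" by (rule zM)
    ultimately show "\<exists>z\<in>{l..r}. 1/4 \<le> ?M a z" by force
  next
    have bd: "\<bar>y\<bar> \<le> t" if "\<bar>y\<bar> * s < 1/4" "s * t = 1" "0 < t" for y s t :: real
    proof -
      have "\<bar>y\<bar> = (\<bar>y\<bar> * s) * t" using that(2) by simp
      also have "\<dots> \<le> 1 * t" using that by (intro mult_right_mono) auto
      finally show ?thesis by simp
    qed
    show "finite {a. \<exists>z\<in>{l..r}. ?N a z < 1/4}"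
    proof (rule finite_bounded_triples)
      fix q p1 p2 assume "(q, p1, p2) \<in> {a. \<exists>z\<in>{l..r}. ?N a z < 1/4}"
      then obtain x where x: "x \<in> {l..r}" "?N (q, p1, p2) x < 1/4" by blast
      let ?a = "(q, p1, p2)"
      have b: "\<bar>y1 ?a x\<bar> \<le> t1" "\<bar>y2 ?a x\<bar> \<le> t2" "\<bar>y3 ?a x\<bar> \<le> t3"
        using le_less_trans[OF yN(1) x(2)] le_less_trans[OF yN(2) x(2)] le_less_trans[OF yN(3) x(2)] bd inv t by auto
      note Bx = B(2)[OF sub[OF x(1)]]
      have q: "\<bar>real_of_int q\<bar> \<le> t1" using b(1) by simp
      have 1: "\<bar>q * x\<bar> \<le> t1 * B" "\<bar>q * f x\<bar> \<le> t1 * B" "\<bar>D x * y2 ?a x\<bar> \<le> B * t2"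
        unfolding abs_mult using q b(2) Bx t B(1) by (auto intro!: mult_mono)
      have p1: "\<bar>real_of_int p1\<bar> \<le> t1 * B + t2" using 1(1) b(2) by simp
      have p2: "\<bar>real_of_int p2\<bar> \<le> t1 * B + B * t2 + t3" using 1(2,3) b(3) unfolding y3.simps y2.simps by linarith
      have "0 \<le> t1 * B" "0 \<le> B * t2" using t B by auto
      then show "\<bar>real_of_int q\<bar> \<le> t1 + t1 * B + t2 + B * t2 + t3 \<and> \<bar>real_of_int p1\<bar> \<le> t1 + t1 * B + t2 + B * t2 + t3
          \<and> \<bar>real_of_int p2\<bar> \<le> t1 + t1 * B + t2 + B * t2 + t3"
        using q p1 p2 t by linarith
    qed
    show "finite {a. \<exists>z\<in>{l..r}. ?M a z < 1/4}"
    proof (rule finite_bounded_triples)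
      fix a0 a1 a2 assume "(a0, a1, a2) \<in> {a. \<exists>z\<in>{l..r}. ?M a z < 1/4}"
      then obtain x where x: "x \<in> {l..r}" "?M (a0, a1, a2) x < 1/4" by blast
      let ?a = "(a0, a1, a2)"
      have inv': "t1 * s1 = 1" "t2 * s2 = 1" "t3 * s3 = 1" using inv by (simp_all add: mult.commute)
      have b: "\<bar>z1 ?a x\<bar> \<le> s1" "\<bar>z2 ?a x\<bar> \<le> s2" "\<bar>z3 ?a x\<bar> \<le> s3"
        using le_less_trans[OF zM(1) x(2)] le_less_trans[OF zM(2) x(2)] le_less_trans[OF zM(3) x(2)] bd inv' sp by auto
      note Bx = B(2)[OF sub[OF x(1)]]
      define K where "K = s3 + s2 + s3 * B"
      have a2: "\<bar>real_of_int a2\<bar> \<le> s3" using b(3) by simp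
      have 1: "\<bar>a2 * f x\<bar> \<le> s3 * B" "\<bar>a2 * D x\<bar> \<le> s3 * B"
        unfolding abs_mult using a2 Bx sp B(1) by (auto intro!: mult_mono)
      have p: "0 \<le> s3 * B" using sp B by auto
      have a1: "\<bar>real_of_int a1\<bar> \<le> K" using 1(2) b(2) sp unfolding z2.simps K_def by linarith
      have K0: "0 \<le> K" using p sp by (simp add: K_def)
      have 2: "\<bar>a1 * x\<bar> \<le> K * B" unfolding abs_mult using a1 Bx K0 by (intro mult_mono) auto
      have a0: "\<bar>real_of_int a0\<bar> \<le> s1 + K * B + s3 * B" using 1(1) 2 b(1) unfolding z1.simps by linarith
      have "0 \<le> K * B" "s3 \<le> K" using K0 B p sp by (auto simp: K_def)
      then show "\<bar>real_of_int a0\<bar> \<le> K + (s1 + K * B + s3 * B) \<and> \<bar>real_of_int a1\<bar> \<le> K + (s1 + K * B + s3 * B)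
          \<and> \<bar>real_of_int a2\<bar> \<le> K + (s1 + K * B + s3 * B)"
        using a0 a1 a2 K0 p sp by linarith
    qed
  qed
  have iff: "?N a x \<le> e \<longleftrightarrow> \<bar>y1 a x\<bar> \<le> e * t1 \<and> \<bar>y2 a x\<bar> \<le> e * t2 \<and> \<bar>y3 a x\<bar> \<le> e * t3" for a x
    using t by (simp add: pnorm_def max3_le_iff s field_simps)
  show "compact {x \<in> {l..r}. \<exists>a. a \<noteq> (0,0,0) \<and> \<bar>y1 a x\<bar> \<le> e * t1 \<and> \<bar>y2 a x\<bar> \<le> e * t2 \<and> \<bar>y3 a x\<bar> \<le> e * t3}"
    "measure lebesgue {x \<in> {l..r}. \<exists>a. a \<noteq> (0,0,0) \<and> \<bar>y1 a x\<bar> \<le> e * t1 \<and> \<bar>y2 a x\<bar> \<le> e * t2 \<and> \<bar>y3 a x\<bar> \<le> e * t3}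
       \<le> 6 * sqrt (4 * Cgood * e) * (r - l)"
    using nondivergence unfolding iff .
qed

end

subsection \<open>Counting lattice points in boxes\<close>

text \<open>Folding the integral of the indicator of \<open>K\<close> onto the unit cube: if every point of the cube
  has at least \<open>N\<close> integer translates in \<open>K\<close>, then \<open>K\<close> has volume at least \<open>N\<close>.\<close>

lemma emeasure_ge_translates:
  fixes K C :: "'a::euclidean_space set" and W :: "'a set"
  assumes K: "K \<in> sets borel" and C: "C \<in> sets borel" "emeasure lborel C = 1"
    and W: "finite W" and disj: "disjoint_family_on (\<lambda>w. (+) w ` C) W"
    and many: "\<And>x. x \<in> C \<Longrightarrow> N \<le> card {w \<in> W. w + x \<in> K}"
  shows "of_nat N \<le> emeasure lborel K"
proof -
  have ind: "(\<lambda>x. indicator K (w + x) :: ennreal) \<in> borel_measurable borel" for w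
    using measurable_compose[OF _ borel_measurable_indicator[OF K], of "\<lambda>x. w + x" borel] by simp
  have "of_nat N = (\<integral>\<^sup>+x. of_nat N * indicator C x \<partial>lborel)"
    using C by (simp add: nn_integral_cmult_indicator)
  also have "\<dots> \<le> (\<integral>\<^sup>+x. (\<Sum>w\<in>W. indicator K (w + x) * indicator C x) \<partial>lborel)"
  proof (rule nn_integral_mono)
    fix x
    show "of_nat N * indicator C x \<le> (\<Sum>w\<in>W. indicator K (w + x) * indicator C x :: ennreal)"
    proof (cases "x \<in> C")
      case True
      have "(\<Sum>w\<in>W. indicator K (w + x) :: ennreal) = of_nat (card {w \<in> W. w + x \<in> K})"
        using W by (simp add: indicator_def sum.If_cases Int_def)
      then show ?thesis using many[OF True] True by simp
    qed simp
  qed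
  also have "\<dots> = (\<Sum>w\<in>W. \<integral>\<^sup>+x. indicator K (w + x) * indicator C x \<partial>lborel)"
    by (rule nn_integral_sum) (use ind C in auto)
  also have "\<dots> = (\<Sum>w\<in>W. emeasure lborel (K \<inter> (+) w ` C))"
  proof (rule sum.cong[OF refl])
    fix w
    have m: "(+) w ` C \<in> sets borel"
    proof -
      have "(+) w ` C = (\<lambda>y. y - w) -` C \<inter> space borel" by (force simp: image_iff)
      moreover have "(\<lambda>y. y - w) -` C \<inter> space borel \<in> sets borel"
        by (rule measurable_sets[OF _ C(1)]) simp
      ultimately show ?thesis by simp
    qed
    have "emeasure lborel (K \<inter> (+) w ` C) = (\<integral>\<^sup>+y. indicator (K \<inter> (+) w ` C) y \<partial>distr lborel borel ((+) w))"
      using K m by (simp add: lborel_distr_plus)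
    also have "\<dots> = (\<integral>\<^sup>+x. indicator (K \<inter> (+) w ` C) (w + x) \<partial>lborel)"
      using K m by (subst nn_integral_distr) auto
    also have "\<dots> = (\<integral>\<^sup>+x. indicator K (w + x) * indicator C x \<partial>lborel)"
      by (rule nn_integral_cong) (auto simp: indicator_def)
    finally show "(\<integral>\<^sup>+x. indicator K (w + x) * indicator C x \<partial>lborel) = emeasure lborel (K \<inter> (+) w ` C)" ..
  qed
  also have "\<dots> = emeasure lborel (\<Union>w\<in>W. K \<inter> (+) w ` C)"
  proof (rule sum_emeasure)
    show "(\<lambda>w. K \<inter> (+) w ` C) ` W \<subseteq> sets lborel"
    proof clarify
      fix w
      have "(+) w ` C = (\<lambda>y. y - w) -` C \<inter> space borel" by (force simp: image_iff)
      moreover have "(\<lambda>y. y - w) -` C \<inter> space borel \<in> sets borel"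
        by (rule measurable_sets[OF _ C(1)]) simp
      ultimately show "K \<inter> (+) w ` C \<in> sets lborel" using K by simp
    qed
    show "disjoint_family_on (\<lambda>w. K \<inter> (+) w ` C) W" using disj by (force simp: disjoint_family_on_def)
  qed (rule W)
  also have "\<dots> \<le> emeasure lborel K" using K by (intro emeasure_mono) auto
  finally show ?thesis .
qed

text \<open>With s = x, \<alpha> = f x - D x * x and \<beta> = D x this is the box |y1| \<le> b1,
  |y2| \<le> b2, |y3| \<le> b3 written in the variables q, p1, p2. The change of variables is a
  shear up to signs, hence preserves volume.\<close>

definition skew_box :: "real \<Rightarrow> real \<Rightarrow> real \<Rightarrow> real \<Rightarrow> real \<Rightarrow> real \<Rightarrow> (real \<times> real \<times> real) set" where
  "skew_box s \<alpha> \<beta> b1 b2 b3 =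
     {(y, z, w). \<bar>y\<bar> \<le> b1 \<and> \<bar>s * y - z\<bar> \<le> b2 \<and> \<bar>\<alpha> * y + \<beta> * z - w\<bar> \<le> b3}"

lemma closed_skew_box: "closed (skew_box s \<alpha> \<beta> b1 b2 b3)"
proof -
  have "skew_box s \<alpha> \<beta> b1 b2 b3 = {p. \<bar>fst p\<bar> \<le> b1} \<inter> {p. \<bar>s * fst p - fst (snd p)\<bar> \<le> b2}
     \<inter> {p. \<bar>\<alpha> * fst p + \<beta> * fst (snd p) - snd (snd p)\<bar> \<le> b3}"
    by (auto simp: skew_box_def)
  then show ?thesis by (auto intro!: closed_Int closed_Collect_le continuous_intros)
qed

lemma emeasure_skew_box:
  assumes b: "0 \<le> b1" "0 \<le> b2" "0 \<le> b3"
  shows "emeasure lborel (skew_box s \<alpha> \<beta> b1 b2 b3) = ennreal (8 * b1 * b2 * b3)"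
proof -
  define P where "P y = {p :: real \<times> real. \<bar>s * y - fst p\<bar> \<le> b2 \<and> \<bar>\<alpha> * y + \<beta> * fst p - snd p\<bar> \<le> b3}" for y
  have clP: "closed (P y)" for y
    unfolding P_def by (auto intro!: closed_Collect_conj closed_Collect_le continuous_intros)
  have P: "emeasure lborel (P y) = ennreal (4 * b2 * b3)" for y
  proof -
    have "emeasure lborel (P y) = emeasure (lborel \<Otimes>\<^sub>M lborel) (P y)" by (simp add: lborel_prod)
    also have "\<dots> = (\<integral>\<^sup>+z. emeasure lborel (Pair z -` P y) \<partial>lborel)"
      by (rule lborel.emeasure_pair_measure_alt) (simp only: lborel_prod sets_lborel, rule borel_closed, rule clP)
    also have "\<dots> = (\<integral>\<^sup>+z. ennreal (2 * b3) * indicator {s * y - b2..s * y + b2} z \<partial>lborel)"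
    proof (rule nn_integral_cong)
      fix z
      have "Pair z -` P y = (if z \<in> {s * y - b2..s * y + b2} then {\<alpha> * y + \<beta> * z - b3..\<alpha> * y + \<beta> * z + b3} else {})"
        by (auto simp: P_def)
      then show "emeasure lborel (Pair z -` P y) = ennreal (2 * b3) * indicator {s * y - b2..s * y + b2} z"
        using b by (simp add: indicator_def)
    qed
    also have "\<dots> = ennreal (2 * b3) * ennreal (2 * b2)"
      using b by (subst nn_integral_cmult_indicator) auto
    finally show ?thesis using b by (simp add: ennreal_mult[symmetric] mult_ac)
  qed
  have "emeasure lborel (skew_box s \<alpha> \<beta> b1 b2 b3) = emeasure (lborel \<Otimes>\<^sub>M lborel) (skew_box s \<alpha> \<beta> b1 b2 b3)"
    by (simp add: lborel_prod)
  also have "\<dots> = (\<integral>\<^sup>+y. emeasure lborel (Pair y -` skew_box s \<alpha> \<beta> b1 b2 b3) \<partial>lborel)"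
    by (rule lborel.emeasure_pair_measure_alt) (simp only: lborel_prod sets_lborel, rule borel_closed, rule closed_skew_box)
  also have "\<dots> = (\<integral>\<^sup>+y. ennreal (4 * b2 * b3) * indicator {-b1..b1} y \<partial>lborel)"
  proof (rule nn_integral_cong)
    fix y
    have "Pair y -` skew_box s \<alpha> \<beta> b1 b2 b3 = (if y \<in> {-b1..b1} then P y else {})"
      by (auto simp: P_def skew_box_def)
    then show "emeasure lborel (Pair y -` skew_box s \<alpha> \<beta> b1 b2 b3) = ennreal (4 * b2 * b3) * indicator {-b1..b1} y"
      using P[of y] by (simp add: indicator_def)
  qed
  also have "\<dots> = ennreal (4 * b2 * b3) * ennreal (2 * b1)"
    using b by (subst nn_integral_cmult_indicator) auto
  finally show ?thesis using b by (simp add: ennreal_mult[symmetric] mult_ac)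
qed

fun real_triple :: "triple \<Rightarrow> real \<times> real \<times> real" where
  "real_triple (a, b, c) = (of_int a, of_int b, of_int c)"

fun add3 :: "triple \<Rightarrow> triple \<Rightarrow> triple" where
  "add3 (a, b, c) (d, e, f) = (a + d, b + e, c + f)"

lemma inj_real_triple: "inj_on real_triple S"
  by (intro inj_onI) (auto elim!: real_triple.elims)

lemma real_triple_add: "real_triple (add3 a b) = real_triple a + real_triple b"
  by (cases a, cases b) simp

definition unit_cube :: "(real \<times> real \<times> real) set" where "unit_cube = {0..<1} \<times> {0..<1} \<times> {0..<1}"

lemma borel_unit_cube: "unit_cube \<in> sets borel"
  unfolding unit_cube_def by (intro borel_Times) auto

lemma emeasure_unit_cube: "emeasure lborel unit_cube = 1"
proof -
  have "emeasure lborel unit_cube = emeasure (lborel \<Otimes>\<^sub>M (lborel \<Otimes>\<^sub>M lborel)) ({0..<1::real} \<times> {0..<1::real} \<times> {0..<1::real})"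
    unfolding unit_cube_def by (simp add: lborel_prod)
  also have "\<dots> = emeasure lborel {0..<1::real} * (emeasure lborel {0..<1::real} * emeasure lborel {0..<1::real})"
    by (subst lborel_pair.emeasure_pair_measure_Times, simp, simp add: lborel_prod borel_Times,
        subst lborel.emeasure_pair_measure_Times) (auto simp: lborel_prod)
  finally show ?thesis by simp
qed

lemma unit_cube_translates_disjoint: "disjoint_family_on (\<lambda>w. (+) w ` unit_cube) (real_triple ` S)"
  unfolding disjoint_family_on_def
proof (intro ballI impI)
  have int: "i = j" if "real_of_int i + s = real_of_int j + t" "s \<in> {0..<1}" "t \<in> {0..<1}" for i j s t
  proof -
    have "\<bar>real_of_int (i - j)\<bar> < 1" using that by auto
    then show ?thesis by linarith
  qed
  fix v w assume vw: "v \<in> real_triple ` S" "w \<in> real_triple ` S" "v \<noteq> w"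
  show "(+) v ` unit_cube \<inter> (+) w ` unit_cube = {}"
  proof (rule ccontr)
    assume "\<not> ?thesis"
    then obtain x y where xy: "x \<in> unit_cube" "y \<in> unit_cube" "v + x = w + y" by blast
    obtain i1 i2 i3 j1 j2 j3 where v: "v = (of_int i1, of_int i2, of_int i3)" and w: "w = (of_int j1, of_int j2, of_int j3)"
      using vw(1,2) by (auto elim!: real_triple.elims)
    obtain x1 x2 x3 where x: "x = (x1, x2, x3)" by (cases x)
    obtain y1 y2 y3 where y: "y = (y1, y2, y3)" by (cases y)
    have "i1 = j1" "i2 = j2" "i3 = j3"
      using xy int[of i1 x1 j1 y1] int[of i2 x2 j2 y2] int[of i3 x3 j3 y3] by (auto simp: v w x y unit_cube_def)
    then show False using vw(3) v w by simp
  qed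
qed

text \<open>Reducing the coordinates of \<open>x\<close> with respect to three independent lattice points of the box
  modulo 1 moves \<open>x\<close> into three times the box; adding any further point of the box stays in four
  times the box.\<close>

lemma card_spanning_box_le:
  fixes A :: "triple set"
  assumes fin: "finite A" and b: "0 \<le> b1" "0 \<le> b2" "0 \<le> b3"
    and A: "\<And>a. a \<in> A \<Longrightarrow> real_triple a \<in> skew_box s \<alpha> \<beta> b1 b2 b3"
    and span: "{a, b, c} \<subseteq> A" "dot a (cross b c) \<noteq> 0"
  shows "real (card A) \<le> 512 * (b1 * b2 * b3)"
proof -
  let ?K = "skew_box s \<alpha> \<beta> (4 * b1) (4 * b2) (4 * b3)"
  have red: "\<exists>w. \<forall>v\<in>A. real_triple (add3 v w) + x \<in> ?K" for x
  proof -
    obtain x1 x2 x3 where x: "x = (x1, x2, x3)" by (cases x)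
    obtain a1 a2 a3 where a: "a = (a1, a2, a3)" by (cases a)
    obtain d1 d2 d3 where bb: "b = (d1, d2, d3)" by (cases b)
    obtain e1 e2 e3 where c: "c = (e1, e2, e3)" by (cases c)
    define det where "det = real_of_int (dot a (cross b c))"
    have det: "det \<noteq> 0" using span(2) by (simp add: det_def)
    have det_eq: "det = real_of_int a1 * (d2 * e3 - d3 * e2) + real_of_int a2 * (d3 * e1 - d1 * e3) + real_of_int a3 * (d1 * e2 - d2 * e1)"
      by (simp add: det_def a bb c)
    \<comment> \<open>Cramer's rule: \<open>k1\<close>, \<open>k2\<close>, \<open>k3\<close> are the
      coordinates of \<open>x\<close> in the basis \<open>a\<close>, \<open>b\<close>,
      \<open>c\<close>.\<close>
    define k1 where "k1 = (x1 * (d2 * e3 - d3 * e2) + x2 * (d3 * e1 - d1 * e3) + x3 * (d1 * e2 - d2 * e1)) / det"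
    define k2 where "k2 = (x1 * (e2 * a3 - e3 * a2) + x2 * (e3 * a1 - e1 * a3) + x3 * (e1 * a2 - e2 * a1)) / det"
    define k3 where "k3 = (x1 * (a2 * d3 - a3 * d2) + x2 * (a3 * d1 - a1 * d3) + x3 * (a1 * d2 - a2 * d1)) / det"
    have kd: "k1 * det = x1 * (d2 * e3 - d3 * e2) + x2 * (d3 * e1 - d1 * e3) + x3 * (d1 * e2 - d2 * e1)"
      "k2 * det = x1 * (e2 * a3 - e3 * a2) + x2 * (e3 * a1 - e1 * a3) + x3 * (e1 * a2 - e2 * a1)"
      "k3 * det = x1 * (a2 * d3 - a3 * d2) + x2 * (a3 * d1 - a1 * d3) + x3 * (a1 * d2 - a2 * d1)"
      using det by (simp_all add: k1_def k2_def k3_def)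
    note kd' = kd[unfolded of_int_diff of_int_mult] and det_eq' = det_eq[unfolded of_int_diff of_int_mult]
    have "(k1 * a1 + k2 * d1 + k3 * e1) * det = (k1 * det) * a1 + (k2 * det) * d1 + (k3 * det) * e1"
      by (simp add: algebra_simps)
    also have "\<dots> = x1 * det" by (subst kd'(1), subst kd'(2), subst kd'(3), subst det_eq', algebra)
    finally have xk1: "(k1 * a1 + k2 * d1 + k3 * e1) * det = x1 * det" .
    have "(k1 * a2 + k2 * d2 + k3 * e2) * det = (k1 * det) * a2 + (k2 * det) * d2 + (k3 * det) * e2"
      by (simp add: algebra_simps)
    also have "\<dots> = x2 * det" by (subst kd'(1), subst kd'(2), subst kd'(3), subst det_eq', algebra)
    finally have xk2: "(k1 * a2 + k2 * d2 + k3 * e2) * det = x2 * det" .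
    have "(k1 * a3 + k2 * d3 + k3 * e3) * det = (k1 * det) * a3 + (k2 * det) * d3 + (k3 * det) * e3"
      by (simp add: algebra_simps)
    also have "\<dots> = x3 * det" by (subst kd'(1), subst kd'(2), subst kd'(3), subst det_eq', algebra)
    finally have xk3: "(k1 * a3 + k2 * d3 + k3 * e3) * det = x3 * det" .
    have xk: "x1 = k1 * a1 + k2 * d1 + k3 * e1" "x2 = k1 * a2 + k2 * d2 + k3 * e2" "x3 = k1 * a3 + k2 * d3 + k3 * e3"
      using det xk1 xk2 xk3 by simp_all
    define n1 n2 n3 where n: "n1 = \<lfloor>k1\<rfloor>" "n2 = \<lfloor>k2\<rfloor>" "n3 = \<lfloor>k3\<rfloor>"
    define f1 f2 f3 where f: "f1 = k1 - n1" "f2 = k2 - n2" "f3 = k3 - n3"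
    have f01: "0 \<le> f1" "f1 \<le> 1" "0 \<le> f2" "f2 \<le> 1" "0 \<le> f3" "f3 \<le> 1"
      unfolding f n by linarith+
    \<comment> \<open>Adding \<open>w\<close> removes the integer parts of the coordinates; the
      fractional parts \<open>f1\<close>, \<open>f2\<close>, \<open>f3\<close> remain, and
      \<open>w\<close> does not depend on the point \<open>v\<close> added later.\<close>
    define w where "w = (- n1 * a1 - n2 * d1 - n3 * e1, - n1 * a2 - n2 * d2 - n3 * e2, - n1 * a3 - n2 * d3 - n3 * e3)"
    have lin: "\<bar>p + f1 * p1 + f2 * p2 + f3 * p3\<bar> \<le> 4 * t"
      if "\<bar>p\<bar> \<le> t" "\<bar>p1\<bar> \<le> t" "\<bar>p2\<bar> \<le> t" "\<bar>p3\<bar> \<le> t" for p p1 p2 p3 t :: real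
    proof -
      have "\<bar>g * r\<bar> \<le> t" if "0 \<le> g" "g \<le> 1" "\<bar>r\<bar> \<le> t" for g r :: real
      proof -
        have "\<bar>g * r\<bar> \<le> 1 * \<bar>r\<bar>" unfolding abs_mult using that by (intro mult_right_mono) auto
        then show ?thesis using that by simp
      qed
      then have "\<bar>f1 * p1\<bar> \<le> t" "\<bar>f2 * p2\<bar> \<le> t" "\<bar>f3 * p3\<bar> \<le> t" using f01 that by blast+
      then show ?thesis using that(1) by linarith
    qed
    have "real_triple (add3 v w) + x \<in> ?K" if v: "v \<in> A" for v
    proof -
      obtain v1 v2 v3 where vv: "v = (v1, v2, v3)" by (cases v)
      have mem: "real_triple v \<in> skew_box s \<alpha> \<beta> b1 b2 b3" "real_triple a \<in> skew_box s \<alpha> \<beta> b1 b2 b3"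
        "real_triple b \<in> skew_box s \<alpha> \<beta> b1 b2 b3" "real_triple c \<in> skew_box s \<alpha> \<beta> b1 b2 b3"
        using A v span(1) by auto
      have z: "real_triple (add3 v w) + x =
         (v1 + f1 * a1 + f2 * d1 + f3 * e1, v2 + f1 * a2 + f2 * d2 + f3 * e2, v3 + f1 * a3 + f2 * d3 + f3 * e3)"
        unfolding x xk by (simp add: vv w_def f algebra_simps)
      have "\<bar>v1 + f1 * a1 + f2 * d1 + f3 * e1\<bar> \<le> 4 * b1"
        using mem by (intro lin) (auto simp: skew_box_def vv a bb c)
      moreover have "\<bar>(s * v1 - v2) + f1 * (s * a1 - a2) + f2 * (s * d1 - d2) + f3 * (s * e1 - e2)\<bar> \<le> 4 * b2"
        using mem by (intro lin) (auto simp: skew_box_def vv a bb c)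
      moreover have "\<bar>(\<alpha> * v1 + \<beta> * v2 - v3) + f1 * (\<alpha> * a1 + \<beta> * a2 - a3) + f2 * (\<alpha> * d1 + \<beta> * d2 - d3) + f3 * (\<alpha> * e1 + \<beta> * e2 - e3)\<bar> \<le> 4 * b3"
        using mem by (intro lin) (auto simp: skew_box_def vv a bb c)
      ultimately show ?thesis unfolding z skew_box_def by (simp add: algebra_simps)
    qed
    then show ?thesis by blast
  qed
  define W where "W = real_triple ` {w. \<exists>x\<in>unit_cube. real_triple w + x \<in> ?K}"
  have finW: "finite {w. \<exists>x\<in>unit_cube. real_triple w + x \<in> ?K}"
  proof (rule finite_bounded_triples)
    fix i j k assume "(i, j, k) \<in> {w. \<exists>x\<in>unit_cube. real_triple w + x \<in> ?K}"
    then obtain p where p: "p \<in> unit_cube" "real_triple (i, j, k) + p \<in> ?K" by blast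
    obtain x1 x2 x3 where pp: "p = (x1, x2, x3)" by (cases p)
    have x: "\<bar>x1\<bar> \<le> 1" "\<bar>x2\<bar> \<le> 1" "\<bar>x3\<bar> \<le> 1"
      and K: "\<bar>i + x1\<bar> \<le> 4 * b1" "\<bar>s * (i + x1) - (j + x2)\<bar> \<le> 4 * b2" "\<bar>\<alpha> * (i + x1) + \<beta> * (j + x2) - (k + x3)\<bar> \<le> 4 * b3"
      using p by (auto simp: pp unit_cube_def skew_box_def)
    define B1 where "B1 = 4 * b1"
    define B2 where "B2 = 4 * b2 + \<bar>s\<bar> * B1"
    define B3 where "B3 = 4 * b3 + \<bar>\<alpha>\<bar> * B1 + \<bar>\<beta>\<bar> * B2"
    have k1: "\<bar>i + x1\<bar> \<le> B1" using K by (simp add: B1_def)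
    have "\<bar>s * (i + x1)\<bar> \<le> \<bar>s\<bar> * B1" unfolding abs_mult using k1 by (intro mult_left_mono) auto
    then have k2: "\<bar>j + x2\<bar> \<le> B2" using K(2) unfolding B2_def by linarith
    have "\<bar>\<alpha> * (i + x1)\<bar> \<le> \<bar>\<alpha>\<bar> * B1" "\<bar>\<beta> * (j + x2)\<bar> \<le> \<bar>\<beta>\<bar> * B2"
      unfolding abs_mult using k1 k2 by (auto intro: mult_left_mono)
    then have k3: "\<bar>k + x3\<bar> \<le> B3" using K(3) unfolding B3_def by linarith
    have "0 \<le> B1" "0 \<le> B2" "0 \<le> B3" using k1 k2 k3 by linarith+
    then show "\<bar>real_of_int i\<bar> \<le> 1 + B1 + B2 + B3 \<and> \<bar>real_of_int j\<bar> \<le> 1 + B1 + B2 + B3 \<and> \<bar>real_of_int k\<bar> \<le> 1 + B1 + B2 + B3"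
      using x k1 k2 k3 by linarith
  qed
  have "of_nat (card A) \<le> emeasure lborel ?K"
  proof (rule emeasure_ge_translates[where C = unit_cube and W = W])
    show "?K \<in> sets borel" using closed_skew_box by (rule borel_closed)
    show "finite W" using finW by (simp add: W_def)
    show "disjoint_family_on (\<lambda>w. (+) w ` unit_cube) W" unfolding W_def by (rule unit_cube_translates_disjoint)
    fix x assume x: "x \<in> unit_cube"
    obtain w where w: "\<And>v. v \<in> A \<Longrightarrow> real_triple (add3 v w) + x \<in> ?K" using red by blast
    have "card A = card ((\<lambda>v. real_triple (add3 v w)) ` A)"
    proof (rule card_image[symmetric], rule inj_onI)
      fix p q assume "real_triple (add3 p w) = real_triple (add3 q w)"
      then have "real_triple p = real_triple q" by (simp add: real_triple_add)
      then show "p = q" using injD[OF inj_real_triple] by blast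
    qed
    also have "\<dots> \<le> card {w \<in> W. w + x \<in> ?K}"
    proof (rule card_mono)
      show "finite {w \<in> W. w + x \<in> ?K}" using \<open>finite W\<close> by simp
      show "(\<lambda>v. real_triple (add3 v w)) ` A \<subseteq> {w \<in> W. w + x \<in> ?K}"
        unfolding W_def using w x by blast
    qed
    finally show "card A \<le> card {w \<in> W. w + x \<in> ?K}" .
  qed (rule borel_unit_cube emeasure_unit_cube)+
  \<comment> \<open>The factor 512 of the statement is 8 * 4^3.\<close>
  also have "\<dots> = ennreal (8 * (4 * b1) * (4 * b2) * (4 * b3))" by (rule emeasure_skew_box) (use b in auto)
  finally have "ennreal (real (card A)) \<le> ennreal (8 * (4 * b1) * (4 * b2) * (4 * b3))" by (simp add: ennreal_of_nat_eq_real_of_nat)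
  then show ?thesis using b by (subst (asm) ennreal_le_iff) (auto simp: mult_ac)
qed

text \<open>If two members are not parallel, their cross product is a normal by the determinant
  condition; otherwise all members lie on one line, and any vector orthogonal to it will do.\<close>

lemma common_normal:
  assumes "\<And>a b c. \<lbrakk>a \<in> A; b \<in> A; c \<in> A\<rbrakk> \<Longrightarrow> dot a (cross b c) = 0"
  shows "\<exists>m. m \<noteq> (0,0,0) \<and> (\<forall>a\<in>A. dot a m = 0)"
proof (cases "\<exists>b\<in>A. \<exists>c\<in>A. cross b c \<noteq> (0,0,0)")
  case True
  then show ?thesis using assms by blast
next
  case par: False
  show ?thesis
  proof (cases "A \<subseteq> {(0,0,0)}")
    case True
    then show ?thesis by (intro exI[of _ "(1,0,0)"]) auto
  next
    case False
    then obtain b where b: "b \<in> A" "b \<noteq> (0,0,0)" by blast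
    obtain b1 b2 b3 where bb: "b = (b1, b2, b3)" by (cases b)
    have cr: "b2 * a3 = b3 * a2 \<and> b3 * a1 = b1 * a3 \<and> b1 * a2 = b2 * a1" if "(a1, a2, a3) \<in> A" for a1 a2 a3
      using par b(1) that bb by fastforce
    show ?thesis
    proof (cases "b1 = 0 \<and> b2 = 0")
      case True
      then have "b3 \<noteq> 0" using b bb by simp
      have "dot a (1,0,0) = 0" if "a \<in> A" for a
      proof -
        obtain a1 a2 a3 where a: "a = (a1, a2, a3)" by (cases a)
        show ?thesis using cr[of a1 a2 a3] that a True \<open>b3 \<noteq> 0\<close> by auto
      qed
      then show ?thesis by (intro exI[of _ "(1,0,0)"]) auto
    next
      case False
      have "dot a (b2, -b1, 0) = 0" if "a \<in> A" for a
      proof -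
        obtain a1 a2 a3 where a: "a = (a1, a2, a3)" by (cases a)
        show ?thesis using cr[of a1 a2 a3] that a by (simp add: mult.commute)
      qed
      then show ?thesis using False by (intro exI[of _ "(b2, -b1, 0)"]) auto
    qed
  qed
qed

text \<open>Pigeonhole in the plane: a cell of side e/2 contains at most one point, and along each
  axis at most 4 T/e + 3 \<le> 7 T/e cells occur.\<close>

lemma card_cells_le:
  fixes g h :: "'a \<Rightarrow> real"
  assumes fin: "finite A" and e: "0 < e" "e \<le> T"
    and bd: "\<And>a. a \<in> A \<Longrightarrow> \<bar>g a\<bar> \<le> T" "\<And>a. a \<in> A \<Longrightarrow> \<bar>h a\<bar> \<le> T"
    and sep: "\<And>a b. \<lbrakk>a \<in> A; b \<in> A; \<bar>g a - g b\<bar> < e/2; \<bar>h a - h b\<bar> < e/2\<rbrakk> \<Longrightarrow> a = b"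
  shows "real (card A) \<le> 49 * (T / e)\<^sup>2"
proof -
  define \<phi> where "\<phi> a = (\<lfloor>2 * g a / e\<rfloor>, \<lfloor>2 * h a / e\<rfloor>)" for a
  define I where "I = {-\<lceil>2 * T / e\<rceil>..\<lceil>2 * T / e\<rceil>}"
  have cell: "\<bar>s - t\<bar> < e/2" if "\<lfloor>2 * s / e\<rfloor> = \<lfloor>2 * t / e\<rfloor>" for s t
  proof -
    have "\<bar>2 * s / e - 2 * t / e\<bar> < 1" using that by linarith
    then have "2 * s / e < 2 * t / e + 1" "2 * t / e < 2 * s / e + 1" by linarith+
    then have "2 * s < 2 * t + e" "2 * t < 2 * s + e" using e by (simp_all add: field_simps)
    then show ?thesis by linarith
  qed
  have rng: "\<lfloor>2 * s / e\<rfloor> \<in> I" if "\<bar>s\<bar> \<le> T" for s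
  proof -
    have "2 * s / e \<le> 2 * T / e" "- (2 * T / e) \<le> 2 * s / e"
      using that e by (auto simp: field_simps)
    then show ?thesis unfolding I_def by (simp; linarith)
  qed
  have "inj_on \<phi> A"
    by (intro inj_onI sep cell) (auto simp: \<phi>_def)
  then have "card A = card (\<phi> ` A)" by (simp add: card_image)
  also have "\<dots> \<le> card (I \<times> I)"
    by (rule card_mono) (use rng bd in \<open>auto simp: \<phi>_def I_def\<close>)
  finally have "real (card A) \<le> (real (card I))\<^sup>2" by (simp add: card_cartesian_product power2_eq_square flip: of_nat_mult)
  also have "\<dots> \<le> (7 * (T / e))\<^sup>2"
  proof (rule power_mono)
    have Te: "1 \<le> T / e" using e by simp
    have "0 \<le> 2 * T / e" using e by simp
    then have "0 \<le> \<lceil>2 * T / e\<rceil>" by linarith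
    then have "real (card I) = 2 * of_int \<lceil>2 * T / e\<rceil> + 1" unfolding I_def by simp
    also have "\<dots> \<le> 2 * (2 * T / e + 1) + 1" 
      by (intro add_mono mult_left_mono of_int_ceiling_le_add_one) auto
    also have "\<dots> \<le> 7 * (T / e)" using Te by simp
    finally show "real (card I) \<le> 7 * (T / e)" .
  qed simp
  finally show ?thesis unfolding power_mult_distrib by simp
qed

text \<open>The plane is projected along the axis on which its normal has the largest coefficient.
  Two coordinate differences below e/2 then force the third below \<open>e\<close>, so the projected
  points are separated.\<close>

lemma card_planar_le:
  fixes g :: "'a \<Rightarrow> real"
  assumes fin: "finite A" and e: "0 < e" "e \<le> T"
    and bd: "\<And>a. a \<in> A \<Longrightarrow> \<bar>g a\<bar> \<le> T \<and> \<bar>h a\<bar> \<le> T \<and> \<bar>k a\<bar> \<le> T"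
    and sep: "\<And>a b. \<lbrakk>a \<in> A; b \<in> A; \<bar>g a - g b\<bar> \<le> e; \<bar>h a - h b\<bar> \<le> e; \<bar>k a - k b\<bar> \<le> e\<rbrakk> \<Longrightarrow> a = b"
    and n: "(n1, n2, n3) \<noteq> (0, 0, 0)" and plane: "\<And>a. a \<in> A \<Longrightarrow> n1 * g a + n2 * h a + n3 * k a = 0"
  shows "real (card A) \<le> 49 * (T / e)\<^sup>2"
proof -
  have third: "\<bar>r\<bar> < e" if "m1 * p + m2 * q + m3 * r = 0" "\<bar>m1\<bar> \<le> \<bar>m3\<bar>" "\<bar>m2\<bar> \<le> \<bar>m3\<bar>" "m3 \<noteq> 0" "\<bar>p\<bar> < e/2" "\<bar>q\<bar> < e/2"
    for m1 m2 m3 p q r :: real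
  proof -
    have "\<bar>m3\<bar> * \<bar>r\<bar> = \<bar>m1 * p + m2 * q\<bar>" using that(1) by (simp add: abs_mult[symmetric])
    also have "\<dots> \<le> \<bar>m1\<bar> * \<bar>p\<bar> + \<bar>m2\<bar> * \<bar>q\<bar>" by (metis abs_mult abs_triangle_ineq)
    also have "\<dots> \<le> \<bar>m3\<bar> * \<bar>p\<bar> + \<bar>m3\<bar> * \<bar>q\<bar>" using that by (intro add_mono mult_right_mono) auto
    also have "\<dots> = \<bar>m3\<bar> * (\<bar>p\<bar> + \<bar>q\<bar>)" by (simp add: distrib_left)
    also have "\<dots> < \<bar>m3\<bar> * e" using that by (intro mult_strict_left_mono) auto
    finally show ?thesis using that(4) by simp
  qed
  have diff: "n1 * (g a - g b) + n2 * (h a - h b) + n3 * (k a - k b) = 0" if "a \<in> A" "b \<in> A" for a b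
    using plane[OF that(1)] plane[OF that(2)] by (simp add: algebra_simps)
  consider "\<bar>n1\<bar> \<le> \<bar>n3\<bar>" "\<bar>n2\<bar> \<le> \<bar>n3\<bar>" | "\<bar>n1\<bar> \<le> \<bar>n2\<bar>" "\<bar>n3\<bar> \<le> \<bar>n2\<bar>" | "\<bar>n2\<bar> \<le> \<bar>n1\<bar>" "\<bar>n3\<bar> \<le> \<bar>n1\<bar>"
    by linarith
  then show ?thesis
  proof cases
    case 1
    then have nz: "n3 \<noteq> 0" using n by auto
    show ?thesis
    proof (rule card_cells_le[OF fin e, of g h])
      fix a b assume ab: "a \<in> A" "b \<in> A" "\<bar>g a - g b\<bar> < e/2" "\<bar>h a - h b\<bar> < e/2"
      have "\<bar>k a - k b\<bar> < e" by (rule third[OF diff[OF ab(1,2)] 1 nz ab(3,4)])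
      then show "a = b" using ab e by (intro sep) auto
    qed (use bd in auto)
  next
    case 2
    then have nz: "n2 \<noteq> 0" using n by auto
    show ?thesis
    proof (rule card_cells_le[OF fin e, of g k])
      fix a b assume ab: "a \<in> A" "b \<in> A" "\<bar>g a - g b\<bar> < e/2" "\<bar>k a - k b\<bar> < e/2"
      have "n1 * (g a - g b) + n3 * (k a - k b) + n2 * (h a - h b) = 0" using diff[OF ab(1,2)] by linarith
      then have "\<bar>h a - h b\<bar> < e" by (rule third[OF _ 2 nz ab(3,4)])
      then show "a = b" using ab e by (intro sep) auto
    qed (use bd in auto)
  next
    case 3
    then have nz: "n1 \<noteq> 0" using n by auto
    show ?thesis
    proof (rule card_cells_le[OF fin e, of h k])
      fix a b assume ab: "a \<in> A" "b \<in> A" "\<bar>h a - h b\<bar> < e/2" "\<bar>k a - k b\<bar> < e/2"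
      have "n2 * (h a - h b) + n3 * (k a - k b) + n1 * (g a - g b) = 0" using diff[OF ab(1,2)] by linarith
      then have "\<bar>g a - g b\<bar> < e" by (rule third[OF _ 3 nz ab(3,4)])
      then show "a = b" using ab e by (intro sep) auto
    qed (use bd in auto)
  qed
qed

context curved
begin

lemma y_diff:
  "y1 (add3 a (scale (-1) b)) x = y1 a x - y1 b x"
  "y2 (add3 a (scale (-1) b)) x = y2 a x - y2 b x"
  "y3 (add3 a (scale (-1) b)) x = y3 a x - y3 b x"
proof -
  obtain a1 a2 a3 b1 b2 b3 where ab: "a = (a1, a2, a3)" "b = (b1, b2, b3)" by (cases a, cases b)
  note simps = ab y1.simps y2.simps y3.simps add3.simps scale.simps of_int_add of_int_mult of_int_minus of_int_1
  show "y1 (add3 a (scale (-1) b)) x = y1 a x - y1 b x" unfolding simps by algebra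
  show "y2 (add3 a (scale (-1) b)) x = y2 a x - y2 b x" unfolding simps by algebra
  show "y3 (add3 a (scale (-1) b)) x = y3 a x - y3 b x" unfolding simps by algebra
qed

lemma z_eq_0: "z1 m x = 0 \<Longrightarrow> z2 m x = 0 \<Longrightarrow> z3 m x = 0 \<Longrightarrow> m = (0,0,0)"
  by (cases m) auto

text \<open>If the points span, a volume comparison applies; if they lie in a plane, the absence of short vectors
  makes a two-dimensional pigeonhole argument sufficient.\<close>

lemma box_count:
  assumes fin: "finite A" and b: "0 < b1" "0 < b2" "0 < b3" and T: "0 < T" "T ^ 3 = b1 * b2 * b3"
    and e: "0 < e" "e \<le> T"
    and A: "\<And>a. a \<in> A \<Longrightarrow> \<bar>y1 a x\<bar> \<le> b1 \<and> \<bar>y2 a x\<bar> \<le> b2 \<and> \<bar>y3 a x\<bar> \<le> b3"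
    and no: "\<And>a. \<lbrakk>\<bar>y1 a x\<bar> \<le> e * (b1 / T); \<bar>y2 a x\<bar> \<le> e * (b2 / T); \<bar>y3 a x\<bar> \<le> e * (b3 / T)\<rbrakk> \<Longrightarrow> a = (0,0,0)"
  shows "real (card A) \<le> 512 * T ^ 3 + 49 * (T / e)\<^sup>2"
proof (cases "\<exists>a\<in>A. \<exists>b\<in>A. \<exists>c\<in>A. dot a (cross b c) \<noteq> 0")
  case True
  then obtain a b c where abc: "{a, b, c} \<subseteq> A" "dot a (cross b c) \<noteq> 0" by blast
  have "real (card A) \<le> 512 * (b1 * b2 * b3)"
  proof (rule card_spanning_box_le[OF fin _ _ _ _ abc])
    fix w assume w: "w \<in> A"
    obtain q p1 p2 where wq: "w = (q, p1, p2)" by (cases w)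
    have "y3 w x = (f x - D x * x) * q + D x * p1 - p2" by (simp add: wq algebra_simps)
    moreover have "y1 w x = q" "y2 w x = x * q - p1" by (simp_all add: wq mult.commute)
    ultimately have "\<bar>real_of_int q\<bar> \<le> b1 \<and> \<bar>x * q - p1\<bar> \<le> b2 \<and> \<bar>(f x - D x * x) * q + D x * p1 - p2\<bar> \<le> b3"
      using A[OF w] by (simp only:)
    then show "real_triple w \<in> skew_box x (f x - D x * x) (D x) b1 b2 b3"
      by (simp only: skew_box_def wq real_triple.simps mem_Collect_eq case_prod_conv)
  qed (use b in auto)
  moreover have "0 \<le> 49 * (T / e)\<^sup>2" by simp
  ultimately show ?thesis using T by linarith
next
  case False
  then obtain m where m: "m \<noteq> (0,0,0)" "\<And>a. a \<in> A \<Longrightarrow> dot a m = 0"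
    using common_normal[of A] by blast
  have sc: "\<bar>t * (T / b)\<bar> \<le> T * s / b \<longleftrightarrow> \<bar>t\<bar> \<le> s" if "0 < b" for t b s
    using that T by (simp add: abs_mult field_simps)
  \<comment> \<open>Multiplying the coordinates by T / b1, T / b2, T / b3 turns the box into a cube
    with bound \<open>T\<close> and the absence of short vectors into separation by
    \<open>e\<close>; the coefficients of the normal are rescaled inversely.\<close>
  have "real (card A) \<le> 49 * (T / e)\<^sup>2"
  proof (rule card_planar_le[OF fin e])
    fix a assume "a \<in> A"
    then show "\<bar>y1 a x * (T / b1)\<bar> \<le> T \<and> \<bar>y2 a x * (T / b2)\<bar> \<le> T \<and> \<bar>y3 a x * (T / b3)\<bar> \<le> T"
      using A sc[OF b(1), of "y1 a x" b1] sc[OF b(2), of "y2 a x" b2] sc[OF b(3), of "y3 a x" b3] b by simp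
    have "(z1 m x * b1) * (y1 a x * (T / b1)) + (- (z2 m x * b2)) * (y2 a x * (T / b2)) + (- (z3 m x * b3)) * (y3 a x * (T / b3))
      = T * (y1 a x * z1 m x - y2 a x * z2 m x - y3 a x * z3 m x)"
      using b by (simp add: field_simps)
    also have "\<dots> = T * of_int (dot a m)" by (simp only: y_z_dot[of a m x])
    also have "\<dots> = 0" using m(2)[OF \<open>a \<in> A\<close>] by simp
    finally show "(z1 m x * b1) * (y1 a x * (T / b1)) + (- (z2 m x * b2)) * (y2 a x * (T / b2)) + (- (z3 m x * b3)) * (y3 a x * (T / b3)) = 0" .
  next
    show "(z1 m x * b1, - (z2 m x * b2), - (z3 m x * b3)) \<noteq> (0, 0, 0)"
      using z_eq_0[of m x] m(1) b by auto
  next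
    fix a a' assume h: "a \<in> A" "a' \<in> A" "\<bar>y1 a x * (T / b1) - y1 a' x * (T / b1)\<bar> \<le> e"
      "\<bar>y2 a x * (T / b2) - y2 a' x * (T / b2)\<bar> \<le> e" "\<bar>y3 a x * (T / b3) - y3 a' x * (T / b3)\<bar> \<le> e"
    have d: "\<bar>s - t\<bar> \<le> e * (b / T)" if "\<bar>s * (T / b) - t * (T / b)\<bar> \<le> e" "0 < b" for s t b
    proof -
      have "\<bar>s - t\<bar> * (T / b) \<le> e" using that T by (simp add: abs_mult left_diff_distrib[symmetric] del: times_divide_eq_right)
      then show ?thesis using that T by (simp add: field_simps)
    qed
    have "add3 a (scale (-1) a') = (0,0,0)"
      by (rule no) (use d[OF h(3) b(1)] d[OF h(4) b(2)] d[OF h(5) b(3)] in \<open>simp_all only: y_diff\<close>)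
    then show "a = a'" by (cases a, cases a') simp
  qed
  moreover have "0 \<le> 512 * T ^ 3" using T(1) by simp
  ultimately show ?thesis by linarith
qed

lemma finite_box: "finite {a. \<bar>y1 a x\<bar> \<le> b1 \<and> \<bar>y2 a x\<bar> \<le> b2 \<and> \<bar>y3 a x\<bar> \<le> b3}"
proof (rule finite_bounded_triples)
  fix q p1 p2 assume "(q, p1, p2) \<in> {a. \<bar>y1 a x\<bar> \<le> b1 \<and> \<bar>y2 a x\<bar> \<le> b2 \<and> \<bar>y3 a x\<bar> \<le> b3}"
  then have q: "\<bar>real_of_int q\<bar> \<le> b1" and 2: "\<bar>q * x - p1\<bar> \<le> b2" and 3: "\<bar>q * f x - p2 - D x * (q * x - p1)\<bar> \<le> b3" by auto
  have 1: "\<bar>q * x\<bar> \<le> b1 * \<bar>x\<bar>" "\<bar>q * f x\<bar> \<le> b1 * \<bar>f x\<bar>" unfolding abs_mult using q by (auto intro: mult_right_mono)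
  have 4: "\<bar>D x * (q * x - p1)\<bar> \<le> \<bar>D x\<bar> * b2" unfolding abs_mult using 2 by (intro mult_left_mono) auto
  have p1: "\<bar>real_of_int p1\<bar> \<le> b1 * \<bar>x\<bar> + b2" using 1 2 by linarith
  have p2: "\<bar>real_of_int p2\<bar> \<le> b1 * \<bar>f x\<bar> + b3 + \<bar>D x\<bar> * b2" using 1 3 4 by linarith
  define K where "K = max b1 (max (b1 * \<bar>x\<bar> + b2) (b1 * \<bar>f x\<bar> + b3 + \<bar>D x\<bar> * b2))"
  show "\<bar>real_of_int q\<bar> \<le> K \<and> \<bar>real_of_int p1\<bar> \<le> K \<and> \<bar>real_of_int p2\<bar> \<le> K"
    unfolding K_def le_max_iff_disj using q p1 p2 by blast
qed

subsection \<open>Convergence\<close>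

text \<open>Collects the three contributions to the third coordinate in \<open>level_cover\<close>:
  the approximation itself (1), the Taylor error across a piece (c2), and the slope times the error
  in the first approximation (Db).\<close>

definition "K0 = 1 + c2 + Db"

lemma K0_pos: "1 \<le> K0" using c2 Db_nonneg by (simp add: K0_def)

text \<open>The box has volume \<open>T ^ 3\<close>, and \<open>1 / sqrt T\<close> is the threshold for short vectors at which the planar
  count is still of order \<open>T ^ 3\<close>.\<close>

lemma level_cover:
  assumes Q: "1 \<le> Q" and r: "0 < r" "r \<le> v - u" and \<delta>: "0 < \<delta>" "\<delta> \<le> Q * r" "Q * r\<^sup>2 \<le> \<delta>"
    and T: "16 < T" "T ^ 3 = 6 * K0 * Q\<^sup>2 * r * \<delta>"
    and large: "1 \<le> 4 * (2 * Q / T)" "1 \<le> 2 * (2 * Q / T) * (v - u)" "4 \<le> 2 * Q / T * c1 * (v - u)\<^sup>2"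
    and small: "3 * Q * r / T \<le> 2 * (v - u)" "3 * Q * r / T \<le> 4" "K0 * \<delta> / T \<le> 4"
  shows "\<exists>X\<in>lmeasurable. {x \<in> {u..v}. \<exists>q::nat. Q \<le> q \<and> q < 2 * Q \<and>
        dist_nearest_int (q * x) < \<delta> \<and> dist_nearest_int (q * f x) < \<delta>} \<subseteq> X \<and>
      measure lebesgue X \<le> 6 * sqrt (4 * Cgood * (1 / sqrt T)) * (v - u) + 13464 * K0 * (v - u) * (Q * \<delta>\<^sup>2)"
proof -
  define e where "e = 1 / sqrt T"
  have T0: "0 < T" using T by simp
  have "4 < sqrt T" using T by (intro real_less_rsqrt) auto
  then have "1 / sqrt T < 1 / 4" using T0 by (intro divide_strict_left_mono) auto
  then have e: "0 < e" "e < 1/4" using T0 by (simp_all add: e_def)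
  have Te: "(T / e)\<^sup>2 = T ^ 3" using T0 by (simp add: e_def power_mult_distrib power2_eq_square power3_eq_cube)
  have eT: "e \<le> T" using e T by linarith
  \<comment> \<open>Box at a reference point within distance \<open>r\<close>: on the way there q x
    - p1 changes by at most 2 Q r, and the initial error \<delta> \<le> Q r adds a third Q
    r.\<close>
  define b1 b2 b3 where b: "b1 = 2 * Q" "b2 = 3 * Q * r" "b3 = K0 * \<delta>"
  have bp: "0 < b1" "0 < b2" "0 < b3" using Q r \<delta> K0_pos by (auto simp: b)
  have T3: "T ^ 3 = b1 * b2 * b3" by (simp add: T(2) b power2_eq_square)
  define Bad where "Bad = {x \<in> {u..v}. \<exists>a. a \<noteq> (0,0,0) \<and> \<bar>y1 a x\<bar> \<le> e * (b1/T) \<and> \<bar>y2 a x\<bar> \<le> e * (b2/T) \<and> \<bar>y3 a x\<bar> \<le> e * (b3/T)}"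
  have prod1: "(b1/T) * (b2/T) * (b3/T) = 1"
    using T3 T0 bp by (simp add: power3_eq_cube)
  have Bad: "compact Bad" "measure lebesgue Bad \<le> 6 * sqrt (4 * Cgood * e) * (v - u)"
    unfolding Bad_def
    by (rule curve_nondivergence[OF order.refl uv order.refl e _ _ _ prod1]; use bp T0 large small in \<open>simp add: b\<close>)+
  define M where "M = Suc (nat \<lfloor>(v - u) / r\<rfloor>)"
  define I where "I j = {u + real j * r..u + (real j + 1) * r} \<inter> {u..v}" for j
  \<comment> \<open>One reference point outside \<open>Bad\<close> serves a whole piece. A piece
    without such a point lies in \<open>Bad\<close>, which is part of the cover, so nothing is
    counted there.\<close>
  define good where "good j \<longleftrightarrow> (\<exists>x. x \<in> I j \<and> x \<notin> Bad)" for j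
  define x0 where "x0 j = (SOME x. x \<in> I j \<and> x \<notin> Bad)" for j
  have x0: "x0 j \<in> I j" "x0 j \<notin> Bad" if "good j" for j
    using someI_ex[of "\<lambda>x. x \<in> I j \<and> x \<notin> Bad"] that unfolding good_def x0_def by blast+
  define S where "S j = (if good j then {a. \<bar>y1 a (x0 j)\<bar> \<le> b1 \<and> \<bar>y2 a (x0 j)\<bar> \<le> b2 \<and> \<bar>y3 a (x0 j)\<bar> \<le> b3} else {})" for j
  define U where "U a = (case a of (q, p1, p2) \<Rightarrow> {real_of_int p1 / real_of_int q - \<delta> / Q..real_of_int p1 / real_of_int q + \<delta> / Q})" for a :: triple
  have finS: "finite (S j)" for j unfolding S_def using finite_box by simp
  \<comment> \<open>561 = 512 + 49: for e = 1 / sqrt T the planar term (T/e)^2 is again T^3.\<close>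
  have cardS: "real (card (S j)) \<le> 561 * T ^ 3" for j
  proof (cases "good j")
    case True
    have x0m: "x0 j \<in> {u..v}" using x0(1)[OF True] by (simp add: I_def)
    have "real (card (S j)) \<le> 512 * T ^ 3 + 49 * (T / e)\<^sup>2"
    proof (rule box_count[OF finS bp T0 T3 e(1) eT])
      fix a assume "a \<in> S j"
      then show "\<bar>y1 a (x0 j)\<bar> \<le> b1 \<and> \<bar>y2 a (x0 j)\<bar> \<le> b2 \<and> \<bar>y3 a (x0 j)\<bar> \<le> b3" using True by (simp add: S_def)
    next
      fix a assume h: "\<bar>y1 a (x0 j)\<bar> \<le> e * (b1/T)" "\<bar>y2 a (x0 j)\<bar> \<le> e * (b2/T)" "\<bar>y3 a (x0 j)\<bar> \<le> e * (b3/T)"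
      show "a = (0,0,0)"
      proof (rule ccontr)
        assume "a \<noteq> (0,0,0)"
        then have "x0 j \<in> Bad" unfolding Bad_def using h x0m by blast
        then show False using x0(2)[OF True] by blast
      qed
    qed
    then show ?thesis unfolding Te by simp
  next
    case False
    then show ?thesis using T0 by (simp add: S_def)
  qed
  define X where "X = Bad \<union> (\<Union>j<M. \<Union>a\<in>S j. U a)"
  have Um: "U a \<in> lmeasurable" "measure lebesgue (U a) = 2 * \<delta> / Q" for a
    using \<delta> Q by (auto simp: U_def split: prod.split)
  have USm: "(\<Union>a\<in>S j. U a) \<in> lmeasurable" for j
    by (rule fmeasurable.finite_UN[OF finS]) (rule Um(1))
  have UMm: "(\<Union>j<M. \<Union>a\<in>S j. U a) \<in> lmeasurable"
    by (rule fmeasurable.finite_UN[OF finite_lessThan]) (rule USm)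
  have Bm: "Bad \<in> lmeasurable" by (rule lmeasurable_compact[OF Bad(1)])
  have US: "measure lebesgue (\<Union>a\<in>S j. U a) \<le> 561 * T ^ 3 * (2 * \<delta> / Q)" for j
  proof -
    have "measure lebesgue (\<Union>a\<in>S j. U a) \<le> (\<Sum>a\<in>S j. measure lebesgue (U a))"
      by (rule measure_UNION_le[OF finS]) (rule fmeasurableD[OF Um(1)])
    also have "\<dots> = real (card (S j)) * (2 * \<delta> / Q)" by (simp add: Um(2))
    also have "\<dots> \<le> 561 * T ^ 3 * (2 * \<delta> / Q)" using cardS[of j] \<delta> Q by (intro mult_right_mono) auto
    finally show ?thesis .
  qed
  have "measure lebesgue (\<Union>j<M. \<Union>a\<in>S j. U a) \<le> (\<Sum>j<M. measure lebesgue (\<Union>a\<in>S j. U a))"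
    by (rule measure_UNION_le[OF finite_lessThan]) (rule fmeasurableD[OF USm])
  also have "\<dots> \<le> (\<Sum>j<M. 561 * T ^ 3 * (2 * \<delta> / Q))" by (intro sum_mono US)
  also have "\<dots> = real M * (561 * T ^ 3 * (2 * \<delta> / Q))" by simp
  also have "\<dots> \<le> (2 * (v - u) / r) * (561 * T ^ 3 * (2 * \<delta> / Q))"
  proof (rule mult_right_mono)
    have one: "1 \<le> (v - u) / r" using r by simp
    then have "real M = of_int \<lfloor>(v - u) / r\<rfloor> + 1" unfolding M_def by simp
    also have "\<dots> \<le> (v - u) / r + 1" by simp
    also have "\<dots> \<le> 2 * ((v - u) / r)" using one by linarith
    also have "\<dots> = 2 * (v - u) / r" by simp
    finally show "real M \<le> 2 * (v - u) / r" .
    show "0 \<le> 561 * T ^ 3 * (2 * \<delta> / Q)" using T0 \<delta> Q by simp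
  qed
  \<comment> \<open>13464 = 2 * 561 * 2 * 6. The length \<open>r\<close> cancels: shorter pieces are
    more numerous, but their boxes are proportionally smaller.\<close>
  also have "\<dots> = 13464 * K0 * (v - u) * (Q * \<delta>\<^sup>2)"
    unfolding T(2) using r Q by (simp add: field_simps power2_eq_square)
  finally have UM: "measure lebesgue (\<Union>j<M. \<Union>a\<in>S j. U a) \<le> 13464 * K0 * (v - u) * (Q * \<delta>\<^sup>2)" .
  have Xm: "X \<in> lmeasurable" unfolding X_def by (rule fmeasurable.Un[OF Bm UMm])
  have "measure lebesgue X \<le> measure lebesgue Bad + measure lebesgue (\<Union>j<M. \<Union>a\<in>S j. U a)"
    unfolding X_def by (rule measure_Un_le[OF fmeasurableD[OF Bm] fmeasurableD[OF UMm]])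
  then have mX: "measure lebesgue X \<le> 6 * sqrt (4 * Cgood * (1 / sqrt T)) * (v - u) + 13464 * K0 * (v - u) * (Q * \<delta>\<^sup>2)"
    using Bad(2) UM unfolding e_def by linarith
  have "x \<in> X" if x: "x \<in> {u..v}" and q: "Q \<le> real q" "real q < 2 * Q" 
    and dn: "dist_nearest_int (q * x) < \<delta>" "dist_nearest_int (q * f x) < \<delta>" for x :: real and q :: nat
  proof (cases "x \<in> Bad")
    case True then show ?thesis by (simp add: X_def)
  next
    case False
    obtain p1 where p1: "\<bar>q * x - of_int p1\<bar> < \<delta>" using dist_nearest_int_attained[of "q * x"] dn by auto
    obtain p2 where p2: "\<bar>q * f x - of_int p2\<bar> < \<delta>" using dist_nearest_int_attained[of "q * f x"] dn by auto
    define j where "j = nat \<lfloor>(x - u) / r\<rfloor>"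
    have fl: "real j \<le> (x - u) / r" "(x - u) / r < real j + 1" 
    proof -
      have "0 \<le> \<lfloor>(x - u) / r\<rfloor>" using x r by simp
      then have "real j = of_int \<lfloor>(x - u) / r\<rfloor>" by (simp add: j_def)
      then show "real j \<le> (x - u) / r" "(x - u) / r < real j + 1" by linarith+
    qed
    have "(x - u) / r \<le> (v - u) / r" using x r by (intro divide_right_mono) auto
    then have jM: "j < M" unfolding j_def M_def by (simp add: floor_mono nat_mono le_imp_less_Suc)
    have xI: "x \<in> I j" using fl r x by (simp add: I_def field_simps)
    then have gj: "good j" using False by (auto simp: good_def)
    note x0' = x0[OF gj]
    have x0m: "x0 j \<in> {u..v}" using x0'(1) by (simp add: I_def)
    have dx: "\<bar>x - x0 j\<bar> \<le> r"
    proof -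
      have "u + real j * r \<le> x" "x \<le> u + (real j + 1) * r" "u + real j * r \<le> x0 j" "x0 j \<le> u + (real j + 1) * r"
        using xI x0'(1) by (auto simp: I_def)
      then show ?thesis by (simp add: distrib_right)
    qed
    let ?a = "(int q, p1, p2) :: triple"
    have 1: "\<bar>y1 ?a (x0 j)\<bar> \<le> b1" using q by (simp add: b)
    have qd: "\<bar>q * (x0 j - x)\<bar> \<le> 2 * Q * r"
      unfolding abs_mult using q dx by (intro mult_mono) auto
    have "y2 ?a (x0 j) = (q * x - p1) + q * (x0 j - x)" by (simp add: algebra_simps)
    then have 2: "\<bar>y2 ?a (x0 j)\<bar> \<le> b2" using qd p1 \<delta> unfolding b by linarith
    \<comment> \<open>The error of the second approximation at \<open>x\<close>, minus the Taylor
      remainder at the reference point, minus the slope times the error of the first approximation: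
      each is at most a multiple of \<delta>.\<close>
    have "y3 ?a (x0 j) = (q * f x - p2) - q * (f x - f (x0 j) - D (x0 j) * (x - x0 j)) - D (x0 j) * (q * x - p1)"
      by (simp add: algebra_simps)
    moreover have "\<bar>D (x0 j) * (q * x - p1)\<bar> \<le> Db * \<delta>"
      unfolding abs_mult using D_bound[OF x0m] p1 Db_nonneg by (intro mult_mono) auto
    moreover have "\<bar>q * (f x - f (x0 j) - D (x0 j) * (x - x0 j))\<bar> \<le> c2 * \<delta>"
    proof -
      have "(x - x0 j)\<^sup>2 \<le> r\<^sup>2" using dx by (intro power2_le_iff_abs_le[THEN iffD2]) auto
      then have "c2 / 2 * (x - x0 j)\<^sup>2 \<le> c2 / 2 * r\<^sup>2" using c2 by (intro mult_left_mono) auto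
      then have "\<bar>f x - f (x0 j) - D (x0 j) * (x - x0 j)\<bar> \<le> c2 / 2 * r\<^sup>2"
        using f_taylor[OF x0m x] by linarith
      then have "\<bar>q * (f x - f (x0 j) - D (x0 j) * (x - x0 j))\<bar> \<le> (2 * Q) * (c2 / 2 * r\<^sup>2)"
        unfolding abs_mult using q by (intro mult_mono) auto
      also have "\<dots> = c2 * (Q * r\<^sup>2)" by simp
      also have "\<dots> \<le> c2 * \<delta>" using \<delta> c2 by (intro mult_left_mono) auto
      finally show ?thesis .
    qed
    moreover have "K0 * \<delta> = \<delta> + c2 * \<delta> + Db * \<delta>" by (simp add: K0_def algebra_simps)
    ultimately have 3: "\<bar>y3 ?a (x0 j)\<bar> \<le> b3" using p2 unfolding b by linarith
    have aS: "?a \<in> S j" using 1 2 3 gj by (simp add: S_def)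
    have qpos: "0 < real q" using q Q by linarith
    have "\<bar>x - p1 / q\<bar> * q = \<bar>(x - p1 / q) * q\<bar>" by (simp add: abs_mult)
    also have "(x - p1 / q) * q = q * x - p1" using qpos by (simp add: field_simps)
    finally have "\<bar>x - p1 / q\<bar> * q \<le> \<delta>" using p1 by linarith
    moreover have "\<bar>x - p1 / q\<bar> * Q \<le> \<bar>x - p1 / q\<bar> * q" using q by (intro mult_left_mono) auto
    ultimately have "\<bar>x - p1 / q\<bar> \<le> \<delta> / Q" using Q by (simp add: pos_le_divide_eq)
    then have "x \<in> U ?a" unfolding U_def by (simp add: abs_le_iff; linarith)
    then show ?thesis unfolding X_def using aS jM by blast
  qed
  then have "{x \<in> {u..v}. \<exists>q::nat. Q \<le> q \<and> q < 2 * Q \<and> dist_nearest_int (q * x) < \<delta> \<and> dist_nearest_int (q * f x) < \<delta>} \<subseteq> X"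
    by blast
  then show ?thesis using Xm mX by blast
qed

end

section \<open>Summation over dyadic levels\<close>

lemma eventually_pow2: 
  assumes "eventually P (at_top :: real filter)" shows "eventually (\<lambda>n. P (2 ^ n)) sequentially"
proof -
  have "filterlim (\<lambda>n. 2 ^ n :: real) at_top sequentially" by real_asymp
  then show ?thesis using assms by (rule eventually_compose_filterlim[rotated])
qed

lemma summable_condensed:
  fixes \<psi> :: "nat \<Rightarrow> real"
  assumes pos: "\<And>q. 1 \<le> q \<Longrightarrow> 0 < \<psi> q" and anti: "antimono_on {1..} \<psi>"
  shows "summable (\<lambda>q. (\<psi> (Suc q))\<^sup>2) \<longleftrightarrow> summable (\<lambda>n. 2 ^ n * (\<psi> (2 ^ n))\<^sup>2)"
proof -
  have "summable (\<lambda>q. (\<psi> (Suc q))\<^sup>2) \<longleftrightarrow> summable (\<lambda>q. (\<psi> q)\<^sup>2)"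
    by (rule summable_Suc_iff)
  also have "\<dots> \<longleftrightarrow> summable (\<lambda>n. 2 ^ n * (\<psi> (2 ^ n))\<^sup>2)"
  proof (rule condensation_test)
    fix m :: nat assume "0 < m"
    then have "\<psi> (Suc m) \<le> \<psi> m" "0 < \<psi> (Suc m)" using anti pos[of "Suc m"] by (auto simp: monotone_on_def)
    then show "(\<psi> (Suc m))\<^sup>2 \<le> (\<psi> m)\<^sup>2" by (intro power_mono) auto
  qed auto
  finally show ?thesis .
qed

lemma dyadic_block:
  assumes "1 \<le> (q::nat)" obtains n where "2 ^ n \<le> q" "q < 2 ^ Suc n"
proof -
  have "\<exists>n. q < 2 ^ n" using less_exp by blast
  define n where "n = (LEAST n. q < 2 ^ n)"
  have n: "q < 2 ^ n" unfolding n_def by (rule LeastI_ex) fact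
  then have "n \<noteq> 0" using assms by (cases n) auto
  then obtain m where m: "n = Suc m" using not0_implies_Suc by blast
  then have "\<not> q < 2 ^ m" using not_less_Least[of m "\<lambda>n. q < 2 ^ n"] by (simp add: n_def)
  then show thesis using that[of m] n m by simp
qed

context curved
begin

theorem convergence:
  fixes \<psi> :: "nat \<Rightarrow> real"
  assumes pos: "\<And>q. 1 \<le> q \<Longrightarrow> 0 < \<psi> q" and anti: "antimono_on {1..} \<psi>"
    and sum: "summable (\<lambda>q. (\<psi> (Suc q))\<^sup>2)"
  shows "negligible (simult_approx_set {u..v} f \<psi>)"
proof -
  define L where "L = v - u"
  have L: "0 < L" using uv by (simp add: L_def)
  \<comment> \<open>Enlarging \<psi> enlarges the set to be covered, and the floor adds only the
    summable terms 2^(-n/5).\<close>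
  define \<delta> where "\<delta> n = max (\<psi> (2 ^ n)) ((2 ^ n) powr (-3/5))" for n :: nat
  have \<delta>_ge: "(2 ^ n) powr (-3/5) \<le> \<delta> n" for n by (simp add: \<delta>_def)
  have \<delta>_pos: "0 < \<delta> n" for n using less_le_trans[OF _ \<delta>_ge[of n]] by simp
  have geo: "(2 ^ n) powr a = (2 powr a) ^ n" for n :: nat and a :: real
    by (simp add: powr_power powr_realpow[symmetric] powr_powr mult.commute)
  have sum\<delta>: "summable (\<lambda>n. 2 ^ n * (\<delta> n)\<^sup>2)"
  proof (rule summable_comparison_test')
    have "2 powr (-1/5) < (1::real)" by (simp add: powr_less_one)
    then show "summable (\<lambda>n. 2 ^ n * (\<psi> (2 ^ n))\<^sup>2 + (2 powr (-1/5)) ^ n)"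
      using sum summable_condensed[OF pos anti] by (intro summable_add summable_geometric) auto
    fix n :: nat
    have "(\<delta> n)\<^sup>2 \<le> (\<psi> (2 ^ n))\<^sup>2 + ((2 ^ n) powr (-3/5))\<^sup>2"
      by (simp add: \<delta>_def max_def)
    then have "2 ^ n * (\<delta> n)\<^sup>2 \<le> 2 ^ n * ((\<psi> (2 ^ n))\<^sup>2 + ((2 ^ n) powr (-3/5))\<^sup>2)"
      by (intro mult_left_mono) auto
    also have "(2::real) ^ n * ((2 ^ n) powr (-3/5))\<^sup>2 = (2 powr (-1/5)) ^ n"
    proof -
      have "(2::real) ^ n * ((2 ^ n) powr (-3/5))\<^sup>2 = (2 ^ n) powr (-1/5)"
        by (simp add: power2_eq_square powr_add[symmetric] powr_mult_base)
      then show ?thesis by (simp add: geo)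
    qed
    then have "(2::real) ^ n * ((\<psi> (2 ^ n))\<^sup>2 + ((2 ^ n) powr (-3/5))\<^sup>2) = 2 ^ n * (\<psi> (2 ^ n))\<^sup>2 + (2 powr (-1/5)) ^ n"
      by (simp only: distrib_left)
    finally show "norm (2 ^ n * (\<delta> n)\<^sup>2) \<le> 2 ^ n * (\<psi> (2 ^ n))\<^sup>2 + (2 powr (-1/5)) ^ n" by simp
  qed
  have ev\<delta>: "\<forall>\<^sub>F n in sequentially. \<delta> n \<le> 1"
  proof -
    have "\<forall>\<^sub>F n in sequentially. 2 ^ n * (\<delta> n)\<^sup>2 < 1"
      using summable_LIMSEQ_zero[OF sum\<delta>] by (rule order_tendstoD) simp
    then show ?thesis
    proof eventually_elim
      case (elim n)
      have "1 * (\<delta> n)\<^sup>2 \<le> 2 ^ n * (\<delta> n)\<^sup>2" by (intro mult_right_mono) auto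
      then have "(\<delta> n)\<^sup>2 \<le> 1\<^sup>2" using elim by simp
      then show ?case by (rule power2_le_imp_le) simp
    qed
  qed
  \<comment> \<open>Then Q r = Q^(1/6) is at least \<delta> once \<delta> \<le> 1, as
    \<open>level_cover\<close> requires.\<close>
  define r where "r n = ((2::real) ^ n) powr (-5/6)" for n :: nat
  define V where "V n = 6 * K0 * (2 ^ n)\<^sup>2 * r n * \<delta> n" for n :: nat
  define T where "T n = root 3 (V n)" for n
  define A where "A n = {x \<in> {u..v}. \<exists>q::nat. 2 ^ n \<le> real q \<and> real q < 2 * 2 ^ n \<and>
        dist_nearest_int (real q * x) < \<delta> n \<and> dist_nearest_int (real q * f x) < \<delta> n}" for n :: nat
  \<comment> \<open>V \<ge> Q^(17/30) gives T \<ge> Q^(17/90); the threshold 1 / sqrt T is then at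
    most Q^(-17/180), and the square root in the nondivergence bound halves the exponent to
    -17/360.\<close>
  define B where "B n = 6 * sqrt (4 * Cgood) * L * (2 powr (-17/360)) ^ n + 13464 * K0 * L * (2 ^ n * (\<delta> n)\<^sup>2)" for n
  \<comment> \<open>T \<le> k1 Q encodes the three conditions \<open>large\<close> of
    \<open>level_cover\<close>, and 3 Q r / T \<le> k2 the first two conditions
    \<open>small\<close>.\<close>
  define k1 where "k1 = min 8 (min (4 * L) (c1 * L\<^sup>2 / 2))"
  define k2 where "k2 = min (2 * L) 4"
  have k: "0 < k1" "0 < k2" using L c1 by (auto simp: k1_def k2_def)
  have "\<forall>\<^sub>F n in sequentially. (2 ^ n) powr (-5/6) \<le> L \<and> 16 ^ 3 < ((2 ^ n) powr (17/30) :: real) \<and>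
      6 * K0 / k1 ^ 3 * (2 ^ n) powr (7/6) \<le> (2 ^ n) ^ 3 \<and>
      27 / k2 ^ 3 * (2 ^ n) powr (1/2) \<le> ((2 ^ n) powr (17/30) :: real) \<and> K0 ^ 3 < (2 ^ n) powr (17/30)"
    (is "eventually (\<lambda>n. ?P (2 ^ n)) _")
  proof (rule eventually_pow2, intro eventually_conj)
    show "\<forall>\<^sub>F x in at_top. x powr (-5/6) \<le> L" using L by real_asymp
    show "\<forall>\<^sub>F x in at_top. 16 ^ 3 < (x powr (17/30) :: real)" by real_asymp
    have e1: "\<forall>\<^sub>F x in at_top. C * x powr (7/6) \<le> x ^ 3" if "0 < C" for C :: real using that by real_asymp
    show "\<forall>\<^sub>F x in at_top. 6 * K0 / k1 ^ 3 * x powr (7/6) \<le> x ^ 3" by (rule e1) (use k K0_pos in simp)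
    have e2: "\<forall>\<^sub>F x in at_top. C * x powr (1/2) \<le> x powr (17/30)" if "0 < C" for C :: real using that by real_asymp
    show "\<forall>\<^sub>F x in at_top. 27 / k2 ^ 3 * x powr (1/2) \<le> (x powr (17/30) :: real)" by (rule e2) (use k in simp)
    have "\<forall>\<^sub>F x in at_top. C < x powr (17/30)" for C :: real by real_asymp
    then show "\<forall>\<^sub>F x in at_top. K0 ^ 3 < x powr (17/30)" by simp
  qed
  then have "\<forall>\<^sub>F n in sequentially. \<exists>X\<in>lmeasurable. A n \<subseteq> X \<and> measure lebesgue X \<le> B n"
    using ev\<delta>
  proof eventually_elim
    case (elim n)
    define Q where "Q = (2::real) ^ n"
    have Q: "1 \<le> Q" "0 < Q" by (simp_all add: Q_def)
    note ev = elim(1)[folded Q_def] and \<delta>1 = elim(2)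
    have rQ: "r n = Q powr (-5/6)" and dQ: "Q powr (-3/5) \<le> \<delta> n" using \<delta>_ge[of n] by (simp_all add: r_def Q_def)
    have rp: "0 < r n" using Q by (simp add: rQ)
    have K0: "1 \<le> K0" by (rule K0_pos)
    have Vp: "0 < V n" using K0 rp \<delta>_pos[of n] by (simp add: V_def)
    have T3: "T n ^ 3 = V n" and Tp: "0 < T n" using Vp by (simp_all add: T_def)
    have VQ: "V n = 6 * K0 * (Q powr (7/6) * \<delta> n)"
    proof -
      have "Q\<^sup>2 = Q powr 2" using Q by (simp add: powr_numeral)
      then have "Q\<^sup>2 * Q powr (-5/6) = Q powr (7/6)" by (simp add: powr_add[symmetric] del: powr_numeral)
      then show ?thesis by (simp add: V_def Q_def[symmetric] rQ)
    qed
    have "Q powr (17/30) = Q powr (7/6) * Q powr (-3/5)" by (simp add: powr_add[symmetric])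
    also have "\<dots> \<le> Q powr (7/6) * \<delta> n" using dQ by (intro mult_left_mono) auto
    also have "1 * \<dots> \<le> 6 * K0 * (Q powr (7/6) * \<delta> n)" using K0 \<delta>_pos[of n] by (intro mult_right_mono) auto
    finally have Vlow: "Q powr (17/30) \<le> V n" by (simp add: VQ)
    have Vup: "V n \<le> 6 * K0 * Q powr (7/6)"
      unfolding VQ using \<delta>1 \<delta>_pos[of n] K0 by (intro mult_left_mono mult_left_le) auto
    have cube: "a \<le> b" if "a ^ 3 \<le> b ^ 3" "0 \<le> b" for a b :: real
    proof (rule ccontr)
      assume "\<not> a \<le> b"
      then have "b ^ 3 < a ^ 3" using that(2) by (intro power_strict_mono) auto
      then show False using that(1) by simp
    qed
    have T_ge: "y \<le> T n" if "y ^ 3 \<le> V n" for y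
      by (rule cube) (use that T3 Tp in auto)
    have T_gt: "16 < T n"
    proof -
      have "16 ^ 3 < T n ^ 3" unfolding T3 using ev Vlow by linarith
      then show ?thesis by (rule power_less_imp_less_base) (use Tp in simp)
    qed
    have T_le: "T n \<le> k1 * Q"
    proof -
      have "T n ^ 3 \<le> 6 * K0 * Q powr (7/6)" using T3 Vup by simp
      also have "\<dots> = k1 ^ 3 * (6 * K0 / k1 ^ 3 * Q powr (7/6))" using k by simp
      also have "\<dots> \<le> k1 ^ 3 * Q ^ 3" using ev k by (intro mult_left_mono) auto
      also have "\<dots> = (k1 * Q) ^ 3" by (simp add: power_mult_distrib)
      finally show ?thesis by (rule cube) (use k Q in auto)
    qed
    have Qr: "Q * r n = Q powr (1/6)"
    proof -
      show ?thesis using Q by (simp add: rQ powr_mult_base)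
    qed
    have T_ge2: "3 * Q * r n / T n \<le> k2"
    proof -
      have "(3 * (Q powr (1/6)) / k2) ^ 3 = 27 / k2 ^ 3 * (Q powr (1/6)) ^ 3" by (simp add: power_divide power_mult_distrib)
      also have "(Q powr (1/6)) ^ 3 = Q powr (1/2)" using Q by (simp add: powr_power)
      also have "27 / k2 ^ 3 * Q powr (1/2) \<le> V n" using ev Vlow by linarith
      finally have "3 * (Q powr (1/6)) / k2 \<le> T n" by (rule T_ge)
      then show ?thesis unfolding mult.assoc Qr using k Tp by (simp add: field_simps)
    qed
    have T_ge3: "K0 \<le> T n" using ev Vlow by (intro T_ge) linarith
    have large: "1 \<le> 4 * (2 * Q / T n)" "1 \<le> 2 * (2 * Q / T n) * L" "4 \<le> 2 * Q / T n * c1 * L\<^sup>2"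
    proof -
      have "k1 * Q \<le> 8 * Q" "k1 * Q \<le> (4 * L) * Q" "k1 * Q \<le> (c1 * L\<^sup>2 / 2) * Q"
        using Q by (intro mult_right_mono; simp add: k1_def)+
      then have "T n \<le> 8 * Q" "T n \<le> (4 * L) * Q" "T n \<le> (c1 * L\<^sup>2 / 2) * Q" using T_le by linarith+
      then show "1 \<le> 4 * (2 * Q / T n)" "1 \<le> 2 * (2 * Q / T n) * L" "4 \<le> 2 * Q / T n * c1 * L\<^sup>2"
        using Tp by (simp_all add: field_simps)
    qed
    have small: "3 * Q * r n / T n \<le> 2 * L" "3 * Q * r n / T n \<le> 4" using T_ge2 by (simp_all add: k2_def)
    have small3: "K0 * \<delta> n / T n \<le> 4"
    proof -
      have "K0 * \<delta> n \<le> K0 * 1" using \<delta>1 K0 by (intro mult_left_mono) auto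
      then have "K0 * \<delta> n \<le> 4 * T n" using T_ge3 Tp by linarith
      then show ?thesis using Tp by (simp add: field_simps)
    qed
    have d1: "\<delta> n \<le> Q * r n"
    proof -
      have "1 \<le> Q powr (1/6)" using Q by (simp add: ge_one_powr_ge_zero)
      then show ?thesis using \<delta>1 by (simp add: Qr)
    qed
    have d2: "Q * (r n)\<^sup>2 \<le> \<delta> n"
    proof -
      have "Q * (r n)\<^sup>2 = (Q * r n) * r n" by (simp add: power2_eq_square)
      also have "\<dots> = Q powr (1/6) * Q powr (-5/6)" by (simp only: Qr) (simp add: rQ)
      also have "\<dots> = Q powr (-2/3)" by (simp add: powr_add[symmetric])
      also have "\<dots> \<le> Q powr (-3/5)" using Q by (intro powr_mono) auto
      finally show ?thesis using dQ by simp
    qed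
    have T3': "T n ^ 3 = 6 * K0 * Q\<^sup>2 * r n * \<delta> n" by (simp add: T3 V_def Q_def)
    obtain X where X: "X \<in> lmeasurable" 
      "{x \<in> {u..v}. \<exists>q::nat. Q \<le> q \<and> q < 2 * Q \<and> dist_nearest_int (real q * x) < \<delta> n \<and> dist_nearest_int (real q * f x) < \<delta> n} \<subseteq> X"
      "measure lebesgue X \<le> 6 * sqrt (4 * Cgood * (1 / sqrt (T n))) * (v - u) + 13464 * K0 * (v - u) * (Q * (\<delta> n)\<^sup>2)"
      using level_cover[OF Q(1) rp _ \<delta>_pos d1 d2 T_gt T3' large[unfolded L_def] small[unfolded L_def] small3] ev
      unfolding rQ L_def by blast
    have "A n \<subseteq> X" using X(2) unfolding A_def Q_def .
    moreover have "measure lebesgue X \<le> B n"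
    proof -
      have "Q powr (17/90) \<le> T n"
      proof (rule T_ge)
        show "(Q powr (17/90)) ^ 3 \<le> V n" using Vlow Q by (simp add: powr_power)
      qed
      then have "sqrt (Q powr (17/90)) \<le> sqrt (T n)" by simp
      moreover have "sqrt (Q powr (17/90)) = Q powr (17/180)" by (simp add: powr_half_sqrt[symmetric] powr_powr)
      ultimately have "1 / sqrt (T n) \<le> 1 / Q powr (17/180)" using Q by (intro divide_left_mono) (use Tp in auto)
      also have "\<dots> = Q powr (-17/180)" by (simp add: powr_minus_divide)
      finally have "4 * Cgood * (1 / sqrt (T n)) \<le> 4 * Cgood * Q powr (-17/180)"
        using Cgood_pos by (intro mult_left_mono) auto
      then have "sqrt (4 * Cgood * (1 / sqrt (T n))) \<le> sqrt (4 * Cgood * Q powr (-17/180))" by (rule real_sqrt_le_mono)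
      also have "\<dots> = sqrt (4 * Cgood) * sqrt (Q powr (-17/180))" by (rule real_sqrt_mult)
      also have "sqrt (Q powr (-17/180)) = Q powr (-17/360)" by (simp add: powr_half_sqrt[symmetric] powr_powr)
      also have "\<dots> = (2 powr (-17/360)) ^ n" unfolding Q_def by (rule geo)
      finally have "sqrt (4 * Cgood * (1 / sqrt (T n))) \<le> sqrt (4 * Cgood) * (2 powr (-17/360)) ^ n" .
      then have "6 * sqrt (4 * Cgood * (1 / sqrt (T n))) * L \<le> 6 * (sqrt (4 * Cgood) * (2 powr (-17/360)) ^ n) * L"
        using L by (intro mult_right_mono mult_left_mono) auto
      then show ?thesis using X(3) unfolding B_def L_def[symmetric] Q_def by (simp add: mult_ac)
    qed
    ultimately show ?case using X(1) by blast
  qed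
  then obtain n0 where n0: "\<And>n. n0 \<le> n \<Longrightarrow> \<exists>X\<in>lmeasurable. A n \<subseteq> X \<and> measure lebesgue X \<le> B n"
    unfolding eventually_sequentially by blast
  then obtain X where X: "\<And>n. n0 \<le> n \<Longrightarrow> X n \<in> lmeasurable \<and> A n \<subseteq> X n \<and> measure lebesgue (X n) \<le> B n"
    by metis
  \<comment> \<open>The levels before \<open>n0\<close> are discarded; a limsup does not notice
    them.\<close>
  define Y where "Y n = X (n + n0)" for n
  have Y: "Y n \<in> lmeasurable" "A (n + n0) \<subseteq> Y n" "measure lebesgue (Y n) \<le> B (n + n0)" for n
    using X[of "n + n0"] by (auto simp: Y_def)
  have sumB: "summable B"
    unfolding B_def by (intro summable_add summable_mult sum\<delta> summable_geometric) (simp add: powr_less_one)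
  have null: "limsup Y \<in> null_sets lebesgue"
  proof (rule borel_cantelli_limsup1)
    show "Y n \<in> sets lebesgue" "emeasure lebesgue (Y n) < \<infinity>" for n
      using Y(1)[of n] by (auto simp: fmeasurable_def)
    show "summable (\<lambda>n. measure lebesgue (Y n))"
      by (rule summable_comparison_test'[OF summable_ignore_initial_segment[OF sumB, of n0]]) (use Y(3) in simp)
  qed
  have "simult_approx_set {u..v} f \<psi> \<subseteq> limsup Y"
  proof
    fix x assume "x \<in> simult_approx_set {u..v} f \<psi>"
    then have xm: "x \<in> {u..v}" and inf: "infinite {q::nat. q \<ge> 1 \<and>
       max (dist_nearest_int (real q * x)) (dist_nearest_int (real q * f x)) < \<psi> q}"
      by (auto simp: simult_approx_set_def)
    have "\<exists>n\<ge>N. x \<in> Y n" for N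
    proof -
      obtain q where q: "2 ^ (N + n0) \<le> q" "q \<ge> 1" 
        "max (dist_nearest_int (real q * x)) (dist_nearest_int (real q * f x)) < \<psi> q"
        using inf unfolding infinite_nat_iff_unbounded_le by blast
      obtain n where n: "2 ^ n \<le> q" "q < 2 ^ Suc n" using dyadic_block[OF q(2)] by blast
      have "N + n0 < Suc n" using le_less_trans[OF q(1) n(2)] by (simp only: power_strict_increasing_iff)
      then have Nn: "N + n0 \<le> n" by simp
      have "\<psi> q \<le> \<psi> (2 ^ n)" using anti n(1) q(2) by (auto simp: monotone_on_def)
      also have "\<dots> \<le> \<delta> n" by (simp add: \<delta>_def)
      finally have "dist_nearest_int (real q * x) < \<delta> n" "dist_nearest_int (real q * f x) < \<delta> n" using q(3) by auto
      moreover have "2 ^ n \<le> real q" using n(1) by (metis of_nat_le_iff of_nat_numeral of_nat_power)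
      moreover have "real q < 2 * 2 ^ n" using n(2) by (metis of_nat_less_iff of_nat_numeral of_nat_power power_Suc)
      ultimately have "x \<in> A n" using xm unfolding A_def by blast
      then have "x \<in> Y (n - n0)" using Y(2)[of "n - n0"] Nn by auto
      then show ?thesis using Nn by (intro exI[of _ "n - n0"]) auto
    qed
    then show "x \<in> limsup Y" by (auto simp: limsup_INF_SUP)
  qed
  then show ?thesis using null negligible_iff_null_sets negligible_subset by blast
qed

end

subsection \<open>Divergence\<close>

lemma kochen_stone_finite:
  assumes fin: "finite F" and E: "\<And>n. n \<in> F \<Longrightarrow> E n \<in> lmeasurable"
    and P: "(\<Sum>n\<in>F. \<Sum>m\<in>F. measure lebesgue (E n \<inter> E m)) \<le> p" "0 < p"
    and R: "r \<le> (\<Sum>n\<in>F. measure lebesgue (E n))" "0 < r"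
  shows "r\<^sup>2 / p \<le> measure lebesgue (\<Union>n\<in>F. E n)"
proof -
  define U where "U = (\<Union>n\<in>F. E n)"
  \<comment> \<open>With \<open>s\<close> counting the sets through a point, the integral of (s -
    t)^2 over the union is nonnegative; this \<open>t\<close> extracts the best lower bound.\<close>
  define t where "t = p / r"
  have t: "0 < t" using P R by (simp add: t_def)
  have U: "U \<in> lmeasurable" unfolding U_def by (rule fmeasurable.finite_UN[OF fin E])
  have EE: "E n \<inter> E m \<in> lmeasurable" if "n \<in> F" "m \<in> F" for n m
    using E that by (intro fmeasurable_Int_fmeasurable fmeasurableD) auto
  have i: "has_bochner_integral lebesgue (indicat_real A) (measure lebesgue A)" if "A \<in> lmeasurable" for A
    using that by (intro has_bochner_integral_real_indicator) (auto simp: fmeasurable_def)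
  define g where "g x = (\<Sum>n\<in>F. \<Sum>m\<in>F. indicat_real (E n \<inter> E m) x) - 2 * t * (\<Sum>n\<in>F. indicat_real (E n) x) + t\<^sup>2 * indicat_real U x" for x
  have "0 \<le> g x" for x
  proof -
    define s where "s = (\<Sum>n\<in>F. indicat_real (E n) x)"
    have 1: "(\<Sum>n\<in>F. \<Sum>m\<in>F. indicat_real (E n \<inter> E m) x) = s * s"
      unfolding s_def sum_product by (simp add: indicator_inter_arith)
    show ?thesis
    proof (cases "x \<in> U")
      case True
      then have "g x = (s - t)\<^sup>2" unfolding g_def 1 s_def[symmetric] by (simp add: power2_eq_square algebra_simps)
      then show ?thesis by simp
    next
      case False
      then have "s = 0" unfolding s_def U_def by (intro sum.neutral) auto
      then show ?thesis unfolding g_def 1 s_def[symmetric] by simp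
    qed
  qed
  then have "0 \<le> integral\<^sup>L lebesgue g" by (intro Bochner_Integration.integral_nonneg)
  also have "integral\<^sup>L lebesgue g = (\<Sum>n\<in>F. \<Sum>m\<in>F. measure lebesgue (E n \<inter> E m)) - 2 * t * (\<Sum>n\<in>F. measure lebesgue (E n)) + t\<^sup>2 * measure lebesgue U"
    unfolding g_def
    by (intro has_bochner_integral_integral_eq has_bochner_integral_add has_bochner_integral_diff
        has_bochner_integral_mult_right has_bochner_integral_sum i EE E U)
  also have "\<dots> \<le> p - 2 * t * r + t\<^sup>2 * measure lebesgue U"
    using P R t by (intro add_mono diff_mono mult_left_mono) auto
  also have "\<dots> = - p + (p\<^sup>2 / r\<^sup>2) * measure lebesgue U"
    using R by (simp add: t_def power_divide)
  finally have "p \<le> (p\<^sup>2 / r\<^sup>2) * measure lebesgue U" by simp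
  then have "p * 1 \<le> p * ((p / r\<^sup>2) * measure lebesgue U)" by (simp add: power2_eq_square)
  then have "1 \<le> (p / r\<^sup>2) * measure lebesgue U" by (simp only: mult_le_cancel_left_pos[OF P(2)])
  then show ?thesis using P R unfolding U_def by (simp add: field_simps)
qed

lemma sum_half_powers_le: "(\<Sum>m\<in>{m\<in>F. n \<le> m}. (1/2::real) ^ (m - n)) \<le> 2" if "finite F"
proof -
  have "(\<Sum>m\<in>{m\<in>F. n \<le> m}. (1/2::real) ^ (m - n)) = (\<Sum>j\<in>(\<lambda>m. m - n) ` {m\<in>F. n \<le> m}. (1/2) ^ j)"
    by (rule sum.reindex_cong[symmetric, of "\<lambda>m. m - n"]) (auto simp: inj_on_def)
  also have "\<dots> \<le> (\<Sum>j. (1/2) ^ j)"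
    using that by (intro sum_le_suminf) auto
  also have "\<dots> = 2" by (subst suminf_geometric) auto
  finally show ?thesis .
qed

text \<open>The geometric term in the overlap bound accounts for neighbouring scales, where an interval of one set
  may meet an interval of the next by accident; summing it costs only a linear term, so no regularity
  of \<open>\<psi>\<close> is needed.\<close>

lemma kochen_stone:
  fixes w :: "nat \<Rightarrow> real" and E :: "nat \<Rightarrow> real set"
  assumes E: "\<And>n. E n \<in> lmeasurable" "\<And>n. E n \<subseteq> {l..r}"
    and w: "\<And>n. 0 \<le> w n" "\<not> summable w" and ab: "0 < a" "0 < b"
    and low: "\<And>n. a * w n \<le> measure lebesgue (E n)"
    and up: "\<And>n m. n \<le> m \<Longrightarrow> measure lebesgue (E n \<inter> E m) \<le> b * (w n * w m + (1/2) ^ (m - n) * w n)"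
  shows "limsup E \<in> lmeasurable" "a\<^sup>2 / (5 * b) \<le> measure lebesgue (limsup E)"
proof -
  define T where "T k = (\<Union>n\<in>{k..}. E n)" for k
  have Tm: "T k \<in> lmeasurable" for k
  proof (rule fmeasurableI2[of "{l..r}"])
    show "T k \<subseteq> {l..r}" unfolding T_def using E(2) by blast
    show "T k \<in> sets lebesgue" unfolding T_def using E(1) by (intro sets.countable_UN') auto
  qed auto
  have Tlow: "a\<^sup>2 / (5 * b) \<le> measure lebesgue (T k)" for k
  proof -
    have "\<not> summable (\<lambda>n. w (n + k))" using w(2) by (simp add: summable_iff_shift)
    then have "\<not> (\<exists>B. \<forall>N. (\<Sum>n<N. w (n + k)) \<le> B)"
      using w(1) summableI_nonneg_bounded[of "\<lambda>n. w (n + k)"] by blast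
    \<comment> \<open>A partial sum above 1 lets the linear term 4 S be absorbed into S^2, which
      produces the factor 5.\<close>
    then obtain N where N: "1 < (\<Sum>n<N. w (n + k))" by (meson not_le)
    define F where "F = (\<lambda>n. n + k) ` {..<N}"
    have fin: "finite F" by (simp add: F_def)
    define S where "S = (\<Sum>n\<in>F. w n)"
    have "S = (\<Sum>n<N. w (n + k))" unfolding S_def F_def by (subst sum.reindex) (auto simp: inj_on_def)
    then have S: "1 < S" using N by simp
    \<comment> \<open>Zero below the diagonal, so that h n m + h m n bounds both orders of the
      indices.\<close>
    define h where "h n m = (if n \<le> m then (1/2) ^ (m - n) * w n else 0)" for n m
    have pw: "measure lebesgue (E n \<inter> E m) \<le> b * (w n * w m + h n m + h m n)" for n m
    proof -
      have h0: "0 \<le> h n m" "0 \<le> h m n" using w by (auto simp: h_def)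
      show ?thesis
      proof (cases "n \<le> m")
        case True
        have "measure lebesgue (E n \<inter> E m) \<le> b * (w n * w m + h n m)" using up[OF True] True by (simp add: h_def)
        also have "\<dots> \<le> b * (w n * w m + h n m + h m n)" using h0 ab by (intro mult_left_mono) auto
        finally show ?thesis .
      next
        case False
        then have le: "m \<le> n" by simp
        have "measure lebesgue (E n \<inter> E m) \<le> b * (w m * w n + h m n)" using up[OF le] le by (simp add: h_def Int_commute)
        also have "\<dots> \<le> b * (w n * w m + h n m + h m n)" using h0 ab by (intro mult_left_mono) (auto simp: mult.commute)
        finally show ?thesis .
      qed
    qed
    have hs: "(\<Sum>n\<in>F. \<Sum>m\<in>F. h n m) \<le> 2 * S"
    proof -
      have "(\<Sum>m\<in>F. h n m) \<le> 2 * w n" for n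
      proof -
        have "(\<Sum>m\<in>F. h n m) = (\<Sum>m\<in>{m\<in>F. n \<le> m}. (1/2) ^ (m - n) * w n)"
          unfolding h_def using fin by (simp add: sum.inter_filter)
        also have "\<dots> = (\<Sum>m\<in>{m\<in>F. n \<le> m}. (1/2) ^ (m - n)) * w n" by (simp add: sum_distrib_right)
        also have "\<dots> \<le> 2 * w n" by (rule mult_right_mono[OF sum_half_powers_le[OF fin] w(1)])
        finally show ?thesis .
      qed
      then have "(\<Sum>n\<in>F. \<Sum>m\<in>F. h n m) \<le> (\<Sum>n\<in>F. 2 * w n)" by (intro sum_mono)
      then show ?thesis by (simp add: S_def sum_distrib_left)
    qed
    have "(\<Sum>n\<in>F. \<Sum>m\<in>F. measure lebesgue (E n \<inter> E m)) \<le> (\<Sum>n\<in>F. \<Sum>m\<in>F. b * (w n * w m + h n m + h m n))"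
      by (intro sum_mono pw)
    also have "\<dots> = b * ((\<Sum>n\<in>F. \<Sum>m\<in>F. w n * w m) + (\<Sum>n\<in>F. \<Sum>m\<in>F. h n m) + (\<Sum>n\<in>F. \<Sum>m\<in>F. h m n))"
      by (simp add: sum.distrib sum_distrib_left distrib_left)
    also have "(\<Sum>n\<in>F. \<Sum>m\<in>F. w n * w m) = S * S" by (simp add: S_def sum_product)
    also have "(\<Sum>n\<in>F. \<Sum>m\<in>F. h m n) = (\<Sum>n\<in>F. \<Sum>m\<in>F. h n m)" by (rule sum.swap)
    also have "b * (S * S + (\<Sum>n\<in>F. \<Sum>m\<in>F. h n m) + (\<Sum>n\<in>F. \<Sum>m\<in>F. h n m)) \<le> b * (S * S + 4 * S)"
      using hs ab by (intro mult_left_mono) auto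
    also have "\<dots> \<le> b * (5 * (S * S))" using S ab by (intro mult_left_mono) auto
    finally have P: "(\<Sum>n\<in>F. \<Sum>m\<in>F. measure lebesgue (E n \<inter> E m)) \<le> b * (5 * (S * S))" .
    have R: "a * S \<le> (\<Sum>n\<in>F. measure lebesgue (E n))"
      unfolding S_def sum_distrib_left by (intro sum_mono low)
    have "a\<^sup>2 / (5 * b) = (a * S)\<^sup>2 / (b * (5 * (S * S)))" using S ab by (simp add: power2_eq_square)
    also have "\<dots> \<le> measure lebesgue (\<Union>n\<in>F. E n)"
      using S ab by (intro kochen_stone_finite[OF fin E(1) P _ R]) auto
    also have "\<dots> \<le> measure lebesgue (T k)"
    proof (rule measure_mono_fmeasurable[OF _ _ Tm])
      show "(\<Union>n\<in>F. E n) \<subseteq> T k" unfolding T_def by (rule UN_mono) (auto simp: F_def)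
      show "(\<Union>n\<in>F. E n) \<in> sets lebesgue" using fin E(1) by (intro sets.finite_UN) auto
    qed
    finally show ?thesis .
  qed
  have lim: "limsup E = (\<Inter>k. T k)" by (simp add: limsup_INF_SUP T_def)
  show "limsup E \<in> lmeasurable"
  proof (rule fmeasurableI2[OF Tm[of 0]])
    show "limsup E \<subseteq> T 0" unfolding lim by blast
    show "limsup E \<in> sets lebesgue" unfolding lim using Tm by (intro sets.countable_INT) auto
  qed
  have "(\<lambda>k. measure lebesgue (T k)) \<longlonglongrightarrow> measure lebesgue (\<Inter>k. T k)"
  proof (rule Lim_measure_decseq)
    show "range T \<subseteq> sets lebesgue" using Tm by auto
    show "decseq T" unfolding decseq_def T_def by (auto intro: order_trans)
    show "emeasure lebesgue (T k) \<noteq> \<infinity>" for k using Tm[of k] by (auto simp: fmeasurable_def)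
  qed
  then show "a\<^sup>2 / (5 * b) \<le> measure lebesgue (limsup E)"
    unfolding lim by (rule LIMSEQ_le_const) (use Tlow in auto)
qed

section \<open>Dirichlet's theorem in sheared coordinates, separated sets\<close>

lemma dirichlet_tangent:
  fixes x y d :: real and m1 m2 :: nat
  assumes m: "1 \<le> m1" "1 \<le> m2"
  obtains q p1 p2 :: int where "1 \<le> q" "q \<le> int (m1 * m2)" "\<bar>q * x - p1\<bar> \<le> 1 / m1"
    "\<bar>q * y - p2 - d * (q * x - p1)\<bar> \<le> 1 / m2"
proof -
  define s where "s q = frac (real q * x)" for q :: nat
  \<comment> \<open>The shear uses the fractional part \<open>s q\<close> rather than q x. The
    difference of two pigeonholed pairs then involves the same integer \<open>p1\<close> in both
    coordinates, for an arbitrary real slope \<open>d\<close>.\<close>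
  define t where "t q = frac (real q * y - d * s q)" for q :: nat
  define \<phi> where "\<phi> q = (\<lfloor>m1 * s q\<rfloor>, \<lfloor>m2 * t q\<rfloor>)" for q :: nat
  have cell: "\<lfloor>real k * frac z\<rfloor> \<in> {0..<int k}" if "1 \<le> k" for k z
  proof -
    have "real k * frac z < real k * 1" using frac_lt_1[of z] that by (intro mult_strict_left_mono) auto
    moreover have "0 \<le> real k * frac z" using frac_ge_0[of z] by simp
    ultimately show ?thesis by (simp add: floor_less_iff)
  qed
  have "\<phi> ` {0..m1 * m2} \<subseteq> {0..<int m1} \<times> {0..<int m2}"
    using cell m unfolding \<phi>_def s_def t_def by blast
  then have "card (\<phi> ` {0..m1 * m2}) \<le> card ({0..<int m1} \<times> {0..<int m2})" by (intro card_mono) auto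
  also have "\<dots> < card {0..m1 * m2}" by simp
  finally have "\<not> inj_on \<phi> {0..m1 * m2}" by (rule pigeonhole)
  then obtain i j where ij: "i \<in> {0..m1 * m2}" "j \<in> {0..m1 * m2}" "i < j" "\<phi> i = \<phi> j"
    unfolding inj_on_def by (metis linorder_neqE_nat)
  have close: "\<bar>z - z'\<bar> \<le> 1 / k" if "\<lfloor>real k * z\<rfloor> = \<lfloor>real k * z'\<rfloor>" "1 \<le> k" for z z' :: real and k :: nat
  proof -
    have "\<bar>real k * z - real k * z'\<bar> \<le> 1" using that(1) by linarith
    then have "real k * \<bar>z - z'\<bar> \<le> 1" by (simp add: abs_mult flip: right_diff_distrib)
    then show ?thesis using that(2) by (simp add: field_simps)
  qed
  have st: "\<bar>s j - s i\<bar> \<le> 1 / m1" "\<bar>t j - t i\<bar> \<le> 1 / m2"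
    using ij(4) m by (auto intro!: close simp: \<phi>_def)
  define q where "q = int j - int i"
  define p1 where "p1 = \<lfloor>real j * x\<rfloor> - \<lfloor>real i * x\<rfloor>"
  define p2 where "p2 = \<lfloor>real j * y - d * s j\<rfloor> - \<lfloor>real i * y - d * s i\<rfloor>"
  have 1: "q * x - p1 = s j - s i" by (simp add: q_def p1_def s_def frac_def algebra_simps)
  have "q * y - p2 - d * (s j - s i) = t j - t i" by (simp add: q_def p2_def t_def frac_def algebra_simps)
  then have 2: "q * y - p2 - d * (q * x - p1) = t j - t i" by (simp only: 1)
  show thesis
  proof (rule that[of q p1 p2])
    show "1 \<le> q" using ij(3) by (simp add: q_def)
    have "int j \<le> int (m1 * m2)" using ij(2) by (simp only: of_nat_le_iff atLeastAtMost_iff)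
    then show "q \<le> int (m1 * m2)" unfolding q_def by linarith
    show "\<bar>q * x - p1\<bar> \<le> 1 / m1" unfolding 1 by (rule st)
    show "\<bar>q * y - p2 - d * (q * x - p1)\<bar> \<le> 1 / m2" unfolding 2 by (rule st)
  qed
qed

lemma maximal_separated:
  fixes R :: "real set"
  assumes "finite R" "0 < \<rho>"
  shows "\<exists>P\<subseteq>R. (\<forall>p\<in>P. \<forall>p'\<in>P. p \<noteq> p' \<longrightarrow> \<rho> \<le> \<bar>p - p'\<bar>) \<and> (\<forall>x\<in>R. \<exists>p\<in>P. \<bar>x - p\<bar> < \<rho>)"
  using assms(1)
proof (induction R rule: finite_induct)
  case empty
  then show ?case by auto
next
  case (insert y R)
  then obtain P where P: "P \<subseteq> R" "\<And>p p'. p \<in> P \<Longrightarrow> p' \<in> P \<Longrightarrow> p \<noteq> p' \<Longrightarrow> \<rho> \<le> \<bar>p - p'\<bar>" "\<And>x. x \<in> R \<Longrightarrow> \<exists>p\<in>P. \<bar>x - p\<bar> < \<rho>"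
    by blast
  show ?case
  proof (cases "\<exists>p\<in>P. \<bar>y - p\<bar> < \<rho>")
    case True
    then show ?thesis using P by (intro exI[of _ P]) blast
  next
    case False
    then have far: "\<rho> \<le> \<bar>y - p\<bar>" "\<rho> \<le> \<bar>p - y\<bar>" if "p \<in> P" for p using that by (auto simp: not_less abs_minus_commute)
    have "\<forall>p\<in>insert y P. \<forall>p'\<in>insert y P. p \<noteq> p' \<longrightarrow> \<rho> \<le> \<bar>p - p'\<bar>" using P(2) far by blast
    moreover have "\<forall>x\<in>insert y R. \<exists>p\<in>insert y P. \<bar>x - p\<bar> < \<rho>" using P(3) assms(2) by auto
    ultimately show ?thesis using P(1) by (intro exI[of _ "insert y P"]) blast
  qed
qed

lemma card_separated_le:
  fixes P :: "real set"
  assumes "finite P" "0 < \<rho>" "s \<le> t" "P \<subseteq> {s..t}"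
    and sep: "\<And>p p'. p \<in> P \<Longrightarrow> p' \<in> P \<Longrightarrow> p \<noteq> p' \<Longrightarrow> \<rho> \<le> \<bar>p - p'\<bar>"
  shows "real (card P) \<le> (t - s) / \<rho> + 1"
proof -
  define \<phi> where "\<phi> p = \<lfloor>(p - s) / \<rho>\<rfloor>" for p
  have "inj_on \<phi> P"
  proof (rule inj_onI)
    fix p p' assume h: "p \<in> P" "p' \<in> P" "\<phi> p = \<phi> p'"
    have "\<bar>(p - s) / \<rho> - (p' - s) / \<rho>\<bar> < 1" using h(3) unfolding \<phi>_def by linarith
    then have "\<bar>p - p'\<bar> < \<rho>" using assms(2) by (simp add: abs_divide flip: diff_divide_distrib)
    then show "p = p'" using sep[OF h(1,2)] by force
  qed
  then have "card P = card (\<phi> ` P)" by (simp add: card_image)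
  also have "\<dots> \<le> card {0..\<lfloor>(t - s) / \<rho>\<rfloor>}"
  proof (rule card_mono)
    show "\<phi> ` P \<subseteq> {0..\<lfloor>(t - s) / \<rho>\<rfloor>}"
    proof clarify
      fix p assume "p \<in> P"
      then have "s \<le> p" "p \<le> t" using assms(4) by auto
      then have "0 \<le> (p - s) / \<rho>" "(p - s) / \<rho> \<le> (t - s) / \<rho>" using assms(2) by (auto simp: divide_right_mono)
      then show "\<phi> p \<in> {0..\<lfloor>(t - s) / \<rho>\<rfloor>}" unfolding \<phi>_def by (simp add: floor_mono)
    qed
  qed simp
  finally have "card P \<le> nat (\<lfloor>(t - s) / \<rho>\<rfloor> + 1)" by simp
  moreover have "0 \<le> (t - s) / \<rho>" using assms by simp
  ultimately show ?thesis by linarith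
qed

section \<open>Distance to the integers, measurability, full measure\<close>

lemma dist_nearest_int_le: "dist_nearest_int x \<le> \<bar>x - of_int k\<bar>"
  unfolding dist_nearest_int_def by (rule cINF_lower) (auto intro: bdd_belowI[of _ 0])

lemma dist_nearest_int_lipschitz: "\<bar>dist_nearest_int x - dist_nearest_int y\<bar> \<le> \<bar>x - y\<bar>"
proof -
  have "dist_nearest_int x \<le> dist_nearest_int y + \<bar>x - y\<bar>" for x y
  proof -
    obtain k where "dist_nearest_int y = \<bar>y - of_int k\<bar>" using dist_nearest_int_attained by blast
    then show ?thesis using dist_nearest_int_le[of x k] by linarith
  qed
  from this[of x y] this[of y x] show ?thesis by linarith
qed

lemma continuous_on_dist_nearest_int [continuous_intros]:
  assumes "continuous_on S g" shows "continuous_on S (\<lambda>x. dist_nearest_int (g x))"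
proof -
  have "1-lipschitz_on UNIV dist_nearest_int"
    using dist_nearest_int_lipschitz by (intro lipschitz_onI) (auto simp: dist_real_def)
  then have "continuous_on UNIV dist_nearest_int" by (rule lipschitz_on_continuous_on)
  then show ?thesis using assms by (rule continuous_on_compose2) auto
qed

lemma sets_simult_approx_set:
  assumes cont: "continuous_on {u..v} f"
  shows "simult_approx_set {u..v} f \<psi> \<in> sets lebesgue"
proof -
  define A where "A q = {x \<in> {u..v}. max (dist_nearest_int (real q * x)) (dist_nearest_int (real q * f x)) < \<psi> q}" for q :: nat
  have "A q \<in> sets borel" for q
  proof -
    let ?g = "\<lambda>x. max (dist_nearest_int (real q * x)) (dist_nearest_int (real q * f x))"
    have "openin (top_of_set {u..v}) ({u..v} \<inter> ?g -` {..<\<psi> q})"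
      by (intro continuous_openin_preimage_gen continuous_intros cont)
    moreover have "A q = {u..v} \<inter> ?g -` {..<\<psi> q}" by (auto simp: A_def)
    ultimately have "openin (top_of_set {u..v}) (A q)" by (simp only:)
    then obtain T where "open T" "A q = {u..v} \<inter> T" by (auto simp: openin_open)
    then show ?thesis by simp
  qed
  then have "(\<Inter>N. \<Union>q\<in>{Suc N..}. A q) \<in> sets borel" by (intro sets.countable_INT sets.countable_UN') auto
  moreover have "simult_approx_set {u..v} f \<psi> = (\<Inter>N. \<Union>q\<in>{Suc N..}. A q)"
  proof (rule set_eqI, rule iffI)
    fix x assume x: "x \<in> simult_approx_set {u..v} f \<psi>"
    show "x \<in> (\<Inter>N. \<Union>q\<in>{Suc N..}. A q)"
    proof
      fix N
      have "infinite {q::nat. q \<ge> 1 \<and> max (dist_nearest_int (real q * x)) (dist_nearest_int (real q * f x)) < \<psi> q}"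
        using x by (simp add: simult_approx_set_def)
      then obtain q where "Suc N \<le> q" "max (dist_nearest_int (real q * x)) (dist_nearest_int (real q * f x)) < \<psi> q"
        unfolding infinite_nat_iff_unbounded_le by blast
      moreover have "x \<in> {u..v}" using x by (simp add: simult_approx_set_def)
      ultimately show "x \<in> (\<Union>q\<in>{Suc N..}. A q)" unfolding A_def by blast
    qed
  next
    fix x assume x: "x \<in> (\<Inter>N. \<Union>q\<in>{Suc N..}. A q)"
    have "infinite {q::nat. q \<ge> 1 \<and> max (dist_nearest_int (real q * x)) (dist_nearest_int (real q * f x)) < \<psi> q}"
      unfolding infinite_nat_iff_unbounded_le
    proof
      fix N
      obtain q where q: "Suc N \<le> q" "x \<in> A q" using x by blast
      then show "\<exists>q\<ge>N. q \<in> {q. q \<ge> 1 \<and> max (dist_nearest_int (real q * x)) (dist_nearest_int (real q * f x)) < \<psi> q}"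
        by (intro exI[of _ q]) (simp add: A_def)
    qed
    moreover have "x \<in> {u..v}" using x by (auto simp: A_def)
    ultimately show "x \<in> simult_approx_set {u..v} f \<psi>" by (simp add: simult_approx_set_def)
  qed
  ultimately show ?thesis by simp
qed

text \<open>If the set meets every interval in a fixed proportion, so it does every open set, and then its
  complement is null by outer regularity. The open set is approximated by a grid of intervals.\<close>

lemma full_measure_of_uniform_proportion:
  fixes S :: "real set"
  assumes uv: "u < v" and S: "S \<in> sets lebesgue" and c: "0 < c"
    and ratio: "\<And>l r. \<lbrakk>u \<le> l; l < r; r \<le> v\<rbrakk> \<Longrightarrow> c * (r - l) \<le> measure lebesgue (S \<inter> {l..r})"
  shows "negligible ({u..v} - S)"
proof (rule ccontr)
  assume non: "\<not> negligible ({u..v} - S)"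
  \<comment> \<open>Without the endpoint \<open>v\<close> the half-open cells of the grid cover
    everything.\<close>
  define X where "X = {u..<v} - S"
  have Xm: "X \<in> lmeasurable"
    unfolding X_def by (rule fmeasurableI2[of "{u..v}"]) (use S in auto)
  have "\<not> negligible X"
  proof
    assume "negligible X"
    then have "negligible (X \<union> {v})" by (simp add: negligible_Un)
    moreover have "{u..v} - S \<subseteq> X \<union> {v}" by (auto simp: X_def)
    ultimately show False using non negligible_subset by blast
  qed
  then have mX: "0 < measure lebesgue X" using Xm by (metis measure_nonneg negligible_iff_measure order_le_less)
  obtain K where K: "closed K" "K \<subseteq> X" "X - K \<in> lmeasurable" "emeasure lebesgue (X - K) < ennreal (measure lebesgue X / 2)"
    using sets_lebesgue_inner_closed[OF fmeasurableD[OF Xm], of "measure lebesgue X / 2"] mX by auto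
  have "X \<subseteq> {u..v}" by (auto simp: X_def)
  then have "bounded K" using K(2) bounded_subset[of "{u..v}" K] by auto
  then have cK: "compact K" using K(1) by (simp add: compact_eq_bounded_closed)
  have Km: "K \<in> lmeasurable" using cK by (rule lmeasurable_compact)
  have mK: "0 < measure lebesgue K"
  proof -
    have "measure lebesgue (X - K) = measure lebesgue X - measure lebesgue K"
      by (rule measurable_measure_Diff[OF Xm fmeasurableD[OF Km] K(2)])
    moreover have "measure lebesgue (X - K) < measure lebesgue X / 2"
      using K(3,4) by (simp add: emeasure_eq_measure2 ennreal_less_iff)
    ultimately show ?thesis using mX by linarith
  qed
  \<comment> \<open>\<open>S\<close> fills at least the proportion \<open>c\<close> of the cells
    that meet \<open>K\<close>, and there it avoids \<open>K\<close>; this cannot fit into U - K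
    once that set is smaller than c times the measure of \<open>K\<close>.\<close>
  define \<eta> where "\<eta> = c * measure lebesgue K"
  have \<eta>: "0 < \<eta>" using mK c by (simp add: \<eta>_def)
  obtain U where U: "open U" "K \<subseteq> U" "U - K \<in> lmeasurable" "emeasure lebesgue (U - K) < ennreal \<eta>"
    using sets_lebesgue_outer_open[OF fmeasurableD[OF Km] \<eta>] by blast
  obtain d where d: "0 < d" "\<And>x. x \<in> K \<Longrightarrow> ball x d \<subseteq> U"
  proof -
    have "\<exists>e>0. (\<Union>x\<in>K. ball x e) \<subseteq> U"
      by (rule compact_subset_open_imp_ball_epsilon_subset[OF cK U(1,2)]) blast
    then show thesis using that by blast
  qed
  obtain N :: nat where N: "(v - u) / d < real N" using reals_Archimedean2 by blast
  have N0: "0 < N" using N uv d by (metis divide_pos_pos diff_gt_0_iff_gt less_trans of_nat_0_less_iff)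
  define h where "h = (v - u) / N"
  have h: "0 < h" "h < d" using N N0 uv d by (auto simp: h_def field_simps)
  have hN: "u + N * h = v" using N0 by (simp add: h_def)
  define I where "I j = {u + real j * h..<u + (real j + 1) * h}" for j :: nat
  define J where "J = {j. j < N \<and> I j \<inter> K \<noteq> {}}"
  have finJ: "finite J" by (simp add: J_def)
  have IS: "I j \<in> sets lebesgue" for j by (simp add: I_def)
  have Im: "I j \<in> lmeasurable" "measure lebesgue (I j) = h" for j
  proof -
    show "I j \<in> lmeasurable"
      by (rule fmeasurableI2[of "{u + real j * h..u + (real j + 1) * h}"]) (auto simp: I_def)
    show "measure lebesgue (I j) = h" using h by (simp add: I_def distrib_right)
  qed
  have cover: "K \<subseteq> (\<Union>j\<in>J. I j)"
  proof
    fix x assume x: "x \<in> K"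
    then have xuv: "u \<le> x" "x < v" using K(2) by (auto simp: X_def)
    define j where "j = nat \<lfloor>(x - u) / h\<rfloor>"
    have "0 \<le> (x - u) / h" using xuv h by simp
    then have jr: "real j \<le> (x - u) / h" "(x - u) / h < real j + 1" unfolding j_def by linarith+
    then have xI: "x \<in> I j" using h by (simp add: I_def field_simps)
    have "u + real j * h \<le> x" using xI by (simp add: I_def)
    then have "real j * h < real N * h" using xuv hN by linarith
    then have "j < N" using h by simp
    then show "x \<in> (\<Union>j\<in>J. I j)" using xI x by (auto simp: J_def)
  qed
  have disj: "I i \<inter> I j = {}" if "i \<noteq> j" for i j
  proof -
    have "I i \<inter> I j = {}" if "i < j" for i j
    proof -
      have "(real i + 1) * h \<le> real j * h" using that h by (intro mult_right_mono) auto
      then show ?thesis by (auto simp: I_def)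
    qed
    then show ?thesis using that by (metis Int_commute linorder_neqE_nat)
  qed
  have IU: "I j \<subseteq> U" if jJ: "j \<in> J" for j
  proof
    fix t assume t: "t \<in> I j"
    obtain x where x: "x \<in> I j" "x \<in> K" using jJ by (auto simp: J_def)
    have "\<bar>t - x\<bar> < h" using t x(1) by (auto simp: I_def distrib_right abs_if)
    then have "t \<in> ball x d" using h by (simp add: dist_real_def abs_minus_commute)
    then show "t \<in> U" using d(2)[OF x(2)] by blast
  qed
  have SI: "S \<inter> I j \<in> lmeasurable" for j 
    by (rule fmeasurableI2[OF Im(1)[of j]]) (use S IS in auto)
  have low: "c * h \<le> measure lebesgue (S \<inter> I j)" if "j \<in> J" for j
  proof -
    have jN: "real j + 1 \<le> real N" using that by (auto simp: J_def)
    then have "(real j + 1) * h \<le> N * h" using h by (intro mult_right_mono) auto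
    then have "c * ((u + (real j + 1) * h) - (u + real j * h)) \<le> measure lebesgue (S \<inter> {u + real j * h..u + (real j + 1) * h})"
      using h hN by (intro ratio) (auto simp: distrib_right)
    also have "\<dots> = measure lebesgue (S \<inter> I j)"
    proof (rule measure_negligible_symdiff[OF SI])
      show "negligible ((S \<inter> I j - S \<inter> {u + real j * h..u + (real j + 1) * h}) \<union> (S \<inter> {u + real j * h..u + (real j + 1) * h} - S \<inter> I j))"
        by (rule negligible_subset[of "{u + (real j + 1) * h}"]) (auto simp: I_def)
    qed
    finally show ?thesis by (simp add: distrib_right)
  qed
  have "measure lebesgue K \<le> measure lebesgue (\<Union>j\<in>J. I j)"
    by (rule measure_mono_fmeasurable[OF cover fmeasurableD[OF Km] fmeasurable.finite_UN[OF finJ Im(1)]])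
  also have "\<dots> \<le> (\<Sum>j\<in>J. measure lebesgue (I j))" by (rule measure_UNION_le[OF finJ IS])
  also have "\<dots> = (\<Sum>j\<in>J. h)" by (simp add: Im(2))
  finally have "c * measure lebesgue K \<le> c * (\<Sum>j\<in>J. h)" using c by (intro mult_left_mono) auto
  also have "\<dots> = (\<Sum>j\<in>J. c * h)" by (simp add: sum_distrib_left)
  also have "\<dots> \<le> (\<Sum>j\<in>J. measure lebesgue (S \<inter> I j))" by (intro sum_mono low)
  also have "\<dots> = measure lebesgue (\<Union>j\<in>J. S \<inter> I j)"
  proof (rule measure_finite_Union[OF finJ, symmetric])
    show "(\<lambda>j. S \<inter> I j) ` J \<subseteq> sets lebesgue" using SI by auto
    show "disjoint_family_on (\<lambda>j. S \<inter> I j) J" unfolding disjoint_family_on_def using disj by blast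
    show "emeasure lebesgue (S \<inter> I j) \<noteq> \<infinity>" for j using SI[of j] by (auto simp: fmeasurable_def)
  qed
  also have "\<dots> \<le> measure lebesgue (U - K)"
  proof (rule measure_mono_fmeasurable[OF _ _ U(3)])
    show "(\<Union>j\<in>J. S \<inter> I j) \<subseteq> U - K" using IU K(2) unfolding X_def by blast
    show "(\<Union>j\<in>J. S \<inter> I j) \<in> sets lebesgue" using SI finJ by (intro sets.finite_UN) auto
  qed
  also have "\<dots> < \<eta>" using U(3,4) \<eta> by (simp add: emeasure_eq_measure2 ennreal_less_iff)
  finally show False by (simp add: \<eta>_def)
qed

section \<open>Ubiquity of rational points near a curve\<close>

context curved
begin

text \<open>With the threshold \<open>eU\<close> the nondivergence bound is half the length of the interval; \<open>kap\<close> makes the box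
  with sides \<open>kap Q\<close>, \<open>10 / (Q \<phi>)\<close>, \<open>\<phi> / 4\<close> of volume \<open>eU ^ 3\<close>.\<close>

definition "eU = 1 / (576 * Cgood)"
definition "kap = 2 * eU ^ 3 / 5"

lemma eU: "0 < eU" "eU < 1/4" "sqrt (4 * Cgood * eU) = 1/12"
proof -
  have C: "5 \<le> Cgood" using c21 by (simp add: Cgood_def)
  show "0 < eU" "eU < 1/4" using C by (auto simp: eU_def field_simps)
  have "4 * Cgood * eU = (1/12)\<^sup>2" using C by (simp add: eU_def power2_eq_square)
  then show "sqrt (4 * Cgood * eU) = 1/12" by simp
qed

lemma kap: "0 < kap" "kap \<le> 1"
proof -
  show "0 < kap" using eU by (simp add: kap_def)
  have "eU ^ 3 \<le> 1 ^ 3" using eU by (intro power_mono) auto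
  then show "kap \<le> 1" by (simp add: kap_def)
qed

text \<open>A local form of ubiquity at height \<open>Q\<close>. The spacing is, up to a constant,
  the reciprocal of Q^2 \<phi>, the order of the expected number of such points per unit length, and
  the fourth clause says that this number is attained. The margin (r - l)/8 leaves room for
  neighbourhoods of the points, and kap Q < q makes the denominators grow with
  \<open>Q\<close>.\<close>

definition well_spaced :: "real \<Rightarrow> real \<Rightarrow> real \<Rightarrow> real \<Rightarrow> real set \<Rightarrow> bool" where
  "well_spaced l r Q \<phi> P \<longleftrightarrow> finite P \<and> P \<subseteq> {l + (r - l) / 8..r - (r - l) / 8} \<and>
     (\<forall>p\<in>P. \<forall>p'\<in>P. p \<noteq> p' \<longrightarrow> 10 / (kap * Q\<^sup>2 * \<phi>) \<le> \<bar>p - p'\<bar>) \<and>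
     r - l \<le> 16 * (10 / (kap * Q\<^sup>2 * \<phi>)) * card P \<and>
     (\<forall>p\<in>P. \<exists>(q::int) (p1::int) (p2::int). 1 \<le> q \<and> kap * Q < q \<and> q \<le> Q \<and> p = p1 / q \<and> \<bar>q * f p - p2\<bar> \<le> \<phi> / 2)"

text \<open>Dirichlet's theorem yields, for each \<open>x\<close>, a rational point near the tangent line at \<open>x\<close>; the
  nondivergence estimate excludes small denominators for at least half of all \<open>x\<close>.\<close>

lemma ubiquity_level:
  assumes lr: "u \<le> l" "l < r" "r \<le> v"
  shows "\<forall>\<^sub>F Q in at_top. \<forall>\<phi>. Q powr (-3/5) \<le> \<phi> \<longrightarrow> \<phi> \<le> Q powr (-1/2) \<longrightarrow> (\<exists>P. well_spaced l r Q \<phi> P)"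
proof -
  define \<Lambda> where "\<Lambda> = (r - l) / 2"
  define k2 where "k2 = min (2 * \<Lambda>) 4"
  have \<Lambda>: "0 < \<Lambda>" "0 < k2" using lr by (auto simp: \<Lambda>_def k2_def)
  \<comment> \<open>Thresholds: \<open>C1\<close>, \<open>C2\<close>, \<open>C3\<close> for
    \<open>large\<close> and \<open>C4\<close> for \<open>small\<close> in the nondivergence bound,
    \<open>C5\<close> for \<rho> \<le> (r - l)/8, \<open>C6\<close> for the Taylor error. All are
    met once Q^(2/5) exceeds their sum, since Q^(2/5) is at most Q and at most Q \<phi>.\<close>
  define C1 where "C1 = eU / kap * (1/4)"
  define C2 where "C2 = eU / kap * (1 / (2 * \<Lambda>))"
  define C3 where "C3 = eU / kap * (4 / (c1 * \<Lambda>\<^sup>2))"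
  define C4 where "C4 = 10 / (eU * k2)"
  define C5 where "C5 = 80 / (kap * (r - l))"
  define C6 where "C6 = 200 * c2 / kap"
  have Cs: "0 < C1" "0 < C2" "0 < C3" "0 < C4" "0 < C5" "0 < C6"
    using eU kap \<Lambda> lr c1 c2 by (auto simp: C1_def C2_def C3_def C4_def C5_def C6_def)
  define C where "C = 10 + C1 + C2 + C3 + C4 + C5 + C6"
  have ev1: "\<forall>\<^sub>F Q in at_top. K \<le> Q powr (2/5)" for K :: real by real_asymp
  have ev2: "\<forall>\<^sub>F Q in at_top. Q powr (-1/2) \<le> K" if "0 < K" for K :: real using that by real_asymp
  have e16: "0 < 16 * eU" using eU(1) by simp
  show ?thesis
    using ev1[of C] ev2[OF e16] eventually_ge_at_top[of 1]
  proof eventually_elim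
    case (elim Q)
    show ?case
    proof (intro allI impI)
      fix \<phi> assume \<phi>1: "Q powr (-3/5) \<le> \<phi>" and \<phi>2: "\<phi> \<le> Q powr (-1/2)"
      have Q: "1 \<le> Q" "0 < Q" using elim by auto
      have \<phi>p: "0 < \<phi>" using \<phi>1 Q less_le_trans[of 0 "Q powr (-3/5)" \<phi>] by simp
      have \<phi>16: "\<phi> \<le> 16 * eU" using \<phi>2 elim(2) by linarith
      have \<phi>le1: "\<phi> \<le> 1"
      proof -
        have "Q powr (-1/2) \<le> Q powr 0" using Q by (intro powr_mono) auto
        then show ?thesis using \<phi>2 Q by simp
      qed
      have Q25: "Q powr (2/5) \<le> Q"
      proof -
        have "Q powr (2/5) \<le> Q powr 1" using Q by (intro powr_mono) auto
        then show ?thesis using Q by simp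
      qed
      have "Q powr (2/5) = Q * Q powr (-3/5)" using Q by (simp add: powr_mult_base)
      also have "\<dots> \<le> Q * \<phi>" using \<phi>1 Q by (intro mult_left_mono) auto
      finally have Y0: "Q powr (2/5) \<le> Q * \<phi>" .
      define Y where "Y = Q * \<phi>"
      have YC: "C \<le> Y" "C \<le> Q" using Y0 Q25 elim(1) by (auto simp: Y_def)
      have Y: "10 \<le> Y" "C4 \<le> Y" "C6 \<le> Y" and QC: "C1 \<le> Q" "C2 \<le> Q" "C3 \<le> Q" "C5 \<le> Q" "10 \<le> Q"
        using YC Cs unfolding C_def by linarith+
      \<comment> \<open>Scaled by \<open>eU\<close> these are kap Q, 10 / Y and \<phi> / 4, so a
        Dirichlet solution with q \<le> kap Q puts its \<open>x\<close> into
        \<open>Bad\<close>.\<close>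
      define t1 t2 t3 where t: "t1 = kap * Q / eU" "t2 = 10 / (Y * eU)" "t3 = \<phi> / (4 * eU)"
      have tp: "0 < t1" "0 < t2" "0 < t3" using kap eU Q \<phi>p Y by (auto simp: t)
      have prod: "t1 * t2 * t3 = 1"
      proof -
        have "t1 * t2 * t3 = (5 * kap) / (2 * eU ^ 3)"
          using eU Q \<phi>p by (simp add: t Y_def field_simps power3_eq_cube)
        also have "\<dots> = 1" using eU by (simp add: kap_def)
        finally show ?thesis .
      qed
      have ke: "0 < kap / eU" using kap eU by simp
      have t1_ge: "s \<le> t1" if "eU / kap * s \<le> Q" for s
      proof -
        have "(kap / eU) * (eU / kap * s) \<le> (kap / eU) * Q" using that ke by (intro mult_left_mono) auto
        then show ?thesis using kap eU by (simp add: t)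
      qed
      have T1: "1/4 \<le> t1" "1 / (2 * \<Lambda>) \<le> t1" "4 / (c1 * \<Lambda>\<^sup>2) \<le> t1"
        using QC t1_ge unfolding C1_def C2_def C3_def by blast+
      have large: "1 \<le> 4 * t1" "1 \<le> 2 * t1 * \<Lambda>" "4 \<le> t1 * c1 * \<Lambda>\<^sup>2"
        using T1 \<Lambda> c1 by (simp_all add: field_simps)
      have t2k: "t2 \<le> k2"
      proof -
        have "10 \<le> Y * (eU * k2)" using Y(2) eU \<Lambda> unfolding C4_def by (simp add: field_simps)
        then have "10 \<le> k2 * (Y * eU)" by (simp add: mult_ac)
        moreover have "0 < Y * eU" using Y eU by simp
        ultimately show ?thesis unfolding t by (simp add: pos_divide_le_eq)
      qed
      have small: "t2 \<le> 2 * \<Lambda>" "t2 \<le> 4" using t2k by (simp_all add: k2_def)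
      have small3: "t3 \<le> 4" using \<phi>16 eU by (simp add: t field_simps)
      \<comment> \<open>Only the middle half is used: the rational point found near \<open>x\<close>
        is at distance at most \<rho> \<le> (r - l)/8 and thus respects the margin.\<close>
      define l' r' where l': "l' = l + (r - l) / 4" "r' = r - (r - l) / 4"
      have len: "r' - l' = \<Lambda>" by (simp add: l' \<Lambda>_def field_simps)
      have "0 < (r - l) / 4" using lr by simp
      then have ulr: "u \<le> l'" "l' < r'" "r' \<le> v" using lr \<Lambda>(1) len unfolding l' by linarith+
      define Bad where "Bad = {x \<in> {l'..r'}. \<exists>a. a \<noteq> (0,0,0) \<and> \<bar>y1 a x\<bar> \<le> eU * t1 \<and> \<bar>y2 a x\<bar> \<le> eU * t2 \<and> \<bar>y3 a x\<bar> \<le> eU * t3}"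
      have Bad: "compact Bad" "measure lebesgue Bad \<le> 6 * sqrt (4 * Cgood * eU) * \<Lambda>"
        unfolding Bad_def len[symmetric]
        by (rule curve_nondivergence[OF ulr eU(1,2) tp prod large[folded len] small[folded len] small3])+
      have mB: "measure lebesgue Bad \<le> \<Lambda> / 2" using Bad(2) unfolding eU(3) by simp
      define \<rho> where "\<rho> = 10 / (kap * Q\<^sup>2 * \<phi>)"
      have kQ: "0 < kap * Q\<^sup>2 * \<phi>" using kap Q \<phi>p by simp
      have \<rho>p: "0 < \<rho>" using kQ by (simp add: \<rho>_def)
      have \<rho>8: "\<rho> \<le> (r - l) / 8"
      proof -
        have "80 \<le> Q * (kap * (r - l))" using QC(4) kap lr unfolding C5_def by (simp add: field_simps)
        also have "\<dots> \<le> (Q * Y) * (kap * (r - l))"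
          using Y Q kap lr by (intro mult_right_mono) (auto simp: mult_le_cancel_left1)
        also have "\<dots> = (r - l) * (kap * Q\<^sup>2 * \<phi>)" by (simp add: Y_def power2_eq_square mult_ac)
        finally have "10 \<le> (r - l) / 8 * (kap * Q\<^sup>2 * \<phi>)" by simp
        then show ?thesis unfolding \<rho>_def using kQ by (simp only: pos_divide_le_eq)
      qed
      define W where "W p \<longleftrightarrow> (\<exists>(q::int) (p1::int) (p2::int). 1 \<le> q \<and> kap * Q < q \<and> q \<le> Q \<and> p = p1 / q \<and> \<bar>q * f p - p2\<bar> \<le> \<phi> / 2)" for p
      define R where "R = {p \<in> {l + (r - l) / 8..r - (r - l) / 8}. W p}"
      have finR: "finite R"
      proof -
        define B where "B = \<bar>l\<bar> + \<bar>r\<bar>"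
        have "R \<subseteq> (\<lambda>(i, j). real_of_int i / real_of_int j) ` ({-\<lceil>B * Q\<rceil>..\<lceil>B * Q\<rceil>} \<times> {1..\<lfloor>Q\<rfloor>})"
        proof
          fix p assume p: "p \<in> R"
          then obtain q p1 :: int where q: "1 \<le> real_of_int q" "q \<le> Q" "p = p1 / q" unfolding R_def W_def by blast
          have "0 < (r - l) / 8" using lr by simp
          moreover have "l + (r - l) / 8 \<le> p" "p \<le> r - (r - l) / 8" using p by (auto simp: R_def)
          ultimately have "\<bar>p\<bar> \<le> B" unfolding B_def by linarith
          moreover have "0 \<le> B" by (simp add: B_def)
          ultimately have "\<bar>p\<bar> * q \<le> B * Q" using q Q by (intro mult_mono) auto
          then have "\<bar>real_of_int p1\<bar> \<le> B * Q" using q by (simp add: abs_divide)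
          then have "real_of_int p1 \<le> B * Q" "- (B * Q) \<le> real_of_int p1" by linarith+
          then have "p1 \<in> {-\<lceil>B * Q\<rceil>..\<lceil>B * Q\<rceil>}" by (simp; linarith)
          moreover have "q \<in> {1..\<lfloor>Q\<rfloor>}" using q by (simp add: le_floor_iff)
          ultimately show "p \<in> (\<lambda>(i, j). real_of_int i / real_of_int j) ` ({-\<lceil>B * Q\<rceil>..\<lceil>B * Q\<rceil>} \<times> {1..\<lfloor>Q\<rfloor>})"
            using q(3) by force
        qed
        then show ?thesis by (rule finite_subset) auto
      qed
      obtain P where P: "P \<subseteq> R" "\<And>p p'. p \<in> P \<Longrightarrow> p' \<in> P \<Longrightarrow> p \<noteq> p' \<Longrightarrow> \<rho> \<le> \<bar>p - p'\<bar>"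
        "\<And>x. x \<in> R \<Longrightarrow> \<exists>p\<in>P. \<bar>x - p\<bar> < \<rho>"
        using maximal_separated[OF finR \<rho>p] by blast
      have finP: "finite P" using P(1) finR finite_subset by blast
      have near: "\<exists>p\<in>R. \<bar>x - p\<bar> \<le> \<rho>" if x: "x \<in> {l'..r'}" "x \<notin> Bad" for x
      proof -
        \<comment> \<open>\<open>m2\<close> is about 4/\<phi>, so that 1/m2 \<le> \<phi>/4, and
          \<open>m1\<close> is about Q/m2, so that m1 m2 \<le> Q and 1/m1 \<le> 10/Y.\<close>
        define m2 where "m2 = nat \<lceil>4 / \<phi>\<rceil>"
        define m1 where "m1 = nat \<lfloor>Q / m2\<rfloor>"
        have \<phi>4: "4 \<le> 4 / \<phi>" using \<phi>p \<phi>le1 by (simp add: field_simps)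
        then have m2: "4 / \<phi> \<le> m2" "m2 \<le> 4 / \<phi> + 1" unfolding m2_def by linarith+
        then have m2p: "0 < real m2" and m25: "m2 \<le> 5 / \<phi>" using \<phi>4 \<phi>p \<phi>le1 by (linarith, simp add: field_simps)
        have m2inv: "1 / m2 \<le> \<phi> / 4" using m2(1) m2p \<phi>p by (simp add: field_simps)
        have "Y / 5 \<le> Q / m2"
        proof -
          have "Q / (5 / \<phi>) \<le> Q / m2" using m25 m2p Q \<phi>p by (intro divide_left_mono) auto
          then show ?thesis by (simp add: Y_def)
        qed
        then have "1 \<le> \<lfloor>Q / m2\<rfloor>" using Y by linarith
        then have m1: "1 \<le> m1" "m1 \<le> Q / m2" "Q / m2 - 1 < m1" unfolding m1_def by linarith+
        then have m1Y: "Y / 10 \<le> m1" using \<open>Y / 5 \<le> Q / m2\<close> Y by linarith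
        then have m1inv: "1 / m1 \<le> 10 / Y" using Y m1(1) by (simp add: field_simps)
        have mm: "real (m1 * m2) \<le> Q" using m1(2) m2p by (simp add: field_simps)
        obtain q p1 p2 :: int where q: "1 \<le> q" "q \<le> int (m1 * m2)" and a1: "\<bar>q * x - p1\<bar> \<le> 1 / m1"
          and a2: "\<bar>q * f x - p2 - D x * (q * x - p1)\<bar> \<le> 1 / m2"
          using dirichlet_tangent[of m1 m2 x "f x" "D x"] m1(1) m2p by auto
        have qQ: "q \<le> Q"
        proof -
          have "real_of_int q \<le> real (m1 * m2)" using q(2) by linarith
          then show ?thesis using mm by linarith
        qed
        have qk: "kap * Q < q"
        proof (rule ccontr)
          assume "\<not> kap * Q < q"
          then have "\<bar>y1 (q, p1, p2) x\<bar> \<le> eU * t1" using q(1) eU by (simp add: t)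
          moreover have "eU * t2 = 10 / Y" "eU * t3 = \<phi> / 4" using eU by (simp_all add: t)
          then have "\<bar>y2 (q, p1, p2) x\<bar> \<le> eU * t2" "\<bar>y3 (q, p1, p2) x\<bar> \<le> eU * t3"
            using a1 a2 m1inv m2inv by (simp_all only: y2.simps y3.simps)
          moreover have "(q, p1, p2) \<noteq> (0,0,0)" using q(1) by simp
          ultimately have "x \<in> Bad" unfolding Bad_def using x(1) by blast
          then show False using x(2) by blast
        qed
        define p where "p = p1 / q"
        have qp: "0 < real_of_int q" using q(1) by simp
        have qxp: "q * (p - x) = - (q * x - p1)" using qp by (simp add: p_def algebra_simps)
        then have dq: "q * \<bar>p - x\<bar> \<le> 10 / Y" using a1 m1inv qp by (metis abs_minus_cancel abs_mult abs_of_pos order_trans)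
        have dxp: "\<bar>x - p\<bar> \<le> \<rho>"
        proof -
          have "(kap * Q) * \<bar>p - x\<bar> \<le> q * \<bar>p - x\<bar>" using qk by (intro mult_right_mono) auto
          then have "\<bar>p - x\<bar> * (kap * Q) \<le> 10 / Y" using dq by (simp add: mult.commute)
          then have "\<bar>p - x\<bar> \<le> 10 / Y / (kap * Q)" using kap Q by (subst pos_le_divide_eq) auto
          also have "\<dots> = \<rho>" by (simp add: \<rho>_def Y_def power2_eq_square mult_ac)
          finally show ?thesis by (simp add: abs_minus_commute)
        qed
        have pI: "p \<in> {l + (r - l) / 8..r - (r - l) / 8}"
        proof -
          have "l + (r - l) / 4 \<le> x" "x \<le> r - (r - l) / 4" using x(1) by (auto simp: l')
          moreover have "x - p \<le> (r - l) / 8" "p - x \<le> (r - l) / 8" using dxp \<rho>8 by linarith+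
          moreover have "(r - l) / 4 = (r - l) / 8 + (r - l) / 8" by simp
          ultimately show ?thesis unfolding atLeastAtMost_iff by linarith
        qed
        have xuv: "x \<in> {u..v}" using x(1) ulr by auto
        have puv: "p \<in> {u..v}"
        proof -
          have "0 < (r - l) / 8" using lr by simp
          then show ?thesis using pI lr unfolding atLeastAtMost_iff by linarith
        qed
        \<comment> \<open>As q (p - x) = -(q x - p1), the tangent term is exactly the linear Taylor
          term at \<open>x\<close>. Passing from \<open>x\<close> to \<open>p\<close> thus costs
          only the quadratic remainder, at most \<phi>/4.\<close>
        have "q * f p - p2 = (q * f x - p2 - D x * (q * x - p1)) + q * (f p - f x - D x * (p - x))"
        proof -
          have "D x * (q * (p - x)) = D x * (- (q * x - p1))" by (simp only: qxp)
          then show ?thesis by (simp add: algebra_simps)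
        qed
        moreover have "\<bar>q * (f p - f x - D x * (p - x))\<bar> \<le> \<phi> / 4"
        proof -
          have "\<bar>q * (f p - f x - D x * (p - x))\<bar> \<le> q * (c2 / 2 * (p - x)\<^sup>2)"
            unfolding abs_mult using f_taylor[OF xuv puv] qp by (simp add: mult_left_mono)
          also have "\<dots> = c2 / 2 * ((q * \<bar>p - x\<bar>) * \<bar>p - x\<bar>)" by (simp add: power2_eq_square)
          also have "\<dots> \<le> c2 / 2 * ((10 / Y) * \<rho>)"
            using dq dxp c2 \<rho>p Y by (intro mult_left_mono mult_mono) (auto simp: abs_minus_commute)
          also have "\<dots> = 50 * c2 / kap / (Q * Y * Y)"
            by (simp add: \<rho>_def Y_def power2_eq_square)
          also have "\<dots> \<le> \<phi> / 4"
          proof -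
            have "200 * c2 / kap \<le> Y * 1 * 1" using Y by (simp add: C6_def)
            also have "\<dots> \<le> Y * Y * Y" using Y by (intro mult_mono) auto
            finally have "200 * c2 / kap \<le> \<phi> * (Q * Y * Y)" by (simp add: Y_def mult_ac)
            moreover have "0 < Q * Y * Y" using Q Y by simp
            ultimately have "200 * c2 / kap / (Q * Y * Y) \<le> \<phi>" by (simp only: pos_divide_le_eq)
            then show ?thesis by simp
          qed
          finally show ?thesis .
        qed
        ultimately have "\<bar>q * f p - p2\<bar> \<le> \<phi> / 2" using a2 m2inv by linarith
        moreover have "1 \<le> real_of_int q" using q(1) by simp
        ultimately have "W p" unfolding W_def using qk qQ p_def by blast
        then show ?thesis using pI dxp by (intro bexI[of _ p]) (auto simp: R_def)
      qed
      have cov: "{l'..r'} - Bad \<subseteq> (\<Union>p\<in>P. {p - 2 * \<rho>..p + 2 * \<rho>})"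
      proof
        fix x assume "x \<in> {l'..r'} - Bad"
        then obtain p where p: "p \<in> R" "\<bar>x - p\<bar> \<le> \<rho>" using near by blast
        then obtain p' where p': "p' \<in> P" "\<bar>p - p'\<bar> < \<rho>" using P(3) by blast
        then have "x \<in> {p' - 2 * \<rho>..p' + 2 * \<rho>}" using p(2) unfolding atLeastAtMost_iff by linarith
        then show "x \<in> (\<Union>p\<in>P. {p - 2 * \<rho>..p + 2 * \<rho>})" using p' by blast
      qed
      have Bm: "Bad \<in> lmeasurable" by (rule lmeasurable_compact[OF Bad(1)])
      have Bsub: "Bad \<subseteq> {l'..r'}" by (auto simp: Bad_def)
      have "\<Lambda> / 2 \<le> measure lebesgue {l'..r'} - measure lebesgue Bad" using mB len ulr by simp
      also have "\<dots> = measure lebesgue ({l'..r'} - Bad)"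
        by (rule measurable_measure_Diff[OF _ fmeasurableD[OF Bm] Bsub, symmetric]) simp
      also have "\<dots> \<le> measure lebesgue (\<Union>p\<in>P. {p - 2 * \<rho>..p + 2 * \<rho>})"
        using Bm finP by (intro measure_mono_fmeasurable[OF cov] fmeasurable.finite_UN) auto
      also have "\<dots> \<le> (\<Sum>p\<in>P. measure lebesgue {p - 2 * \<rho>..p + 2 * \<rho>})"
        by (rule measure_UNION_le[OF finP]) simp
      also have "\<dots> = card P * (4 * \<rho>)" using \<rho>p by simp
      \<comment> \<open>At least (r - l)/4 of the line is covered, and each chosen point accounts
        for 4 \<rho> of it.\<close>
      finally have card: "r - l \<le> 16 * \<rho> * card P" by (simp add: \<Lambda>_def mult_ac)
      have "well_spaced l r Q \<phi> P"
        unfolding well_spaced_def \<rho>_def[symmetric] W_def[symmetric]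
        using finP P(1,2) card unfolding R_def by blast
      then show "\<exists>P. well_spaced l r Q \<phi> P" by blast
    qed
  qed
qed


lemma well_spaced_card_le:
  assumes P: "well_spaced l r Q \<phi> P" and lr: "l < r" and \<rho>: "\<rho> = 10 / (kap * Q\<^sup>2 * \<phi>)" "0 < \<rho>" "\<rho> \<le> r - l"
  shows "real (card P) \<le> 2 * (r - l) / \<rho>"
proof -
  have "real (card P) \<le> ((r - (r - l) / 8) - (l + (r - l) / 8)) / \<rho> + 1"
  proof (rule card_separated_le)
    show "l + (r - l) / 8 \<le> r - (r - l) / 8" using lr by (simp add: field_simps)
  qed (use P \<rho>(2) in \<open>unfold well_spaced_def \<rho>(1)[symmetric], blast+\<close>)
  also have "\<dots> \<le> (r - l) / \<rho> + (r - l) / \<rho>"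
  proof (rule add_mono)
    show "((r - (r - l) / 8) - (l + (r - l) / 8)) / \<rho> \<le> (r - l) / \<rho>"
      using lr \<rho>(2) by (intro divide_right_mono) (auto simp: field_simps)
    show "1 \<le> (r - l) / \<rho>" using \<rho>(2,3) by simp
  qed
  finally show ?thesis by simp
qed

lemma near_rational_approximates:
  assumes q: "1 \<le> q" "real_of_int q \<le> Q" and p: "p = real_of_int p1 / q" "\<bar>q * f p - real_of_int p2\<bar> \<le> \<phi> / 2"
    and xp: "x \<in> {u..v}" "p \<in> {u..v}" "\<bar>x - p\<bar> \<le> \<phi> / (4 * (1 + Lip)) / Q" and \<phi>: "0 < \<phi>"
  shows "dist_nearest_int (q * x) < \<phi>" "dist_nearest_int (q * f x) < \<phi>"
proof -
  \<comment> \<open>A shift by s/Q costs \<open>s\<close> in the first and Lip s in the second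
    approximation, together \<phi>/4, while \<phi>/2 is already spent at \<open>p\<close>.\<close>
  define s where "s = \<phi> / (4 * (1 + Lip))"
  have s: "0 < s" "Lip * s + s = \<phi> / 4"
  proof -
    have "A * (\<phi> / (4 * A)) = \<phi> / 4" if "A \<noteq> 0" for A using that by simp
    moreover have "1 + Lip \<noteq> 0" using Lip_nonneg by linarith
    ultimately have "(1 + Lip) * s = \<phi> / 4" unfolding s_def by blast
    then show "Lip * s + s = \<phi> / 4" by (simp add: algebra_simps)
    show "0 < s" using \<phi> Lip_nonneg by (simp add: s_def)
  qed
  have Q: "0 < Q" using q by linarith
  have ls: "0 \<le> Lip * s" using Lip_nonneg s by simp
  have qx: "q * \<bar>x - p\<bar> \<le> s"
  proof -
    have "q * \<bar>x - p\<bar> \<le> Q * (s / Q)" using q xp(3) Q by (intro mult_mono) (auto simp: s_def)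
    then show ?thesis using Q by simp
  qed
  have "q * x - p1 = q * (x - p)" using q by (simp add: p(1) field_simps)
  then have "\<bar>q * x - p1\<bar> \<le> s" using qx q by (simp add: abs_mult)
  then show "dist_nearest_int (q * x) < \<phi>"
    using dist_nearest_int_le[of "q * x" p1] s ls \<phi> by linarith
  have "\<bar>q * (f x - f p)\<bar> \<le> q * (Lip * \<bar>x - p\<bar>)"
    unfolding abs_mult using f_lip[OF xp(2,1)] q by (intro mult_mono) auto
  also have "\<dots> = Lip * (q * \<bar>x - p\<bar>)" by simp
  also have "\<dots> \<le> Lip * s" using qx Lip_nonneg by (rule mult_left_mono)
  finally have "\<bar>q * f x - q * f p\<bar> \<le> Lip * s" by (simp add: right_diff_distrib)
  then show "dist_nearest_int (q * f x) < \<phi>"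
    using dist_nearest_int_le[of "q * f x" p2] p(2) s \<phi> by linarith
qed

theorem divergence:
  fixes \<psi> :: "nat \<Rightarrow> real"
  assumes pos: "\<And>q. 1 \<le> q \<Longrightarrow> 0 < \<psi> q" and anti: "antimono_on {1..} \<psi>"
    and div: "\<not> summable (\<lambda>q. (\<psi> (Suc q))\<^sup>2)"
  shows "negligible ({u..v} - simult_approx_set {u..v} f \<psi>)"
proof -
  define cs where "cs = 1 / (4 * (1 + Lip))"
  have cs: "0 < cs" "cs \<le> 1" using Lip_nonneg by (auto simp: cs_def field_simps)
  define ck where "ck = cs * kap"
  have ck: "0 < ck" "ck \<le> 1" using cs kap by (auto simp: ck_def intro: mult_le_one)
  have Sm: "simult_approx_set {u..v} f \<psi> \<in> sets lebesgue" by (rule sets_simult_approx_set[OF cont_f])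
  \<comment> \<open>The cap keeps Q \<phi>^2 \<le> 1, whence the neighbourhoods formed at one level
    are disjoint.\<close>
  define \<phi> where "\<phi> n = min (\<psi> (2 ^ n)) ((2 ^ n) powr (-1/2))" for n :: nat
  have \<psi>2: "0 < \<psi> (2 ^ n)" for n :: nat by (rule pos) simp
  have \<phi>p: "0 < \<phi> n" for n using \<psi>2[of n] by (simp add: \<phi>_def)
  have \<phi>mono: "\<phi> m \<le> \<phi> n" if "n \<le> m" for n m
  proof -
    have "\<psi> (2 ^ m) \<le> \<psi> (2 ^ n)" using anti that by (auto simp: monotone_on_def power_increasing)
    moreover have "((2::real) ^ m) powr (-1/2) \<le> (2 ^ n) powr (-1/2)"
      using that by (intro powr_mono2') (auto simp: power_increasing)
    ultimately show ?thesis unfolding \<phi>_def by (rule min.mono)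
  qed
  have Q\<phi>: "2 ^ n * (\<phi> n)\<^sup>2 \<le> 1" for n
  proof -
    have "(\<phi> n)\<^sup>2 \<le> ((2 ^ n) powr (-1/2))\<^sup>2" using \<phi>p[of n] by (intro power_mono) (auto simp: \<phi>_def)
    also have "\<dots> = (2 ^ n) powr (-1)" by (simp add: power2_eq_square powr_add[symmetric])
    also have "\<dots> = 1 / 2 ^ n" by (simp add: powr_minus_divide)
    finally show ?thesis by (simp add: field_simps)
  qed
  show ?thesis
  proof (rule full_measure_of_uniform_proportion[OF uv Sm])
    \<comment> \<open>\<open>kochen_stone\<close> will be applied with a = ck / 80 * L and b = ck *
      L; its bound a^2 / (5 b) is linear in L, so the proportion is the same for every
      interval.\<close>
    show "0 < (ck / 80)\<^sup>2 / (5 * ck)" using ck by simp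
    fix l r assume lr: "u \<le> l" "l < r" "r \<le> v"
    define L where "L = r - l"
    have L: "0 < L" using lr by (simp add: L_def)
    have e1: "\<forall>\<^sub>F Q in at_top. 1 / Q \<le> L / 8" using L by real_asymp
    have e2: "\<forall>\<^sub>F Q in at_top. K \<le> Q powr (7/5)" for K :: real by real_asymp
    have "\<forall>\<^sub>F n in sequentially. (\<forall>\<phi>. (2 ^ n) powr (-3/5) \<le> \<phi> \<longrightarrow> \<phi> \<le> (2 ^ n) powr (-1/2) \<longrightarrow> (\<exists>P. well_spaced l r (2 ^ n) \<phi> P))
        \<and> 1 / 2 ^ n \<le> L / 8 \<and> 10 / (kap * L) \<le> (2 ^ n) powr (7/5)"
      by (rule eventually_pow2, intro eventually_conj ubiquity_level[OF lr] e1 e2)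
    then obtain n0 where n0: "\<And>n \<phi>. \<lbrakk>n0 \<le> n; (2 ^ n) powr (-3/5) \<le> \<phi>; \<phi> \<le> (2 ^ n) powr (-1/2)\<rbrakk> \<Longrightarrow> \<exists>P. well_spaced l r (2 ^ n) \<phi> P"
      "\<And>n. n0 \<le> n \<Longrightarrow> 1 / 2 ^ n \<le> L / 8" "\<And>n. n0 \<le> n \<Longrightarrow> 10 / (kap * L) \<le> (2 ^ n) powr (7/5)"
      unfolding eventually_sequentially by blast
    \<comment> \<open>Only levels with \<psi> \<ge> Q^(-3/5) are used, the range in which
      \<open>ubiquity_level\<close> supplies points.\<close>
    define act where "act n \<longleftrightarrow> n0 \<le> n \<and> (2 ^ n) powr (-3/5) \<le> \<psi> (2 ^ n)" for n :: nat
    have \<phi>act: "(2 ^ n) powr (-3/5) \<le> \<phi> n" if "act n" for n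
    proof -
      have "((2::real) ^ n) powr (-3/5) \<le> (2 ^ n) powr (-1/2)" by (intro powr_mono) auto
      then show ?thesis using that by (simp add: act_def \<phi>_def)
    qed
    have "\<exists>P. well_spaced l r (2 ^ n) (\<phi> n) P" if "act n" for n
      using n0(1)[of n "\<phi> n"] \<phi>act[OF that] that by (simp add: act_def \<phi>_def)
    then obtain P where P: "\<And>n. act n \<Longrightarrow> well_spaced l r (2 ^ n) (\<phi> n) (P n)" by metis
    define s where "s n = cs * \<phi> n / 2 ^ n" for n
    define \<rho> where "\<rho> n = 10 / (kap * (2 ^ n)\<^sup>2 * \<phi> n)" for n :: nat
    define w where "w n = (if act n then 2 ^ n * (\<phi> n)\<^sup>2 else 0)" for n
    define E where "E n = (if act n then (\<Union>p\<in>P n. {p - s n..p + s n}) else {})" for n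
    have sp: "0 < s n" and \<rho>p: "0 < \<rho> n" for n using cs kap \<phi>p[of n] by (auto simp: s_def \<rho>_def)
    \<comment> \<open>Up to constants this ratio is the proportion of the interval covered at level
      \<open>n\<close>; it is a multiple of the term of the condensed series.\<close>
    have s\<rho>: "s n / \<rho> n = ck / 10 * (2 ^ n * (\<phi> n)\<^sup>2)" for n
      using \<phi>p[of n] kap by (simp add: s_def \<rho>_def ck_def power2_eq_square)
    have s\<rho>m: "s m / \<rho> n \<le> ck / 10 * ((1/2) ^ (m - n) * (2 ^ n * (\<phi> n)\<^sup>2))" if "n \<le> m" for n m
    proof -
      have "s m / \<rho> n = ck / 10 * (2 ^ n / 2 ^ m * (2 ^ n * (\<phi> n * \<phi> m)))"
        using \<phi>p[of n] kap by (simp add: s_def \<rho>_def ck_def power2_eq_square mult_ac)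
      also have "(2::real) ^ n / 2 ^ m = (1/2) ^ (m - n)"
        using that by (simp add: power_diff power_one_over field_simps)
      also have "ck / 10 * ((1/2) ^ (m - n) * (2 ^ n * (\<phi> n * \<phi> m))) \<le> ck / 10 * ((1/2) ^ (m - n) * (2 ^ n * (\<phi> n)\<^sup>2))"
        using ck \<phi>mono[OF that] \<phi>p[of n] by (intro mult_left_mono) (auto simp: power2_eq_square)
      finally show ?thesis .
    qed
    have smono: "s m \<le> s n" if "n \<le> m" for n m
      unfolding s_def using \<phi>mono[OF that] \<phi>p[of n] \<phi>p[of m] cs that
      by (intro frac_le mult_left_mono) (auto simp: power_increasing)
    have finP: "finite (P n)" and Psub: "P n \<subseteq> {l + L / 8..r - L / 8}" 
      and Psep: "\<And>p p'. p \<in> P n \<Longrightarrow> p' \<in> P n \<Longrightarrow> p \<noteq> p' \<Longrightarrow> \<rho> n \<le> \<bar>p - p'\<bar>"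
      and Pcard: "L \<le> 16 * \<rho> n * card (P n)" if "act n" for n
      using P[OF that] unfolding well_spaced_def L_def[symmetric] \<rho>_def[symmetric] by blast+
    have sL: "s n \<le> L / 8" if "act n" for n
    proof -
      have "\<phi> n \<le> 1"
      proof -
        have "((2::real) ^ n) powr (-1/2) \<le> (2 ^ n) powr 0" by (intro powr_mono) auto
        then show ?thesis by (simp add: \<phi>_def min_le_iff_disj)
      qed
      then have "cs * \<phi> n \<le> 1" using cs \<phi>p[of n] by (intro mult_le_one) auto
      then have "s n \<le> 1 / 2 ^ n" unfolding s_def by (intro divide_right_mono) auto
      then show ?thesis using n0(2)[of n] that by (auto simp: act_def)
    qed
    have \<rho>L: "\<rho> n \<le> L" if "act n" for n
    proof -
      have "(2::real) ^ n * ((2 ^ n) * (2 ^ n) powr (-3/5)) = (2 ^ n) powr (7/5)" by (simp add: powr_mult_base)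
      then have "(2 ^ n) powr (7/5) \<le> 2 ^ n * (2 ^ n * \<phi> n)"
        using \<phi>act[OF that] by (metis mult_left_mono zero_le_power zero_le_numeral)
      then have "10 / (kap * L) \<le> (2 ^ n)\<^sup>2 * \<phi> n" using n0(3)[of n] that by (auto simp: act_def power2_eq_square)
      then have "10 \<le> (2 ^ n)\<^sup>2 * \<phi> n * (kap * L)" using kap L by (simp add: pos_divide_le_eq)
      then have "10 \<le> L * (kap * (2 ^ n)\<^sup>2 * \<phi> n)" by (simp add: mult_ac)
      moreover have "0 < kap * (2 ^ n)\<^sup>2 * \<phi> n" using kap \<phi>p[of n] by simp
      ultimately show ?thesis unfolding \<rho>_def by (simp only: pos_divide_le_eq)
    qed
    have Pup: "real (card (P n)) \<le> 2 * L / \<rho> n" if "act n" for n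
      unfolding L_def by (rule well_spaced_card_le[OF P[OF that] lr(2) _ \<rho>p \<rho>L[OF that, unfolded L_def]]) (simp add: \<rho>_def)
    have Em: "E n \<in> lmeasurable" for n
    proof (cases "act n")
      case True
      then show ?thesis unfolding E_def using finP[OF True] by (auto intro!: fmeasurable.finite_UN)
    qed (simp add: E_def)
    have Esub: "E n \<subseteq> {l..r}" for n
    proof
      fix x assume "x \<in> E n"
      then obtain p where a: "act n" and p: "p \<in> P n" "p - s n \<le> x" "x \<le> p + s n"
        by (auto simp: E_def split: if_splits)
      then show "x \<in> {l..r}" using Psub[OF a] sL[OF a] by force
    qed
    have w0: "0 \<le> w n" for n by (simp add: w_def)
    have low: "(ck / 80 * L) * w n \<le> measure lebesgue (E n)" for n
    proof (cases "act n")
      case a: True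
      have s2: "2 * s n < \<rho> n"
      proof -
        have "ck * (2 ^ n * (\<phi> n)\<^sup>2) \<le> 1 * 1" using ck Q\<phi>[of n] by (intro mult_mono) auto
        then have "s n / \<rho> n \<le> 1 / 10" unfolding s\<rho> by simp
        then have "10 * s n \<le> \<rho> n" using \<rho>p[of n] by (simp add: field_simps)
        then show ?thesis using sp[of n] by linarith
      qed
      have "measure lebesgue (E n) = (\<Sum>p\<in>P n. measure lebesgue {p - s n..p + s n})"
        unfolding E_def if_P[OF a]
      proof (rule measure_finite_Union[OF finP[OF a]])
        show "disjoint_family_on (\<lambda>p. {p - s n..p + s n}) (P n)"
          unfolding disjoint_family_on_def
        proof (intro ballI impI)
          fix p p' assume h: "p \<in> P n" "p' \<in> P n" "p \<noteq> p'"
          have "2 * s n < \<bar>p - p'\<bar>" using Psep[OF a h] s2 by linarith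
          then show "{p - s n..p + s n} \<inter> {p' - s n..p' + s n} = {}" by auto
        qed
        show "emeasure lebesgue {p - s n..p + s n} \<noteq> \<infinity>" for p
          using fmeasurableD2[of "{p - s n..p + s n}" lebesgue] by simp
      qed auto
      also have "\<dots> = card (P n) * (2 * s n)" using sp[of n] by simp
      finally have mE: "measure lebesgue (E n) = card (P n) * (2 * s n)" .
      have "(ck / 80 * L) * w n = L * (s n / \<rho> n) / 8" by (simp add: s\<rho> w_def a)
      also have "\<dots> \<le> (16 * \<rho> n * card (P n)) * (s n / \<rho> n) / 8"
        using Pcard[OF a] sp[of n] \<rho>p[of n] by (intro divide_right_mono mult_right_mono) auto
      also have "\<dots> = measure lebesgue (E n)" using \<rho>p[of n] by (simp add: mE)
      finally show ?thesis .
    qed (simp add: w_def)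
    have up: "measure lebesgue (E n \<inter> E m) \<le> (ck * L) * (w n * w m + (1/2) ^ (m - n) * w n)" if nm: "n \<le> m" for n m
    proof (cases "act n \<and> act m")
      case True
      then have a: "act n" "act m" by auto
      \<comment> \<open>Since s m \<le> s n, the level-m intervals meeting a given level-n interval
        have centres within 2 s n of its centre; separation allows at most 4 s n / \<rho> m + 1 of
        them. The summand 1 is the source of the geometric term.\<close>
      have one: "measure lebesgue ({p - s n..p + s n} \<inter> E m) \<le> (4 * s n / \<rho> m + 1) * (2 * s m)" for p
      proof -
        define P' where "P' = {p' \<in> P m. p' \<in> {p - 2 * s n..p + 2 * s n}}"
        have fin': "finite P'" using finP[OF a(2)] by (simp add: P'_def)
        have card': "real (card P') \<le> 4 * s n / \<rho> m + 1"
        proof -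
          have "real (card P') \<le> ((p + 2 * s n) - (p - 2 * s n)) / \<rho> m + 1"
            by (rule card_separated_le[OF fin' \<rho>p]) (use Psep[OF a(2)] sp[of n] in \<open>auto simp: P'_def\<close>)
          then show ?thesis by simp
        qed
        have sub: "{p - s n..p + s n} \<inter> E m \<subseteq> (\<Union>p'\<in>P'. {p' - s m..p' + s m})"
        proof
          fix x assume x: "x \<in> {p - s n..p + s n} \<inter> E m"
          then obtain p' where p': "p' \<in> P m" "x \<in> {p' - s m..p' + s m}" unfolding E_def if_P[OF a(2)] by blast
          have "p' \<in> {p - 2 * s n..p + 2 * s n}" using x p'(2) smono[OF nm] by auto
          then show "x \<in> (\<Union>p'\<in>P'. {p' - s m..p' + s m})" using p' by (auto simp: P'_def)
        qed
        have "measure lebesgue ({p - s n..p + s n} \<inter> E m) \<le> measure lebesgue (\<Union>p'\<in>P'. {p' - s m..p' + s m})"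
        proof (rule measure_mono_fmeasurable[OF sub])
          show "{p - s n..p + s n} \<inter> E m \<in> sets lebesgue" using Em[of m] by auto
          show "(\<Union>p'\<in>P'. {p' - s m..p' + s m}) \<in> lmeasurable" by (rule fmeasurable.finite_UN[OF fin']) simp
        qed
        also have "\<dots> \<le> (\<Sum>p'\<in>P'. measure lebesgue {p' - s m..p' + s m})" by (rule measure_UNION_le[OF fin']) simp
        also have "\<dots> = card P' * (2 * s m)" using sp[of m] by simp
        also have "\<dots> \<le> (4 * s n / \<rho> m + 1) * (2 * s m)" using card' sp[of m] by (intro mult_right_mono) auto
        finally show ?thesis .
      qed
      have "measure lebesgue (E n \<inter> E m) = measure lebesgue (\<Union>p\<in>P n. {p - s n..p + s n} \<inter> E m)"
        using a(1) by (simp add: E_def[of n] Int_commute)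
      also have "\<dots> \<le> (\<Sum>p\<in>P n. measure lebesgue ({p - s n..p + s n} \<inter> E m))"
        by (rule measure_UNION_le[OF finP[OF a(1)]]) (use Em[of m] in auto)
      also have "\<dots> \<le> (\<Sum>p\<in>P n. (4 * s n / \<rho> m + 1) * (2 * s m))" by (intro sum_mono one)
      also have "\<dots> = card (P n) * ((4 * s n / \<rho> m + 1) * (2 * s m))" by simp
      also have "\<dots> \<le> (2 * L / \<rho> n) * ((4 * s n / \<rho> m + 1) * (2 * s m))"
        using Pup[OF a(1)] sp[of n] sp[of m] \<rho>p[of m] by (intro mult_right_mono) auto
      also have "\<dots> = L * (16 * (s n / \<rho> n) * (s m / \<rho> m) + 4 * (s m / \<rho> n))"
        using \<rho>p[of n] \<rho>p[of m] by (simp add: field_simps)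
      also have "\<dots> \<le> L * (ck * (w n * w m) + ck * ((1/2) ^ (m - n) * w n))"
      proof (intro mult_left_mono add_mono)
        have "16 * (s n / \<rho> n) * (s m / \<rho> m) = (16/100 * ck) * (ck * (w n * w m))"
          using a by (simp add: s\<rho> w_def)
        also have "\<dots> \<le> 1 * (ck * (w n * w m))" using ck w0 by (intro mult_right_mono) auto
        finally show "16 * (s n / \<rho> n) * (s m / \<rho> m) \<le> ck * (w n * w m)" by simp
        have "4 * (s m / \<rho> n) \<le> 4 * (ck / 10 * ((1/2) ^ (m - n) * w n))" 
          unfolding w_def if_P[OF a(1)] by (rule mult_left_mono[OF s\<rho>m[OF nm]]) simp
        also have "\<dots> = 2/5 * (ck * ((1/2) ^ (m - n) * w n))" by simp
        also have "\<dots> \<le> 1 * (ck * ((1/2) ^ (m - n) * w n))" using ck w0 by (intro mult_right_mono) auto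
        finally show "4 * (s m / \<rho> n) \<le> ck * ((1/2) ^ (m - n) * w n)" by simp
      qed (use L in auto)
      finally show ?thesis by (simp add: algebra_simps)
    next
      case False
      then have "E n \<inter> E m = {}" by (auto simp: E_def)
      then show ?thesis using ck L w0 by simp
    qed
    have geo: "(2 ^ n) powr a = (2 powr a) ^ n" for n :: nat and a :: real
      by (simp add: powr_power powr_realpow[symmetric] powr_powr mult.commute)
    \<comment> \<open>If \<open>w\<close> were summable, w n < 1 would hold eventually, whereas w n
      = 1 on an active level where the cap is attained. So \<phi> = \<psi> on late active levels,
      and late inactive ones contribute at most 2^(-n/5) each.\<close>
    have wdiv: "\<not> summable w"
    proof
      assume sw: "summable w"
      have "\<forall>\<^sub>F n in sequentially. w n < 1" using summable_LIMSEQ_zero[OF sw] by (rule order_tendstoD) simp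
      then obtain n1 where n1: "\<And>n. n1 \<le> n \<Longrightarrow> w n < 1" unfolding eventually_sequentially by blast
      have "summable (\<lambda>n. 2 ^ n * (\<psi> (2 ^ n))\<^sup>2)"
      proof (rule summable_comparison_test'[of "\<lambda>n. w n + (2 powr (-1/5)) ^ n" "max n0 n1"])
        show "summable (\<lambda>n. w n + (2 powr (-1/5)) ^ n)"
          using sw by (intro summable_add summable_geometric) (auto simp: powr_less_one)
        fix n assume n: "max n0 n1 \<le> n"
        have "2 ^ n * (\<psi> (2 ^ n))\<^sup>2 \<le> w n + (2 powr (-1/5)) ^ n"
        proof (cases "act n")
          case True
          have "\<phi> n = \<psi> (2 ^ n)"
          proof (rule ccontr)
            assume "\<phi> n \<noteq> \<psi> (2 ^ n)"
            then have e: "\<phi> n = (2 ^ n) powr (-1/2)" by (auto simp: \<phi>_def min_def split: if_splits)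
            have "w n = 2 ^ n * ((2 ^ n) powr (-1/2) * (2 ^ n) powr (-1/2))" using True by (simp add: w_def e power2_eq_square)
            also have "\<dots> = 1" by (simp add: powr_add[symmetric] powr_minus_divide)
            finally show False using n1[of n] n by simp
          qed
          then show ?thesis using True by (simp add: w_def)
        next
          case False
          then have "\<psi> (2 ^ n) \<le> (2 ^ n) powr (-3/5)" using n by (simp add: act_def)
          then have "2 ^ n * (\<psi> (2 ^ n))\<^sup>2 \<le> 2 ^ n * ((2 ^ n) powr (-3/5))\<^sup>2"
            using \<psi>2[of n] by (intro mult_left_mono power_mono) auto
          also have "\<dots> = (2 ^ n) powr (-1/5)" by (simp add: power2_eq_square powr_add[symmetric] powr_mult_base)
          finally show ?thesis using w0[of n] by (simp add: geo)
        qed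
        then show "norm (2 ^ n * (\<psi> (2 ^ n))\<^sup>2) \<le> w n + (2 powr (-1/5)) ^ n" by simp
      qed
      then show False using div summable_condensed[OF pos anti] by blast
    qed
    have ckL: "0 < ck / 80 * L" "0 < ck * L" using ck L by auto
    have ks: "limsup E \<in> lmeasurable" "(ck / 80 * L)\<^sup>2 / (5 * (ck * L)) \<le> measure lebesgue (limsup E)"
      by (rule kochen_stone[OF Em Esub w0 wdiv ckL low up]; assumption)+
    have sub: "limsup E \<subseteq> simult_approx_set {u..v} f \<psi> \<inter> {l..r}"
    proof
      fix x assume "x \<in> limsup E"
      then have x: "\<And>N. \<exists>n\<ge>N. x \<in> E n" by (auto simp: limsup_INF_SUP)
      then have xlr: "x \<in> {l..r}" using Esub by blast
      then have xuv: "x \<in> {u..v}" using lr by auto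
      have "infinite {q::nat. q \<ge> 1 \<and> max (dist_nearest_int (real q * x)) (dist_nearest_int (real q * f x)) < \<psi> q}"
        unfolding infinite_nat_iff_unbounded_le
      proof
        fix M :: nat
        \<comment> \<open>Since q > kap 2^n, a high level forces the denominator above
          \<open>M\<close>; this is why infinitely many different denominators occur.\<close>
        obtain N where N: "real M / kap < 2 ^ N" using real_arch_pow[of 2 "real M / kap"] by auto
        obtain n where n: "N \<le> n" "x \<in> E n" using x by blast
        then obtain p where a: "act n" and p: "p \<in> P n" "\<bar>x - p\<bar> \<le> s n"
          by (force simp: E_def split: if_splits)
        have "\<exists>(q::int) (p1::int) (p2::int). 1 \<le> real_of_int q \<and> kap * 2 ^ n < q \<and> real_of_int q \<le> 2 ^ n \<and> p = p1 / q \<and> \<bar>q * f p - p2\<bar> \<le> \<phi> n / 2"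
          using P[OF a] p(1) unfolding well_spaced_def by blast
        then obtain q p1 p2 :: int where q: "1 \<le> real_of_int q" "kap * 2 ^ n < q" "real_of_int q \<le> 2 ^ n" "p = p1 / q" "\<bar>q * f p - p2\<bar> \<le> \<phi> n / 2"
          by blast
        have q1: "1 \<le> q" using q(1) by simp
        have "p \<in> {l + L / 8..r - L / 8}" using Psub[OF a] p(1) by blast
        then have puv: "p \<in> {u..v}" using lr L by auto
        have xs: "\<bar>x - p\<bar> \<le> \<phi> n / (4 * (1 + Lip)) / 2 ^ n" using p(2) by (simp add: s_def cs_def)
        note ap = near_rational_approximates[OF q1 q(3,4,5) xuv puv xs \<phi>p]
        define k where "k = nat q"
        have k: "real k = q" using q1 by (simp add: k_def)
        have "k \<le> 2 ^ n"
        proof -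
          have "real k \<le> real (2 ^ n)" using q(3) k by simp
          then show ?thesis by (simp only: of_nat_le_iff)
        qed
        moreover have k1: "1 \<le> k" using q1 by (simp add: k_def)
        ultimately have "\<psi> (2 ^ n) \<le> \<psi> k" using anti by (auto simp: monotone_on_def)
        then have "\<phi> n \<le> \<psi> k" by (simp add: \<phi>_def)
        then have "max (dist_nearest_int (real k * x)) (dist_nearest_int (real k * f x)) < \<psi> k"
          using ap unfolding k by simp
        moreover have "M \<le> k"
        proof -
          have "(2::real) ^ N \<le> 2 ^ n" using n(1) by (intro power_increasing) auto
          then have "real M / kap < 2 ^ n" using N by linarith
          then have "real M < kap * 2 ^ n" using kap by (simp add: field_simps)
          then have "real M < real k" using q(2) k by simp
          then show ?thesis by simp
        qed
        ultimately show "\<exists>q\<ge>M. q \<in> {q::nat. q \<ge> 1 \<and> max (dist_nearest_int (real q * x)) (dist_nearest_int (real q * f x)) < \<psi> q}"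
          using k1 by (intro exI[of _ k]) simp
      qed
      then show "x \<in> simult_approx_set {u..v} f \<psi> \<inter> {l..r}" using xlr xuv by (simp add: simult_approx_set_def)
    qed
    have "(ck / 80)\<^sup>2 / (5 * ck) * (r - l) = (ck / 80 * L)\<^sup>2 / (5 * (ck * L))"
      using L ck by (simp add: L_def[symmetric] power2_eq_square)
    also have "\<dots> \<le> measure lebesgue (limsup E)" by (rule ks(2))
    also have "\<dots> \<le> measure lebesgue (simult_approx_set {u..v} f \<psi> \<inter> {l..r})"
    proof (rule measure_mono_fmeasurable[OF sub fmeasurableD[OF ks(1)]])
      show "simult_approx_set {u..v} f \<psi> \<inter> {l..r} \<in> lmeasurable"
        by (rule fmeasurableI2[of "{l..r}"]) (use Sm in auto)
    qed
    finally show "(ck / 80)\<^sup>2 / (5 * ck) * (r - l) \<le> measure lebesgue (simult_approx_set {u..v} f \<psi> \<inter> {l..r})" .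
  qed
qed

end

subsection \<open>From local to global\<close>

lemma mvt_within:
  fixes g g' :: "real \<Rightarrow> real"
  assumes d: "\<And>t. t \<in> {a..b} \<Longrightarrow> (g has_real_derivative g' t) (at t within {a..b})"
    and xy: "a \<le> x" "x < y" "y \<le> b"
  obtains z where "x < z" "z < y" "g y - g x = g' z * (y - x)"
proof -
  have "\<exists>z\<in>{x<..<y}. g y - g x = (*) (g' z) (y - x)"
  proof (rule mvt_simple[OF xy(2)])
    fix t assume "x \<le> t" "t \<le> y"
    then have "(g has_real_derivative g' t) (at t within {x..y})"
      using xy by (intro DERIV_subset[OF d]) auto
    then show "(g has_derivative (*) (g' t)) (at t within {x..y})"
      by (simp add: has_field_derivative_def)
  qed
  then show thesis using that by auto
qed

lemma taylor_lower_C2: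
  fixes h h' h'' :: "real \<Rightarrow> real"
  assumes d1: "\<And>t. t \<in> {a..b} \<Longrightarrow> (h has_real_derivative h' t) (at t within {a..b})"
    and d2: "\<And>t. t \<in> {a..b} \<Longrightarrow> (h' has_real_derivative h'' t) (at t within {a..b})"
    and low: "\<And>t. t \<in> {a..b} \<Longrightarrow> c \<le> h'' t"
  shows "\<lbrakk>x \<in> {a..b}; y \<in> {a..b}; x \<le> y\<rbrakk> \<Longrightarrow> c * (y - x) \<le> h' y - h' x"
    "\<lbrakk>x \<in> {a..b}; y \<in> {a..b}\<rbrakk> \<Longrightarrow> c / 2 * (y - x)\<^sup>2 \<le> h y - h x - h' x * (y - x)"
proof -
  have slope: "c * (y - x) \<le> h' y - h' x" if h: "x \<in> {a..b}" "y \<in> {a..b}" "x \<le> y" for x y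
  proof (cases "x = y")
    case False
    then obtain z where z: "x < z" "z < y" "h' y - h' x = h'' z * (y - x)"
      using mvt_within[of a b h' h'' x y] d2 h by auto
    have "z \<in> {a..b}" using z h by auto
    then show ?thesis unfolding z(3) using low h by (intro mult_right_mono) auto
  qed simp
  show "c * (y - x) \<le> h' y - h' x" if "x \<in> {a..b}" "y \<in> {a..b}" "x \<le> y"
    by (rule slope[OF that])
  assume x: "x \<in> {a..b}" and y: "y \<in> {a..b}"
  \<comment> \<open>\<open>p\<close> vanishes at \<open>x\<close>; by \<open>slope\<close> its
    derivative is nonnegative to the right of \<open>x\<close> and nonpositive to the left.\<close>
  define p where "p t = h t - h x - h' x * (t - x) - c / 2 * (t - x)\<^sup>2" for t
  define p' where "p' t = h' t - h' x - c * (t - x)" for t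
  have dp: "(p has_real_derivative p' t) (at t within {a..b})" if "t \<in> {a..b}" for t
    unfolding p_def p'_def by (rule derivative_eq_intros d1[OF that] refl | simp)+
  consider "x = y" | "x < y" | "y < x" by linarith
  then have "0 \<le> p y"
  proof cases
    case 1 then show ?thesis by (simp add: p_def)
  next
    case 2
    then obtain z where z: "x < z" "z < y" "p y - p x = p' z * (y - x)"
      using mvt_within[of a b p p' x y] dp x y by auto
    have "0 \<le> p' z" unfolding p'_def using slope[of x z] x y z by auto
    then have "0 \<le> p y - p x" unfolding z(3) using 2 by simp
    then show ?thesis by (simp add: p_def)
  next
    case 3
    then obtain z where z: "y < z" "z < x" "p x - p y = p' z * (x - y)"
      using mvt_within[of a b p p' y x] dp x y by auto
    have "p' z \<le> 0" unfolding p'_def using slope[of z x] x y z by (auto simp: algebra_simps)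
    then have "p x - p y \<le> 0" unfolding z(3) using 3 by (intro mult_nonpos_nonneg) auto
    then show ?thesis by (simp add: p_def)
  qed
  then show "c / 2 * (y - x)\<^sup>2 \<le> h y - h x - h' x * (y - x)" by (simp add: p_def)
qed

lemma taylor_upper_C2:
  fixes h h' h'' :: "real \<Rightarrow> real"
  assumes d1: "\<And>t. t \<in> {a..b} \<Longrightarrow> (h has_real_derivative h' t) (at t within {a..b})"
    and d2: "\<And>t. t \<in> {a..b} \<Longrightarrow> (h' has_real_derivative h'' t) (at t within {a..b})"
    and up: "\<And>t. t \<in> {a..b} \<Longrightarrow> h'' t \<le> c"
  shows "\<lbrakk>x \<in> {a..b}; y \<in> {a..b}; x \<le> y\<rbrakk> \<Longrightarrow> h' y - h' x \<le> c * (y - x)"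
    "\<lbrakk>x \<in> {a..b}; y \<in> {a..b}\<rbrakk> \<Longrightarrow> h y - h x - h' x * (y - x) \<le> c / 2 * (y - x)\<^sup>2"
proof -
  have d1': "((\<lambda>t. - h t) has_real_derivative - h' t) (at t within {a..b})" if "t \<in> {a..b}" for t
    by (rule DERIV_minus[OF d1[OF that]])
  have d2': "((\<lambda>t. - h' t) has_real_derivative - h'' t) (at t within {a..b})" if "t \<in> {a..b}" for t
    by (rule DERIV_minus[OF d2[OF that]])
  have low: "- c \<le> - h'' t" if "t \<in> {a..b}" for t using up[OF that] by simp
  note * = taylor_lower_C2[of a b "\<lambda>t. - h t" "\<lambda>t. - h' t" "\<lambda>t. - h'' t" "- c", OF d1' d2' low]
  show "h' y - h' x \<le> c * (y - x)" if "x \<in> {a..b}" "y \<in> {a..b}" "x \<le> y"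
    using *(1)[OF _ _ _ that] by simp
  show "h y - h x - h' x * (y - x) \<le> c / 2 * (y - x)\<^sup>2" if "x \<in> {a..b}" "y \<in> {a..b}"
    using *(2)[OF _ _ _ that] by simp
qed

text \<open>A uniform limit of curved functions need not be \<open>C\<^sup>2\<close>, but the derivatives converge
  pointwise and all the inequalities pass to the limit.\<close>

lemma curved_limit:
  fixes f :: "real \<Rightarrow> real"
  assumes ab: "a < b" and c: "0 < c1" "c1 \<le> c2"
    and app: "\<And>\<epsilon>. 0 < \<epsilon> \<Longrightarrow> \<exists>h D. curved h D a b c1 c2 \<and> (\<forall>x\<in>{a..b}. \<bar>h x - f x\<bar> \<le> \<epsilon>)"
  shows "\<exists>D. curved f D a b c1 c2"
proof -
  have "\<exists>h D. curved h D a b c1 c2 \<and> (\<forall>x\<in>{a..b}. \<bar>h x - f x\<bar> \<le> 1 / real (Suc n))" for n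
    by (rule app) simp
  then obtain h D where hD: "\<And>n. curved (h n) (D n) a b c1 c2" 
    and hf: "\<And>n x. x \<in> {a..b} \<Longrightarrow> \<bar>h n x - f x\<bar> \<le> 1 / real (Suc n)"
    by metis
  have inv: "(\<lambda>n. 1 / real (Suc n)) \<longlonglongrightarrow> 0" using LIMSEQ_inverse_real_of_nat by (simp add: inverse_eq_divide)
  have hlim: "(\<lambda>n. h n x) \<longlonglongrightarrow> f x" if "x \<in> {a..b}" for x
  proof (rule LIMSEQ_I)
    fix e :: real assume "0 < e"
    then obtain N where N: "\<And>n. N \<le> n \<Longrightarrow> 1 / real (Suc n) < e"
      using order_tendstoD(2)[OF inv] unfolding eventually_sequentially by blast
    have "norm (h n x - f x) < e" if "N \<le> n" for n using N[OF that] hf[OF \<open>x \<in> {a..b}\<close>, of n] by simp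
    then show "\<exists>no. \<forall>n\<ge>no. norm (h n x - f x) < e" by blast
  qed
  have Dconv: "convergent (\<lambda>n. D n x)" if x: "x \<in> {a..b}" for x
  proof (rule Cauchy_convergent, rule CauchyI)
    fix e :: real assume e: "0 < e"
    have c2: "0 < c2" using c by simp
    \<comment> \<open>Step of a difference quotient: the first bound leaves room for
      \<open>y\<close> on one side of \<open>x\<close>, the second keeps the total curvature error
      c2 d^2 below e d / 4.\<close>
    define d where "d = min ((b - a) / 2) (e / (4 * c2))"
    have d: "0 < d" "d \<le> (b - a) / 2" "d \<le> e / (4 * c2)"
    proof -
      show "0 < d" using ab e c2 by (simp add: d_def)
      show "d \<le> (b - a) / 2" "d \<le> e / (4 * c2)" unfolding d_def by (rule min.cobounded1, rule min.cobounded2)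
    qed
    have "\<exists>y\<in>{a..b}. \<bar>y - x\<bar> = d"
    proof (cases "x + d \<le> b")
      case True then show ?thesis using d x by (intro bexI[of _ "x + d"]) auto
    next
      case False then show ?thesis using d x by (intro bexI[of _ "x - d"]) (auto simp: field_simps)
    qed
    then obtain y where y: "y \<in> {a..b}" "\<bar>y - x\<bar> = d" by blast
    have "0 < e * d / 16" using e d by simp
    then obtain N where N: "\<And>n. N \<le> n \<Longrightarrow> 1 / real (Suc n) < e * d / 16"
      using order_tendstoD(2)[OF inv] unfolding eventually_sequentially by blast
    have "norm (D m x - D n x) < e" if mn: "N \<le> m" "N \<le> n" for m n
    proof -
      have t: "\<bar>h n y - h n x - D n x * (y - x)\<bar> \<le> c2 / 2 * d\<^sup>2" for n
        using curved.f_taylor[OF hD x y(1), of n] y(2) by (metis power2_abs)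
      have "(D m x - D n x) * (y - x) = (h m y - f y) - (h n y - f y) - (h m x - f x) + (h n x - f x)
          - (h m y - h m x - D m x * (y - x)) + (h n y - h n x - D n x * (y - x))" by (simp add: algebra_simps)
      then have "\<bar>(D m x - D n x) * (y - x)\<bar> \<le> 1 / real (Suc m) + 1 / real (Suc n) + 1 / real (Suc m) + 1 / real (Suc n)
          + c2 / 2 * d\<^sup>2 + c2 / 2 * d\<^sup>2"
        using hf[OF y(1), of m] hf[OF y(1), of n] hf[OF x, of m] hf[OF x, of n] t[of m] t[of n] by linarith
      also have "\<dots> < e * d / 4 + c2 * d\<^sup>2" using N[OF mn(1)] N[OF mn(2)] by simp
      also have "c2 * d\<^sup>2 \<le> e * d / 4"
      proof -
        have "c2 * d \<le> e / 4" using d(3) c2 by (simp add: field_simps)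
        then have "(c2 * d) * d \<le> (e / 4) * d" using d by (intro mult_right_mono) auto
        then show ?thesis by (simp add: power2_eq_square)
      qed
      finally have "\<bar>D m x - D n x\<bar> * d < (e / 2) * d" by (simp add: abs_mult y(2) mult_ac)
      then have "\<bar>D m x - D n x\<bar> < e / 2" using d by simp
      then show ?thesis using e by simp
    qed
    then show "\<exists>M. \<forall>m\<ge>M. \<forall>n\<ge>M. norm (D m x - D n x) < e" by blast
  qed
  define D' where "D' x = lim (\<lambda>n. D n x)" for x
  have Dlim: "(\<lambda>n. D n x) \<longlonglongrightarrow> D' x" if "x \<in> {a..b}" for x
    unfolding D'_def using Dconv[OF that] by (simp add: convergent_LIMSEQ_iff)
  have "curved f D' a b c1 c2"
  proof
    fix x y assume x: "x \<in> {a..b}" and y: "y \<in> {a..b}"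
    have l1: "(\<lambda>n. D n y - D n x) \<longlonglongrightarrow> D' y - D' x" by (intro tendsto_intros Dlim x y)
    have l2: "(\<lambda>n. h n y - h n x - D n x * (y - x)) \<longlonglongrightarrow> f y - f x - D' x * (y - x)"
      by (intro tendsto_intros Dlim hlim x y)
    show "c1 / 2 * (y - x)\<^sup>2 \<le> f y - f x - D' x * (y - x)"
      by (rule LIMSEQ_le_const[OF l2]) (use curved.f_lower[OF hD x y] in blast)
    show "f y - f x - D' x * (y - x) \<le> c2 / 2 * (y - x)\<^sup>2"
      by (rule LIMSEQ_le_const2[OF l2]) (use curved.f_upper[OF hD x y] in blast)
    assume xy: "x \<le> y"
    show "c1 * (y - x) \<le> D' y - D' x"
      by (rule LIMSEQ_le_const[OF l1]) (use curved.D_lower[OF hD x y xy] in blast)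
    show "D' y - D' x \<le> c2 * (y - x)"
      by (rule LIMSEQ_le_const2[OF l1]) (use curved.D_upper[OF hD x y xy] in blast)
  qed (use ab c in auto)
  then show ?thesis by blast
qed

text \<open>The second derivative is continuous and does not vanish, so it keeps its sign on the
  interval.\<close>

lemma C2_curved_sign:
  assumes ab: "a < b" and c: "0 < c1" "c1 \<le> c2" and g: "g \<in> C2_curved {a..b} c1 c2"
  shows "(\<exists>D. curved g D a b c1 c2) \<or> (\<exists>D. curved (\<lambda>x. - g x) D a b c1 c2)"
proof -
  obtain g' g'' where d1: "\<And>x. x \<in> {a..b} \<Longrightarrow> (g has_real_derivative g' x) (at x within {a..b})"
    and d2: "\<And>x. x \<in> {a..b} \<Longrightarrow> (g' has_real_derivative g'' x) (at x within {a..b})"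
    and cont: "continuous_on {a..b} g''" and bd: "\<And>x. x \<in> {a..b} \<Longrightarrow> c1 \<le> \<bar>g'' x\<bar> \<and> \<bar>g'' x\<bar> \<le> c2"
    using g unfolding C2_curved_def by blast
  have nz: "g'' x \<noteq> 0" if "x \<in> {a..b}" for x using bd[OF that] c by auto
  have "(\<forall>x\<in>{a..b}. 0 < g'' x) \<or> (\<forall>x\<in>{a..b}. g'' x < 0)"
  proof (rule ccontr)
    assume "\<not> ?thesis"
    then obtain x y where xy: "x \<in> {a..b}" "y \<in> {a..b}" "g'' x < 0" "0 < g'' y"
      using nz by (meson linorder_neqE_linordered_idom)
    have "connected (g'' ` {a..b})" by (rule connected_continuous_image[OF cont connected_Icc])
    then have "0 \<in> g'' ` {a..b}"
      by (rule connectedD_interval[OF _ imageI[OF xy(1)] imageI[OF xy(2)]]) (use xy(3,4) in simp_all)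
    then show False using nz by auto
  qed
  then show ?thesis
  proof
    assume pos: "\<forall>x\<in>{a..b}. 0 < g'' x"
    have b1: "c1 \<le> g'' x" "g'' x \<le> c2" if "x \<in> {a..b}" for x using bd[OF that] pos that by force+
    have "curved g g' a b c1 c2"
      by unfold_locales (fact ab c | rule taylor_lower_C2[OF d1 d2 b1(1)] taylor_upper_C2[OF d1 d2 b1(2)]; assumption)+
    then show ?thesis by blast
  next
    assume neg: "\<forall>x\<in>{a..b}. g'' x < 0"
    have b1: "c1 \<le> - g'' x" "- g'' x \<le> c2" if "x \<in> {a..b}" for x using bd[OF that] neg that by force+
    have d1': "((\<lambda>t. - g t) has_real_derivative - g' t) (at t within {a..b})" if "t \<in> {a..b}" for t
      by (rule DERIV_minus[OF d1[OF that]])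
    have d2': "((\<lambda>t. - g' t) has_real_derivative - g'' t) (at t within {a..b})" if "t \<in> {a..b}" for t
      by (rule DERIV_minus[OF d2[OF that]])
    have "curved (\<lambda>x. - g x) (\<lambda>x. - g' x) a b c1 c2"
      by unfold_locales (fact ab c | rule taylor_lower_C2[OF d1' d2' b1(1)] taylor_upper_C2[OF d1' d2' b1(2)]; assumption)+
    then show ?thesis by blast
  qed
qed

text \<open>The sign of the second derivative may vary among the approximants. As approximability
  within \<epsilon> is inherited by larger \<epsilon>, one of the two signs serves for every
  \<epsilon>.\<close>

lemma curved_of_closure:
  fixes f :: "real \<Rightarrow> real"
  assumes ab: "a < b" and c: "0 < c1" "c1 \<le> c2" and f: "restrict f {a..b} \<in> C2_curved_closure {a..b} c1 c2"
  shows "(\<exists>D. curved f D a b c1 c2) \<or> (\<exists>D. curved (\<lambda>x. - f x) D a b c1 c2)"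
proof -
  let ?m = "cfunspace (top_of_set {a..b}) (euclidean_metric :: real metric)"
  interpret M: Metric_space "mspace ?m" "mdist ?m" by (rule Metric_space_mspace_mdist)
  have close: "\<exists>g\<in>C2_curved {a..b} c1 c2. \<forall>x\<in>{a..b}. \<bar>g x - f x\<bar> \<le> \<epsilon>" if e0: "0 < \<epsilon>" for \<epsilon>
  proof -
    have "restrict f {a..b} \<in> M.mtopology closure_of C2_curved {a..b} c1 c2"
      using f by (simp add: C2_curved_closure_def mtopology_of_def)
    then obtain g where g: "g \<in> C2_curved {a..b} c1 c2" "g \<in> M.mcball (restrict f {a..b}) \<epsilon>"
      using e0 unfolding M.metric_closure_of_alt by blast
    then have g': "g \<in> mspace ?m" "restrict f {a..b} \<in> mspace ?m" "mdist ?m (restrict f {a..b}) g \<le> \<epsilon>"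
      unfolding M.in_mcball by blast+
    have "\<bar>g x - f x\<bar> \<le> \<epsilon>" if "x \<in> {a..b}" for x
    proof -
      have "mdist euclidean_metric (restrict f {a..b} x) (g x) \<le> \<epsilon>"
        by (rule mdist_cfunspace_imp_mdist_le[OF g'(2,1,3)]) (use that in simp)
      then show ?thesis using that by (simp add: dist_real_def abs_minus_commute)
    qed
    then show ?thesis using g(1) by blast
  qed
  let ?P = "\<lambda>\<sigma> \<epsilon>. \<exists>h D. curved h D a b c1 c2 \<and> (\<forall>x\<in>{a..b}. \<bar>h x - \<sigma> * f x\<bar> \<le> \<epsilon>)"
  have mono: "?P \<sigma> \<epsilon>'" if "?P \<sigma> \<epsilon>" "\<epsilon> \<le> \<epsilon>'" for \<sigma> \<epsilon> \<epsilon>' using that by (meson order_trans)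
  have either: "?P 1 \<epsilon> \<or> ?P (-1) \<epsilon>" if e0: "0 < \<epsilon>" for \<epsilon>
  proof -
    obtain g where g: "g \<in> C2_curved {a..b} c1 c2" "\<And>x. x \<in> {a..b} \<Longrightarrow> \<bar>g x - f x\<bar> \<le> \<epsilon>" using close[OF e0] by blast
    from C2_curved_sign[OF ab c g(1)] show ?thesis
    proof (elim disjE exE)
      fix D assume "curved g D a b c1 c2"
      then have "?P 1 \<epsilon>" using g(2) by auto
      then show ?thesis ..
    next
      fix D assume D: "curved (\<lambda>x. - g x) D a b c1 c2"
      have "\<bar>- g x - (-1) * f x\<bar> \<le> \<epsilon>" if "x \<in> {a..b}" for x using g(2)[OF that] by linarith
      then have "?P (-1) \<epsilon>" using D by blast
      then show ?thesis ..
    qed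
  qed
  have "(\<forall>\<epsilon>>0. ?P 1 \<epsilon>) \<or> (\<forall>\<epsilon>>0. ?P (-1) \<epsilon>)"
  proof (rule ccontr)
    assume "\<not> ?thesis"
    then obtain e1 e2 where e: "0 < e1" "\<not> ?P 1 e1" "0 < e2" "\<not> ?P (-1) e2" by blast
    then have "0 < min e1 e2" by simp
    from either[OF this] show False using mono[of 1 "min e1 e2" e1] mono[of "-1" "min e1 e2" e2] e(2,4) by auto
  qed
  then show ?thesis
  proof
    assume "\<forall>\<epsilon>>0. ?P 1 \<epsilon>"
    then have "\<exists>D. curved f D a b c1 c2" by (intro curved_limit[OF ab c]) simp
    then show ?thesis ..
  next
    assume "\<forall>\<epsilon>>0. ?P (-1) \<epsilon>"
    then have "\<exists>D. curved (\<lambda>x. - f x) D a b c1 c2" by (intro curved_limit[OF ab c]) simp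
    then show ?thesis ..
  qed
qed

section \<open>Symmetries, increasing \<psi>, and assembly of the local results\<close>

lemma dist_nearest_int_minus: "dist_nearest_int (- x) = dist_nearest_int x"
proof -
  have "dist_nearest_int (- x) \<le> dist_nearest_int x" for x
  proof -
    obtain k where "dist_nearest_int x = \<bar>x - of_int k\<bar>" using dist_nearest_int_attained by blast
    moreover have "\<bar>- x - of_int (- k)\<bar> = \<bar>x - of_int k\<bar>" by simp
    ultimately show ?thesis using dist_nearest_int_le[of "- x" "- k"] by linarith
  qed
  from this[of x] this[of "- x"] show ?thesis by simp
qed

lemma simult_approx_set_minus: "simult_approx_set I (\<lambda>x. - f x) \<psi> = simult_approx_set I f \<psi>"
  unfolding simult_approx_set_def by (simp add: dist_nearest_int_minus)

lemma simult_approx_set_restrict: "J \<subseteq> I \<Longrightarrow> simult_approx_set I f \<psi> \<inter> J = simult_approx_set J f \<psi>"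
  unfolding simult_approx_set_def by auto

text \<open>An increasing \<psi> stays above \<psi> 1 > 0. A Dirichlet denominator multiplied by
  \<open>Suc M\<close> exceeds \<open>M\<close>, and its error is still below \<psi> 1 if the
  Dirichlet parameter \<open>m\<close> is large.\<close>

lemma simult_approx_set_mono:
  fixes f :: "real \<Rightarrow> real"
  assumes pos: "0 < \<psi> 1" and mono: "mono_on {1..} \<psi>"
  shows "simult_approx_set I f \<psi> = I"
proof -
  have "infinite {q::nat. q \<ge> 1 \<and> max (dist_nearest_int (real q * x)) (dist_nearest_int (real q * f x)) < \<psi> q}" for x
    unfolding infinite_nat_iff_unbounded_le
  proof
    fix M :: nat
    obtain m :: nat where m: "real (Suc M) / \<psi> 1 < real m" using reals_Archimedean2 by blast
    moreover have "0 < real (Suc M) / \<psi> 1" using pos by simp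
    ultimately have m1: "1 \<le> m" by (cases m) auto
    obtain q p1 p2 :: int where q: "1 \<le> q" "\<bar>q * x - p1\<bar> \<le> 1 / m" "\<bar>q * f x - p2 - 0 * (q * x - p1)\<bar> \<le> 1 / m"
      using dirichlet_tangent[OF m1 m1] by metis
    define k where "k = Suc M * nat q"
    have k: "real k = real (Suc M) * q" using q(1) by (simp add: k_def algebra_simps)
    have kM: "Suc M \<le> k"
    proof -
      have "1 \<le> nat q" using q(1) by simp
      then have "Suc M * 1 \<le> Suc M * nat q" by (rule mult_le_mono2)
      then show ?thesis by (simp add: k_def)
    qed
    have small: "real (Suc M) * (1 / m) < \<psi> 1" using m pos m1 by (simp add: field_simps)
    have dn: "dist_nearest_int (real k * y) < \<psi> 1" if "\<bar>q * y - p\<bar> \<le> 1 / m" for y :: real and p :: int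
    proof -
      have "\<bar>real k * y - of_int (int (Suc M) * p)\<bar> = real (Suc M) * \<bar>q * y - p\<bar>"
      proof -
        have "real k * y - of_int (int (Suc M) * p) = real (Suc M) * (q * y - p)" unfolding k by (simp add: algebra_simps)
        then show ?thesis by (simp only: abs_mult abs_of_nat)
      qed
      also have "\<dots> \<le> real (Suc M) * (1 / m)" using that by (rule mult_left_mono) simp
      finally show ?thesis using small dist_nearest_int_le[of "real k * y" "int (Suc M) * p"] by linarith
    qed
    have "\<psi> 1 \<le> \<psi> k" using mono kM by (auto simp: monotone_on_def)
    then have "max (dist_nearest_int (real k * x)) (dist_nearest_int (real k * f x)) < \<psi> k"
      using dn[OF q(2)] dn[of "f x" p2] q(3) by simp
    then show "\<exists>q\<ge>M. q \<in> {q. q \<ge> 1 \<and> max (dist_nearest_int (real q * x)) (dist_nearest_int (real q * f x)) < \<psi> q}"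
      using kM by (intro exI[of _ k]) simp
  qed
  then show ?thesis by (auto simp: simult_approx_set_def)
qed

text \<open>The Lindelof property: the open sets meeting \<open>X\<close> in a null set cover all
  points of nondegeneracy, countably many of them have the same union, and the points left over lie
  in a null set.\<close>

lemma negligible_locally:
  fixes X :: "real set"
  assumes wn: "weakly_nondegenerate {a..b} f" and X: "X \<subseteq> {a..b}"
    and loc: "\<And>x r. \<lbrakk>weakly_nondegenerate_at {a..b} f x; 0 < r; {x - r..x + r} \<subseteq> {a..b};
        (\<exists>c1 c2 D. curved f D (x - r) (x + r) c1 c2) \<or> (\<exists>c1 c2 D. curved (\<lambda>x. - f x) D (x - r) (x + r) c1 c2)\<rbrakk>
        \<Longrightarrow> negligible (X \<inter> {x - r..x + r})"
  shows "negligible X"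
proof -
  define \<F> where "\<F> = {T. open T \<and> negligible (X \<inter> T)}"
  obtain \<F>' where F': "\<F>' \<subseteq> \<F>" "countable \<F>'" "\<Union>\<F>' = \<Union>\<F>"
    using Lindelof[of \<F>] unfolding \<F>_def by blast
  have cover: "x \<in> \<Union>\<F>" if nd: "weakly_nondegenerate_at {a..b} f x" for x
  proof -
    obtain c1 c2 r where cr: "0 < c1" "c1 \<le> c2" "0 < r" "{x - r..x + r} \<subseteq> {a..b}"
      "restrict f {x - r..x + r} \<in> C2_curved_closure {x - r..x + r} c1 c2"
      using nd unfolding weakly_nondegenerate_at_def by blast
    have "x - r < x + r" using cr by simp
    from curved_of_closure[OF this cr(1,2,5)] have "negligible (X \<inter> {x - r..x + r})"
      by (intro loc[OF nd cr(3,4)]) blast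
    then have "negligible (X \<inter> {x - r<..<x + r})" by (rule negligible_subset) auto
    then have "{x - r<..<x + r} \<in> \<F>" by (simp add: \<F>_def)
    then show ?thesis using cr(3) by (intro UnionI[of "{x - r<..<x + r}"]) auto
  qed
  have "AE x in lebesgue. x \<in> {a..b} \<longrightarrow> weakly_nondegenerate_at {a..b} f x"
    using wn unfolding weakly_nondegenerate_def by (subst (asm) AE_restrict_space_iff) auto
  then obtain N where N: "N \<in> null_sets lebesgue" "{x. \<not> (x \<in> {a..b} \<longrightarrow> weakly_nondegenerate_at {a..b} f x)} \<subseteq> N"
    unfolding eventually_ae_filter by auto
  have "negligible N" using N(1) by (simp add: negligible_iff_null_sets)
  moreover have "negligible (\<Union>T\<in>\<F>'. X \<inter> T)"
    using F' by (intro negligible_countable_Union) (auto simp: \<F>_def)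
  ultimately have "negligible (N \<union> (\<Union>T\<in>\<F>'. X \<inter> T))" by (rule negligible_Un)
  moreover have "X \<subseteq> N \<union> (\<Union>T\<in>\<F>'. X \<inter> T)"
  proof
    fix x assume x: "x \<in> X"
    show "x \<in> N \<union> (\<Union>T\<in>\<F>'. X \<inter> T)"
    proof (cases "weakly_nondegenerate_at {a..b} f x")
      case True
      then have "x \<in> \<Union>\<F>'" using cover F'(3) by simp
      then show ?thesis using x by blast
    next
      case False
      then show ?thesis using x X N(2) by blast
    qed
  qed
  ultimately show ?thesis by (rule negligible_subset)
qed

theorem theorem5:
  fixes a b :: real and f :: "real \<Rightarrow> real" and \<psi> :: "nat \<Rightarrow> real"
  assumes "a \<le> b"
    and "\<And>q. q \<ge> 1 \<Longrightarrow> \<psi> q > 0"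
    and "mono_on {1..} \<psi> \<or> antimono_on {1..} \<psi>"
    and "weakly_nondegenerate {a..b} f"
  shows "(summable (\<lambda>q. (\<psi> (Suc q))\<^sup>2) \<longrightarrow>
            simult_approx_set {a..b} f \<psi> \<in> sets lebesgue \<and>
            emeasure lebesgue (simult_approx_set {a..b} f \<psi>) = 0) \<and>
         (\<not> summable (\<lambda>q. (\<psi> (Suc q))\<^sup>2) \<longrightarrow>
            simult_approx_set {a..b} f \<psi> \<in> sets lebesgue \<and>
            emeasure lebesgue (simult_approx_set {a..b} f \<psi>) = ennreal (b - a))"
proof -
  let ?S = "simult_approx_set {a..b} f \<psi>"
  have Ssub: "?S \<subseteq> {a..b}" by (auto simp: simult_approx_set_def)
  note pos = assms(2)
  from assms(3) show ?thesis
  proof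
    assume mono: "mono_on {1..} \<psi>"
    have S: "?S = {a..b}" by (rule simult_approx_set_mono[OF pos mono]) simp
    have "\<not> summable (\<lambda>q. (\<psi> (Suc q))\<^sup>2)"
    proof
      assume "summable (\<lambda>q. (\<psi> (Suc q))\<^sup>2)"
      then have lim: "(\<lambda>q. (\<psi> (Suc q))\<^sup>2) \<longlonglongrightarrow> 0" by (rule summable_LIMSEQ_zero)
      have p1: "0 < \<psi> 1" by (rule pos) simp
      have "(\<psi> 1)\<^sup>2 \<le> (\<psi> (Suc q))\<^sup>2" for q
        using mono p1 by (intro power_mono) (auto simp: monotone_on_def)
      then have "(\<psi> 1)\<^sup>2 \<le> 0" by (intro LIMSEQ_le_const[OF lim]) blast
      then show False using p1 by simp
    qed
    then show ?thesis using assms(1) by (simp add: S)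
  next
    assume anti: "antimono_on {1..} \<psi>"
    show ?thesis
    proof (intro conjI impI)
      assume sum: "summable (\<lambda>q. (\<psi> (Suc q))\<^sup>2)"
      have "negligible ?S"
      proof (rule negligible_locally[OF assms(4) Ssub])
        fix x r
        assume sub: "{x - r..x + r} \<subseteq> {a..b}"
          and c: "(\<exists>c1 c2 D. curved f D (x - r) (x + r) c1 c2) \<or> (\<exists>c1 c2 D. curved (\<lambda>x. - f x) D (x - r) (x + r) c1 c2)"
        from c show "negligible (?S \<inter> {x - r..x + r})"
          unfolding simult_approx_set_restrict[OF sub]
          using curved.convergence[OF _ pos anti sum] simult_approx_set_minus[of _ f] by metis
      qed
      then show "?S \<in> sets lebesgue" "emeasure lebesgue ?S = 0"
        unfolding negligible_iff_null_sets by auto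
    next
      assume div: "\<not> summable (\<lambda>q. (\<psi> (Suc q))\<^sup>2)"
      have "negligible ({a..b} - ?S)"
      proof (rule negligible_locally[OF assms(4)])
        fix x r
        assume sub: "{x - r..x + r} \<subseteq> {a..b}"
          and c: "(\<exists>c1 c2 D. curved f D (x - r) (x + r) c1 c2) \<or> (\<exists>c1 c2 D. curved (\<lambda>x. - f x) D (x - r) (x + r) c1 c2)"
        have "({a..b} - ?S) \<inter> {x - r..x + r} = {x - r..x + r} - simult_approx_set {x - r..x + r} f \<psi>"
          using sub simult_approx_set_restrict[OF sub, of f \<psi>] by blast
        moreover from c have "negligible ({x - r..x + r} - simult_approx_set {x - r..x + r} f \<psi>)"
          using curved.divergence[OF _ pos anti div] simult_approx_set_minus[of _ f] by metis
        ultimately show "negligible (({a..b} - ?S) \<inter> {x - r..x + r})" by (simp only:)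
      qed blast
      then have null: "{a..b} - ?S \<in> null_sets lebesgue" by (simp add: negligible_iff_null_sets)
      \<comment> \<open>\<open>f\<close> may be discontinuous globally, so measurability is deduced
        from completeness: the complement in {a..b} is null.\<close>
      have S: "?S = {a..b} - ({a..b} - ?S)" using Ssub by blast
      have "{a..b} - ({a..b} - ?S) \<in> sets lebesgue"
        by (rule sets.Diff[OF _ null_setsD2[OF null]]) simp
      then show "?S \<in> sets lebesgue" by (simp only: S[symmetric])
      have "emeasure lebesgue ?S = emeasure lebesgue {a..b}"
        by (subst S, rule emeasure_Diff_null_set[OF null]) simp
      then show "emeasure lebesgue ?S = ennreal (b - a)" using assms(1) by simp
    qed
  qed
qed

end
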